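(* There is a function $\varepsilon(n)\to 0$ as $n\to\infty$ such that for every $n\ge 2$, every complete $n$-vertex simple topological graph has a topological subgraph on $m\geq (\log n)^{1/4 - \varepsilon(n)}$ vertices that is weakly isomorphic to $C_m$ or to $T_m$.
   Context: A topological graph is a graph drawn in the plane with vertices as points and edges as non-self-intersecting arcs connecting the corresponding points; arcs do not pass through vertices other than their endpoints, and if two edges share an interior point they properly cross there. It is simple if every pair of edges intersect at most once, either at a common endpoint or at a proper crossing. Two simple topological graphs $G,H$ are weakly isomorphic if there is an incidence-preserving bijection between them such that two edges of $G$ cross if and only if the corresponding edges of $H$ cross. $C_m$ denotes a complete convex geometric graph on $m$ vertices (vertices in convex position, edges straight segments); all such are weakly isomorphic. The complete twisted graph $T_m$ is a complete simple topological graph on $m$ vertices whose vertices can be ordered $v_1,\dots,v_m$ so that edges $v_iv_j$ and $v_kv_\ell$ (with $i<j$, $k<\ell$) cross if and only if $i<k<\ell<j$ or $k<i<j<\ell$. Logarithms are base 2. *)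

theory Defs
  imports "HOL-Analysis.Analysis"
begin

text \<open>The plane is \<^typ>\<open>complex\<close>. Vertices are points of the plane, an edge is the two-element set
  of its end vertices, and \<open>curve\<close> assigns to each edge a parametrised arc drawing it; the values
  of \<open>curve\<close> on non-edges are irrelevant.\<close>

record topgraph =
  verts :: "complex set"
  edges :: "complex set set"
  curve :: "complex set \<Rightarrow> real \<Rightarrow> complex"

text \<open>Two point sets properly cross at \<open>p\<close> if, up to a homeomorphism of a neighbourhood of \<open>p\<close>
  onto the open unit disc, they look there like the horizontal and the vertical diameter.\<close>

definition properly_cross_at :: "complex set \<Rightarrow> complex set \<Rightarrow> complex \<Rightarrow> bool" where
  "properly_cross_at A B p \<longleftrightarrow>
    (\<exists>U h k. open U \<and> p \<in> U \<and> homeomorphism U (ball 0 1) h k \<and> h p = 0 \<and>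
       h ` (U \<inter> A) = {z \<in> ball 0 1. Im z = 0} \<and>
       h ` (U \<inter> B) = {z \<in> ball 0 1. Re z = 0})"

definition edge_arc :: "topgraph \<Rightarrow> complex set \<Rightarrow> complex set" where
  "edge_arc G e = path_image (curve G e)"

definition edge_interior :: "topgraph \<Rightarrow> complex set \<Rightarrow> complex set" where
  "edge_interior G e = edge_arc G e - e"

definition topological_graph :: "topgraph \<Rightarrow> bool" where
  "topological_graph G \<longleftrightarrow>
    finite (verts G) \<and>
    (\<forall>e\<in>edges G. e \<subseteq> verts G \<and> card e = 2) \<and>
    (\<forall>e\<in>edges G. arc (curve G e) \<and> {pathstart (curve G e), pathfinish (curve G e)} = e) \<and>
    (\<forall>e\<in>edges G. edge_arc G e \<inter> verts G = e) \<and>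
    (\<forall>e\<in>edges G. \<forall>e'\<in>edges G. e \<noteq> e' \<longrightarrow>
       (\<forall>p \<in> edge_interior G e \<inter> edge_interior G e'.
          properly_cross_at (edge_arc G e) (edge_arc G e') p))"

definition simple_topological_graph :: "topgraph \<Rightarrow> bool" where
  "simple_topological_graph G \<longleftrightarrow>
    topological_graph G \<and>
    (\<forall>e\<in>edges G. \<forall>e'\<in>edges G. e \<noteq> e' \<longrightarrow>
       edge_arc G e \<inter> edge_arc G e' = {} \<or>
       (\<exists>p. edge_arc G e \<inter> edge_arc G e' = {p} \<and>
            (p \<in> e \<inter> e' \<or> properly_cross_at (edge_arc G e) (edge_arc G e') p)))"

definition complete_graph :: "topgraph \<Rightarrow> bool" where
  "complete_graph G \<longleftrightarrow> edges G = {e. e \<subseteq> verts G \<and> card e = 2}"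

definition cross :: "topgraph \<Rightarrow> complex set \<Rightarrow> complex set \<Rightarrow> bool" where
  "cross G e e' \<longleftrightarrow>
    (\<exists>p \<in> edge_interior G e \<inter> edge_interior G e'.
       properly_cross_at (edge_arc G e) (edge_arc G e') p)"

definition topological_subgraph :: "topgraph \<Rightarrow> topgraph \<Rightarrow> bool" where
  "topological_subgraph H G \<longleftrightarrow>
    topological_graph H \<and> verts H \<subseteq> verts G \<and> edges H \<subseteq> edges G \<and>
    (\<forall>e\<in>edges H. curve H e = curve G e)"

definition weakly_isomorphic :: "topgraph \<Rightarrow> topgraph \<Rightarrow> bool" where
  "weakly_isomorphic G H \<longleftrightarrow>
    simple_topological_graph G \<and> simple_topological_graph H \<and>
    (\<exists>f g. bij_betw f (verts G) (verts H) \<and> bij_betw g (edges G) (edges H) \<and>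
       (\<forall>v\<in>verts G. \<forall>e\<in>edges G. v \<in> e \<longleftrightarrow> f v \<in> g e) \<and>
       (\<forall>e\<in>edges G. \<forall>e'\<in>edges G. cross G e e' \<longleftrightarrow> cross H (g e) (g e')))"

definition convex_position :: "complex set \<Rightarrow> bool" where
  "convex_position V \<longleftrightarrow> (\<forall>v\<in>V. v \<notin> convex hull (V - {v}))"

text \<open>The graphs \<open>C\<^sub>m\<close> and \<open>T\<^sub>m\<close> are only determined up to weak isomorphism, so they are given as
  predicates.\<close>

definition complete_convex_geometric :: "nat \<Rightarrow> topgraph \<Rightarrow> bool" where
  "complete_convex_geometric m G \<longleftrightarrow>
    topological_graph G \<and> complete_graph G \<and> card (verts G) = m \<and>
    convex_position (verts G) \<and>
    (\<forall>u v. {u, v} \<in> edges G \<longrightarrow> edge_arc G {u, v} = closed_segment u v)"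

definition complete_twisted :: "nat \<Rightarrow> topgraph \<Rightarrow> bool" where
  "complete_twisted m G \<longleftrightarrow>
    simple_topological_graph G \<and> complete_graph G \<and> card (verts G) = m \<and>
    (\<exists>v. bij_betw v {1..m} (verts G) \<and>
       (\<forall>i\<in>{1..m}. \<forall>j\<in>{1..m}. \<forall>k\<in>{1..m}. \<forall>l\<in>{1..m}. i < j \<longrightarrow> k < l \<longrightarrow>
          (cross G {v i, v j} {v k, v l} \<longleftrightarrow>
             (i < k \<and> k < l \<and> l < j) \<or> (k < i \<and> i < j \<and> j < l))))"

end

theory Submission
  imports Defs "HOL-Complex_Analysis.Winding_Numbers" "HOL-Real_Asymp.Real_Asymp"
begin

text \<open>
  By the Jordan curve theorem, whether two vertices lie on the same side of a triangle \<open>abc\<close>, or of the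
  curve \<open>apc\<close> formed at a crossing \<open>p\<close> of \<open>ab\<close> and \<open>cd\<close>, is the parity of the crossings of the edge
  joining them with that curve. Together with the non-planarity of \<open>K\<^sub>5\<close> these parities leave only the five
  realizable crossing patterns on five vertices, and they determine the rotation of the edges at a vertex
  \<open>v\<close>.

  Order the other vertices by the rotation at \<open>v\<close> and colour a triple \<open>i < j < k\<close> by \<open>x\<close>, \<open>y\<close>, \<open>z\<close> or \<open>0\<close>
  according to whether \<open>vi\<close> crosses \<open>jk\<close>, \<open>vj\<close> crosses \<open>ik\<close>, \<open>vk\<close> crosses \<open>ij\<close>, or none of these (at most
  one can happen). On five vertices one reads off that the classes \<open>{x}\<close>, \<open>{y}\<close> and \<open>{0, z}\<close> are
  transitive: if \<open>ijk\<close>, \<open>ijl\<close>, \<open>jkl\<close> belong to a class, so does \<open>ikl\<close>. An online version of the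
  Erdos-Szekeres labelling then finds a clique of size \<open>m\<close> in \<open>{x}\<close> or \<open>{y}\<close>, or one of size \<open>m\<^sup>2 + 1\<close> in
  \<open>{0, z}\<close>, among \<open>2 ^ O(m\<^sup>4 log m)\<close> vertices; the latter contains a clique of size \<open>m\<close> in \<open>z\<close> or in
  \<open>0\<close>, because having colour \<open>z\<close> together with the last vertex is a transitive relation on pairs. Cliques of colour \<open>x\<close> and \<open>z\<close> are
  twisted, cliques of colour \<open>y\<close> and \<open>0\<close> are convex.
\<close>

section \<open>Arcs, Jordan curves and crossings\<close>

text \<open>Weak isomorphism only sees which edges cross, and a drawn K_4 has at most one crossing.
  So it suffices to find ordered vertices on which every 4-subset has its crossing at the same
  place. Topology enters through statements about at most six vertices; afterwards the facts about
  five vertices are propositional problems in fifteen crossing variables.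

  The exponent 1/4 comes from counting labels. Target lengths m, m and m^2 for the three classes
  give a box of m * m * m^2 = m^4 label vectors, so T = m^4 + 1 vertices with distinct labels force
  a long path. Fixing the colour towards every earlier vertex would split the reservoir into 3^t
  classes in round t and make log n of order T^2. Remembering one witness per colour costs only a
  factor polynomial in T per round, so log n is of order T log T, and the extra logarithm disappears
  in \<epsilon>.\<close>

definition arc_between :: "complex set \<Rightarrow> complex \<Rightarrow> complex \<Rightarrow> bool" where
  "arc_between A x y \<longleftrightarrow> (\<exists>g. arc g \<and> path_image g = A \<and> pathstart g = x \<and> pathfinish g = y)"

definition jordan_curve :: "complex set \<Rightarrow> bool" where
  "jordan_curve J \<longleftrightarrow> (\<exists>g. simple_path g \<and> pathfinish g = pathstart g \<and> path_image g = J)"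

lemma arc_between_commute: "arc_between A x y \<longleftrightarrow> arc_between A y x"
  unfolding arc_between_def
  by (metis arc_reversepath path_image_reversepath pathfinish_reversepath pathstart_reversepath)

lemma arc_between_ends:
  assumes "arc_between A x y"
  shows "x \<in> A" "y \<in> A" "x \<noteq> y"
  using assms arc_distinct_ends unfolding arc_between_def by blast+

lemma arc_between_closed: "arc_between A x y \<Longrightarrow> closed A"
  unfolding arc_between_def using closed_arc_image by blast

lemma arc_between_endless_connected: "arc_between A x y \<Longrightarrow> connected (A - {x, y})"
  unfolding arc_between_def using arc_imp_simple_path connected_simple_path_endless by blast

text \<open>The open arc is the image of the open unit interval, and continuity carries the closure
  along. This supplies points of an arc arbitrarily close to its end.\<close>

lemma arc_between_dense:
  assumes "arc_between A x y"
  shows "x \<in> closure (A - {x, y})"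
proof -
  obtain g where g: "arc g" "path_image g = A" "pathstart g = x" "pathfinish g = y"
    using assms unfolding arc_between_def by blast
  have "g ` {0<..<1} = A - {x, y}"
    using g simple_path_endless[OF arc_imp_simple_path[OF g(1)]] by simp
  moreover have "g ` closure {0<..<1::real} \<subseteq> closure (g ` {0<..<1})"
    by (rule image_closure_subset) (use arc_imp_path[OF g(1)] in \<open>auto simp: path_def intro: closure_subset[THEN subsetD]\<close>)
  ultimately show ?thesis
    using g(3) unfolding pathstart_def by auto
qed

lemma arc_between_delete_end_connected:
  assumes "arc_between A x y" shows "connected (A - {x})"
proof (rule connected_intermediate_closure)
  show "connected (A - {x, y})" by (rule arc_between_endless_connected[OF assms])
  show "A - {x} \<subseteq> closure (A - {x, y})"
    using arc_between_dense[of A y x] assms arc_between_commute[of A x y] closure_subset[of "A - {x, y}"]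
    by (auto simp: insert_commute)
qed auto

lemma arc_between_split:
  assumes "arc_between A x y" "p \<in> A" "p \<noteq> x" "p \<noteq> y"
  obtains B C where "arc_between B x p" "arc_between C p y" "B \<union> C = A" "B \<inter> C = {p}"
proof -
  obtain g where g: "arc g" "path_image g = A" "pathstart g = x" "pathfinish g = y"
    using assms unfolding arc_between_def by blast
  obtain t where t: "t \<in> {0..1}" "g t = p" using assms(2) g(2) unfolding path_image_def by auto
  have t01: "0 < t" "t < 1"
    using t assms(3,4) g(3,4) unfolding pathstart_def pathfinish_def
    by (metis atLeastAtMost_iff order_le_less)+
  have inj: "inj_on g {0..1}" using g(1) unfolding arc_def by blast
  show thesis
  proof
    show "arc_between (g ` {0..t}) x p"
      unfolding arc_between_def using g t t01
      by (intro exI[of _ "subpath 0 t g"]) (auto simp: arc_subpath_arc path_image_subpath, auto simp: pathstart_def pathfinish_def)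
    show "arc_between (g ` {t..1}) p y"
      unfolding arc_between_def using g t t01
      by (intro exI[of _ "subpath t 1 g"]) (auto simp: arc_subpath_arc path_image_subpath, auto simp: pathstart_def pathfinish_def)
    have "{0..1} = {0..t} \<union> {t..1}" using t01 by auto
    then show "g ` {0..t} \<union> g ` {t..1} = A" using g(2) unfolding path_image_def by (metis image_Un)
    have "g ` {0..t} \<inter> g ` {t..1} = g ` ({0..t} \<inter> {t..1})"
      using t01 by (intro inj_on_image_Int[OF inj, symmetric]) auto
    also have "{0..t} \<inter> {t..1} = {t}" using t01 by auto
    finally show "g ` {0..t} \<inter> g ` {t..1} = {p}" using t by simp
  qed
qed

lemma arc_between_join:
  assumes "arc_between A x y" "arc_between B y z" "A \<inter> B = {y}"
  shows "arc_between (A \<union> B) x z"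
proof -
  obtain g where g: "arc g" "path_image g = A" "pathstart g = x" "pathfinish g = y"
    using assms unfolding arc_between_def by blast
  obtain h where h: "arc h" "path_image h = B" "pathstart h = y" "pathfinish h = z"
    using assms unfolding arc_between_def by blast
  show ?thesis unfolding arc_between_def
    using g h assms(3) by (intro exI[of _ "g +++ h"]) (auto simp: arc_join path_image_join)
qed

lemma jordan_curve_join:
  assumes "arc_between A x y" "arc_between B x y" "A \<inter> B = {x, y}"
  shows "jordan_curve (A \<union> B)"
proof -
  obtain g where g: "arc g" "path_image g = A" "pathstart g = x" "pathfinish g = y"
    using assms unfolding arc_between_def by blast
  obtain h where h: "arc h" "path_image h = B" "pathstart h = y" "pathfinish h = x"
    using assms arc_between_commute[of B x y] unfolding arc_between_def by blast
  show ?thesis unfolding jordan_curve_def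
    using g h assms(3) by (intro exI[of _ "g +++ h"]) (auto simp: simple_path_join_loop path_image_join)
qed

lemma jordan_curve_triangle:
  assumes "arc_between A x y" "arc_between B y z" "arc_between C z x"
    "A \<inter> B = {y}" "B \<inter> C = {z}" "C \<inter> A = {x}"
  shows "jordan_curve (A \<union> B \<union> C)"
proof (rule jordan_curve_join)
  show "arc_between (A \<union> B) x z" using assms arc_between_join by blast
  show "arc_between C x z" using assms arc_between_commute by blast
  show "(A \<union> B) \<inter> C = {x, z}" using assms by blast
qed

lemma jordan_curve_facts:
  assumes "jordan_curve J"
  shows "inside J \<noteq> {}" "open (inside J)" "connected (inside J)" "open (outside J)"
    "connected (outside J)" "\<not> bounded (outside J)" "inside J \<inter> outside J = {}"
    "inside J \<union> outside J = - J" "frontier (inside J) = J" "frontier (outside J) = J"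
    "bounded (inside J)" "closed J"
  using assms Jordan_inside_outside closed_simple_path_image unfolding jordan_curve_def by metis+

section \<open>Side changes of an arc relative to a Jordan curve\<close>

lemma connected_same_side:
  assumes J: "jordan_curve J" and "connected C" "C \<inter> J = {}" "x \<in> C" "y \<in> C"
  shows "x \<in> inside J \<longleftrightarrow> y \<in> inside J"
proof -
  have "inside J \<inter> C = {} \<or> outside J \<inter> C = {}"
    using connectedD[OF \<open>connected C\<close>, of "inside J" "outside J"] jordan_curve_facts[OF J] assms(3)
    by blast
  then show ?thesis using jordan_curve_facts(7,8)[OF J] assms(3-) by blast
qed

text \<open>Here \<open>s\<close> stands for the side of a Jordan curve as a function of time and
  \<open>T\<close> for the crossing times. The induction removes the last flip: before it the
  hypothesis applies, after it \<open>s\<close> is constant.\<close>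

lemma flip_parity:
  fixes s :: "real \<Rightarrow> bool"
  assumes "finite T" "T \<subseteq> {a<..<b}" "a \<le> b"
    and const: "\<And>c d. a \<le> c \<Longrightarrow> c \<le> d \<Longrightarrow> d \<le> b \<Longrightarrow> {c..d} \<inter> T = {} \<Longrightarrow> s c = s d"
    and flip: "\<And>t. t \<in> T \<Longrightarrow> \<exists>\<epsilon>>0. \<forall>r r'. t - \<epsilon> < r \<and> r < t \<and> t < r' \<and> r' < t + \<epsilon> \<longrightarrow> s r \<noteq> s r'"
  shows "s a = s b \<longleftrightarrow> even (card T)"
  using assms
proof (induction "card T" arbitrary: T b)
  case 0
  then have "T = {}" by simp
  with 0(5)[of a b] 0 show ?case by simp
next
  case (Suc n)
  have ne: "T \<noteq> {}" using Suc(2) by auto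
  define t where "t = Max T"
  have t: "t \<in> T" "\<And>r. r \<in> T \<Longrightarrow> r \<le> t" using ne Suc(3) unfolding t_def by auto
  have tab: "a < t" "t < b" using t(1) Suc(4) by auto
  obtain \<epsilon> where e: "\<epsilon> > 0" "\<And>r r'. t - \<epsilon> < r \<Longrightarrow> r < t \<Longrightarrow> t < r' \<Longrightarrow> r' < t + \<epsilon> \<Longrightarrow> s r \<noteq> s r'"
    using Suc(7)[OF t(1)] by blast
  \<comment> \<open>\<open>u\<close> is at least \<open>a\<close>, \<open>t - \<epsilon>\<close> and
    every other flip time, so any \<open>c\<close> in \<open>(u, t)\<close> lies in the window of
    the last flip and after all the others.\<close>
  define u where "u = Max (insert a (insert (t - \<epsilon>) (T - {t})))"
  have u: "a \<le> u" "t - \<epsilon> \<le> u" "\<And>r. r \<in> T - {t} \<Longrightarrow> r \<le> u"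
    unfolding u_def using Suc(3) by (auto intro!: Max_ge simp del: Max_insert)
  have "u < t" unfolding u_def using Suc(3) tab e t by (subst Max_less_iff) (auto simp: order.not_eq_order_implies_strict)
  then obtain c where c: "u < c" "c < t" using dense by blast
  obtain d where d: "t < d" "d < min b (t + \<epsilon>)" using dense[of t "min b (t + \<epsilon>)"] tab e by auto
  have cd: "s c \<noteq> s d" using e(2)[of c d] c d u by auto
  have db: "s d = s b"
    by (rule Suc(6)) (use d tab t(2) in force)+
  have "s a = s c \<longleftrightarrow> even (card (T - {t}))"
  proof (rule Suc(1))
    show "n = card (T - {t})" using Suc(2,3) t by simp
    show "T - {t} \<subseteq> {a<..<c}" using u(3) c Suc(4) by force
    show "s x = s y" if "a \<le> x" "x \<le> y" "y \<le> c" "{x..y} \<inter> (T - {t}) = {}" for x y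
      by (rule Suc(6)) (use that c tab in auto)
    show "\<exists>\<epsilon>>0. \<forall>r r'. x - \<epsilon> < r \<and> r < x \<and> x < r' \<and> r' < x + \<epsilon> \<longrightarrow> s r \<noteq> s r'" if "x \<in> T - {t}" for x
      by (rule Suc(7)) (use that in auto)
  qed (use Suc(3) u c in auto)
  moreover have "card T = Suc (card (T - {t}))" using Suc(3) t(1) by (metis card.remove)
  ultimately show ?case using cd db by auto
qed

text \<open>A proper crossing depends only on the two sets near \<open>p\<close>: shrink the chart
  to the preimage of a small disc contained in the image of \<open>W\<close> and rescale that disc
  to the unit disc. This allows an edge to be replaced by a closed curve that runs along it near the
  crossing.\<close>

lemma properly_cross_at_local:
  assumes "properly_cross_at A B p" "open W" "p \<in> W" "A \<inter> W = A' \<inter> W" "B \<inter> W = B' \<inter> W"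
  shows "properly_cross_at A' B' p"
proof -
  obtain U h k where U: "open U" "p \<in> U" "homeomorphism U (ball 0 1) h k" "h p = 0"
    "h ` (U \<inter> A) = {z \<in> ball 0 1. Im z = 0}" "h ` (U \<inter> B) = {z \<in> ball 0 1. Re z = 0}"
    using assms unfolding properly_cross_at_def by blast
  note hk = homeomorphism_apply1[OF U(3)] homeomorphism_apply2[OF U(3)]
    homeomorphism_image1[OF U(3)] homeomorphism_image2[OF U(3)]
  have "openin (top_of_set (ball 0 1)) (h ` (U \<inter> W))"
    by (rule homeomorphism_imp_open_map[OF U(3)]) (simp add: assms(2) openin_open_Int)
  then have "open (h ` (U \<inter> W))" by (simp add: openin_open_eq)
  moreover have "0 \<in> h ` (U \<inter> W)" using U assms(3) by force
  ultimately obtain r where r: "r > 0" "ball 0 r \<subseteq> h ` (U \<inter> W)"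
    using openE by blast
  have "h ` (U \<inter> W) \<subseteq> ball 0 1" using hk(3) by blast
  then have r1: "ball (0::complex) r \<subseteq> ball 0 1" using r by blast
  define U' where "U' = k ` ball 0 r"
  have U'W: "U' \<subseteq> U \<inter> W"
  proof
    fix x assume "x \<in> U'"
    then obtain y where y: "y \<in> ball 0 r" "x = k y" unfolding U'_def by blast
    then obtain w where "w \<in> U \<inter> W" "y = h w" using r by blast
    then show "x \<in> U \<inter> W" using y hk(1) by auto
  qed
  have op: "open U'"
  proof -
    have "openin (top_of_set U) (k ` ball 0 r)"
      by (rule homeomorphism_imp_open_map[OF homeomorphism_symD[OF U(3)]])
        (use r1 in \<open>auto simp: openin_open_eq\<close>)
    then show ?thesis using U(1) unfolding U'_def by (simp add: openin_open_eq)
  qed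
  have hU': "h ` U' = ball 0 r" unfolding U'_def using hk(2) r1 by (force simp: image_image)
  have H1: "homeomorphism U' (ball 0 r) h k"
    by (rule homeomorphism_of_subsets[OF U(3)]) (use U'W hU' in \<open>auto simp: U'_def\<close>)
  have H2: "homeomorphism (ball (0::complex) r) (ball 0 1) (\<lambda>z. z /\<^sub>R r) (\<lambda>z. r *\<^sub>R z)"
  proof (rule homeomorphismI)
    show "continuous_on (ball 0 r) (\<lambda>z::complex. z /\<^sub>R r)" "continuous_on (ball 0 1) (\<lambda>z::complex. r *\<^sub>R z)"
      by (rule continuous_on_scaleR continuous_on_const continuous_on_id)+
    show "(\<lambda>z. z /\<^sub>R r) ` ball 0 r \<subseteq> ball (0::complex) 1"
      using r(1) by (auto simp: inverse_eq_divide)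
  qed (use r(1) in auto)
  have H: "homeomorphism U' (ball 0 1) ((\<lambda>z. z /\<^sub>R r) \<circ> h) (k \<circ> (\<lambda>z. r *\<^sub>R z))"
    by (rule homeomorphism_compose[OF H1 H2])
  have scale: "(\<lambda>z. z /\<^sub>R r) ` {z \<in> ball 0 r. f z = 0} = {z \<in> ball 0 1. f z = 0}"
    if "\<And>c z. f (c *\<^sub>R z) = c * f z" for f :: "complex \<Rightarrow> real"
  proof (intro set_eqI iffI)
    fix z assume "z \<in> {z \<in> ball 0 1. f z = 0}"
    then show "z \<in> (\<lambda>z. z /\<^sub>R r) ` {z \<in> ball 0 r. f z = 0}"
      using r by (intro image_eqI[of _ _ "r *\<^sub>R z"]) (auto simp: that)
  qed (use r in \<open>auto simp: that field_simps\<close>)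
  have cut: "h ` (U' \<inter> S) = {z \<in> ball 0 r. f z = 0}" if "h ` (U \<inter> S) = {z \<in> ball 0 1. f z = 0}"
    for f :: "complex \<Rightarrow> real" and S
  proof (intro set_eqI iffI)
    fix z assume "z \<in> {z \<in> ball 0 r. f z = 0}"
    then have z: "z \<in> ball 0 r" "z \<in> h ` (U \<inter> S)" using that r1 by auto
    then obtain x where x: "x \<in> U" "x \<in> S" "z = h x" by blast
    then have "x \<in> U'" using z hk(1) unfolding U'_def by force
    with x show "z \<in> h ` (U' \<inter> S)" by blast
  next
    fix z assume "z \<in> h ` (U' \<inter> S)"
    then have "z \<in> h ` U'" "z \<in> h ` (U \<inter> S)" using U'W by auto
    then show "z \<in> {z \<in> ball 0 r. f z = 0}" using hU' that by auto
  qed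
  have AB: "U' \<inter> A' = U' \<inter> A" "U' \<inter> B' = U' \<inter> B" using assms(4,5) U'W by auto
  show ?thesis unfolding properly_cross_at_def
  proof (rule exI[of _ U'], rule exI[of _ "(\<lambda>z. z /\<^sub>R r) \<circ> h"], rule exI[of _ "k \<circ> (\<lambda>z. r *\<^sub>R z)"], intro conjI op H)
    show "p \<in> U'" using hk(1)[OF U(2)] U(4) r unfolding U'_def by force
    show "((\<lambda>z. z /\<^sub>R r) \<circ> h) ` (U' \<inter> A') = {z \<in> ball 0 1. Im z = 0}"
      unfolding AB image_comp[symmetric] cut[OF U(5)] by (rule scale) simp
    show "((\<lambda>z. z /\<^sub>R r) \<circ> h) ` (U' \<inter> B') = {z \<in> ball 0 1. Re z = 0}"
      unfolding AB image_comp[symmetric] cut[OF U(6)] by (rule scale) simp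
  qed (use U(4) in auto)
qed

text \<open>In the chart \<open>J\<close> is the horizontal diameter and \<open>\<gamma>\<close>
  runs in the vertical one. As \<open>\<gamma>\<close> is injective, its height is strictly
  monotone, so it passes from one open half disc to the other. If both halves were on the same side
  of \<open>J\<close>, a whole neighbourhood minus \<open>J\<close> would be, although every point
  of \<open>J\<close> is a boundary point of both \<open>inside J\<close> and
  \<open>outside J\<close>.\<close>

lemma crossing_flips_side:
  assumes J: "jordan_curve J" and \<gamma>: "arc \<gamma>" and t: "0 < t" "t < 1"
    and cr: "properly_cross_at J (path_image \<gamma>) (\<gamma> t)"
  shows "\<exists>\<epsilon>>0. \<forall>r r'. t - \<epsilon> < r \<and> r < t \<and> t < r' \<and> r' < t + \<epsilon> \<longrightarrow>
    (\<gamma> r \<in> inside J) \<noteq> (\<gamma> r' \<in> inside J)"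
proof -
  obtain U h k where U: "open U" "\<gamma> t \<in> U" "homeomorphism U (ball 0 1) h k" "h (\<gamma> t) = 0"
    "h ` (U \<inter> J) = {z \<in> ball 0 1. Im z = 0}" "h ` (U \<inter> path_image \<gamma>) = {z \<in> ball 0 1. Re z = 0}"
    using cr unfolding properly_cross_at_def by blast
  note hk = homeomorphism_apply1[OF U(3)] homeomorphism_apply2[OF U(3)]
    homeomorphism_image1[OF U(3)] homeomorphism_image2[OF U(3)]
  note Jf = jordan_curve_facts[OF J]
  have cont: "continuous_on {0..1} \<gamma>" and inj: "inj_on \<gamma> {0..1}"
    using \<gamma> unfolding arc_def path_def by auto
  have "isCont \<gamma> t"
    using continuous_on_interior[OF cont, of t] t by auto
  then have "filterlim \<gamma> (nhds (\<gamma> t)) (nhds t)"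
    by (simp add: isCont_def tendsto_nhds_iff)
  moreover have "eventually (\<lambda>z. z \<in> U) (nhds (\<gamma> t))" using U(1,2) eventually_nhds by blast
  ultimately have "eventually (\<lambda>s. \<gamma> s \<in> U) (nhds t)" unfolding filterlim_iff by blast
  then obtain e where e: "e > 0" "\<And>s. dist s t < e \<Longrightarrow> \<gamma> s \<in> U"
    unfolding eventually_nhds_metric by blast
  define \<epsilon> where "\<epsilon> = min e (min t (1 - t))"
  have pos: "\<epsilon> > 0" using e t unfolding \<epsilon>_def by auto
  have near: "\<gamma> s \<in> U" "s \<in> {0..1}" if "t - \<epsilon> < s" "s < t + \<epsilon>" for s
    using that e(2)[of s] unfolding \<epsilon>_def dist_real_def by auto
  have pJ: "\<gamma> t \<in> J"
  proof -
    have "h (\<gamma> t) \<in> h ` (U \<inter> J)" using U(4,5) by simp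
    then obtain w where "w \<in> U" "w \<in> J" "h (\<gamma> t) = h w" by blast
    then show ?thesis using hk(1)[of w] hk(1)[OF U(2)] by simp
  qed
  \<comment> \<open>The sign \<open>s\<close> selects the upper or the lower half disc. Each is
    convex, so its image under \<open>k\<close> is connected, and it misses
    \<open>J\<close>.\<close>
  have half: "(x \<in> inside J) = (y \<in> inside J)"
    if "x \<in> U" "y \<in> U" "0 < s * Im (h x)" "0 < s * Im (h y)" for x y s
  proof (rule connected_same_side[OF J])
    let ?H = "ball 0 1 \<inter> {z. 0 < s * Im z}"
    have "convex {z. 0 < s * Im z}"
    proof -
      have "{z. 0 < s * Im z} = {z. inner (Complex 0 s) z > 0}" by (auto simp: inner_complex_def)
      then show ?thesis by (simp only: convex_halfspace_gt)
    qed
    then have "connected ?H" by (intro convex_connected convex_Int) auto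
    then show "connected (k ` ?H)"
      by (rule connected_continuous_image[rotated]) (rule continuous_on_subset[OF homeomorphism_cont2[OF U(3)]], auto)
    show "k ` ?H \<inter> J = {}"
    proof (rule ccontr)
      assume "k ` ?H \<inter> J \<noteq> {}"
      then obtain z where z: "z \<in> ?H" "k z \<in> J" by blast
      then have "k z \<in> U \<inter> J" using hk(4) by blast
      then have "h (k z) \<in> {z \<in> ball 0 1. Im z = 0}" using U(5) by blast
      then show False using z hk(2) by auto
    qed
    have "h x \<in> ball 0 1" "h y \<in> ball 0 1" using that hk(3) by blast+
    then have xH: "h x \<in> ?H" and yH: "h y \<in> ?H" using that(3,4) by simp_all
    show "x \<in> k ` ?H" using imageI[OF xH, of k] unfolding hk(1)[OF that(1)] .
    show "y \<in> k ` ?H" using imageI[OF yH, of k] unfolding hk(1)[OF that(2)] .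
  qed
  have "(\<gamma> r \<in> inside J) \<noteq> (\<gamma> r' \<in> inside J)"
    if r: "t - \<epsilon> < r" "r < t" "t < r'" "r' < t + \<epsilon>" for r r'
  proof
    assume eq: "(\<gamma> r \<in> inside J) = (\<gamma> r' \<in> inside J)"
    define f where "f = (\<lambda>s. Im (h (\<gamma> s)))"
    have sub: "s \<in> {0..1}" "\<gamma> s \<in> U" if "s \<in> {r..r'}" for s
      using near[of s] that r by auto
    have re: "Re (h (\<gamma> s)) = 0" if "s \<in> {r..r'}" for s
    proof -
      have "h (\<gamma> s) \<in> h ` (U \<inter> path_image \<gamma>)" using sub[OF that] unfolding path_image_def by blast
      then show ?thesis using U(6) by auto
    qed
    have contf: "continuous_on {r..r'} f" unfolding f_def
      by (intro continuous_on_Im continuous_on_compose2[OF homeomorphism_cont1[OF U(3)]]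
          continuous_on_subset[OF cont]) (use sub in auto)
    have injf: "inj_on f {r..r'}"
    proof (rule inj_onI)
      fix x y assume xy: "x \<in> {r..r'}" "y \<in> {r..r'}" "f x = f y"
      then have "h (\<gamma> x) = h (\<gamma> y)" using re[OF xy(1)] re[OF xy(2)] xy(3) unfolding f_def complex_eq_iff by simp
      then have "\<gamma> x = \<gamma> y" using hk(1)[OF sub(2)[OF xy(1)]] hk(1)[OF sub(2)[OF xy(2)]] by metis
      then show "x = y" using inj_onD[OF inj _ sub(1)[OF xy(1)] sub(1)[OF xy(2)]] by blast
    qed
    have "f t = 0" using U(4) unfolding f_def by simp
    then have "f r < 0 \<and> 0 < f r' \<or> f r' < 0 \<and> 0 < f r"
      using continuous_inj_imp_mono[OF r(2,3) contf injf] by auto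
    then obtain s :: real where s: "s = 1 \<or> s = -1" "0 < s * f r" "0 < - s * f r'"
      by (elim disjE) (use that[of "-1"] that[of 1] in auto)
    have all: "(x \<in> inside J) = (\<gamma> r \<in> inside J)" if "x \<in> U - J" for x
    proof -
      have "Im (h x) \<noteq> 0"
      proof
        assume "Im (h x) = 0"
        then have "h x \<in> h ` (U \<inter> J)" using that hk(3) U(5) by blast
        then obtain w where "w \<in> U" "w \<in> J" "h x = h w" by blast
        then show False using that hk(1)[of w] hk(1)[of x] by simp
      qed
      then have "0 < s * Im (h x) \<or> 0 < - s * Im (h x)" using s(1) by auto
      moreover have "\<gamma> r \<in> U" "\<gamma> r' \<in> U" using sub r by auto
      ultimately show ?thesis
        using half[of x "\<gamma> r" s] half[of x "\<gamma> r'" "-s"] that s(2,3) eq unfolding f_def by blast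
    qed
    have "\<gamma> t \<in> closure (inside J)" "\<gamma> t \<in> closure (outside J)"
      using pJ Jf(9,10) unfolding frontier_def by blast+
    then have "U \<inter> inside J \<noteq> {}" "U \<inter> outside J \<noteq> {}"
      using open_Int_closure_eq_empty[OF U(1)] U(2) by blast+
    then obtain x y where "x \<in> U" "x \<in> inside J" "y \<in> U" "y \<in> outside J" by blast
    then show False using all[of x] all[of y] Jf(7,8) by blast
  qed
  then show ?thesis using pos by blast
qed

lemma arc_crossing_parity:
  assumes J: "jordan_curve J" and A: "arc_between A u v" and "u \<notin> J" "v \<notin> J"
    and fin: "finite (A \<inter> J)" and cr: "\<And>p. p \<in> A \<inter> J \<Longrightarrow> properly_cross_at J A p"
  shows "(u \<in> inside J \<longleftrightarrow> v \<in> inside J) \<longleftrightarrow> even (card (A \<inter> J))"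
proof -
  obtain g where g: "arc g" "path_image g = A" "pathstart g = u" "pathfinish g = v"
    using A unfolding arc_between_def by blast
  have cont: "continuous_on {0..1} g" and inj: "inj_on g {0..1}"
    using g(1) unfolding arc_def path_def by auto
  define T where "T = {t \<in> {0..1}. g t \<in> J}"
  have gT: "g ` T = A \<inter> J" using g(2) unfolding T_def path_image_def by auto
  have injT: "inj_on g T" by (rule inj_on_subset[OF inj]) (auto simp: T_def)
  have finT: "finite T" using fin gT injT finite_image_iff by metis
  have T01: "T \<subseteq> {0<..<1}"
  proof
    fix t assume t: "t \<in> T"
    then have "t \<noteq> 0" "t \<noteq> 1" using g(3,4) assms(3,4) unfolding T_def pathstart_def pathfinish_def by auto
    then show "t \<in> {0<..<1}" using t unfolding T_def by auto
  qed
  have "(g 0 \<in> inside J) = (g 1 \<in> inside J) \<longleftrightarrow> even (card T)"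
  proof (rule flip_parity[OF finT T01])
    fix c d :: real assume cd: "0 \<le> c" "c \<le> d" "d \<le> 1" "{c..d} \<inter> T = {}"
    show "(g c \<in> inside J) = (g d \<in> inside J)"
    proof (rule connected_same_side[OF J])
      show "connected (g ` {c..d})"
        by (intro connected_continuous_image continuous_on_subset[OF cont]) (use cd in auto)
      show "g ` {c..d} \<inter> J = {}" using cd unfolding T_def by fastforce
    qed (use cd in auto)
  next
    fix t assume "t \<in> T"
    then show "\<exists>\<epsilon>>0. \<forall>r r'. t - \<epsilon> < r \<and> r < t \<and> t < r' \<and> r' < t + \<epsilon> \<longrightarrow> (g r \<in> inside J) \<noteq> (g r' \<in> inside J)"
      by (intro crossing_flips_side[OF J g(1)]) (use T01 cr gT g(2) in auto)
  qed auto
  then show ?thesis using g(3,4) card_image[OF injT] gT unfolding pathstart_def pathfinish_def by simp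
qed

section \<open>The local picture at a crossing, and theta curves\<close>

text \<open>The diameter \<open>f = 0\<close> without its centre consists of two rays, told apart by
  the sign of \<open>g\<close>. The preimage of a ray is connected and avoids the only common point
  of the closed sets \<open>A\<close> and \<open>B\<close>, so it lies in one of them; a point
  \<open>y\<close> of \<open>B\<close> near \<open>p\<close> selects a ray contained in
  \<open>B\<close>. The functions \<open>f\<close>, \<open>g\<close> are \<open>Im\<close>,
  \<open>Re\<close> for one diameter and \<open>Re\<close>, \<open>Im\<close> for the other.\<close>

lemma arc_halves:
  fixes f g :: "complex \<Rightarrow> real"
  assumes U: "open U" "p \<in> U" "homeomorphism U (ball 0 1) h k" "h p = 0"
    and A: "arc_between A a p" and B: "arc_between B p b" and AB: "A \<inter> B = {p}"
    and h: "h ` (U \<inter> (A \<union> B)) = {z \<in> ball 0 1. f z = 0}"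
    and fg: "\<And>z. f z = 0 \<Longrightarrow> g z = 0 \<Longrightarrow> z = 0" "g 0 = 0"
    and con: "\<And>s. connected {z \<in> ball 0 1. f z = 0 \<and> 0 < s * g z}"
  obtains s y where "s = 1 \<or> s = - 1" "y \<in> B \<inter> U" "y \<noteq> p" "f (h y) = 0" "0 < s * g (h y)"
    "\<And>x. x \<in> U \<Longrightarrow> f (h x) = 0 \<Longrightarrow> 0 < s * g (h x) \<Longrightarrow> x \<in> B"
proof -
  note hk = homeomorphism_apply1[OF U(3)] homeomorphism_apply2[OF U(3)]
    homeomorphism_image1[OF U(3)] homeomorphism_image2[OF U(3)]
  have "p \<in> closure (B - {p, b})" by (rule arc_between_dense[OF B])
  then obtain y where y: "y \<in> B" "y \<noteq> p" "y \<in> U"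
    using U(2) open_Int_closure_eq_empty[OF U(1), of "B - {p, b}"] by blast
  have fy: "f (h y) = 0" using h y by blast
  have "h y \<noteq> 0" using hk(1)[OF y(3)] hk(1)[OF U(2)] y(2) U(4) by auto
  then have "g (h y) \<noteq> 0" using fg fy by auto
  then obtain s :: real where s: "s = 1 \<or> s = -1" "0 < s * g (h y)"
    by (cases "g (h y) > 0") (use that[of 1] that[of "-1"] in auto)
  let ?R = "{z \<in> ball 0 1. f z = 0 \<and> 0 < s * g z}"
  have "connected (k ` ?R)"
    by (rule connected_continuous_image[OF _ con]) (rule continuous_on_subset[OF homeomorphism_cont2[OF U(3)]], auto)
  moreover have R: "k ` ?R \<subseteq> A \<union> B" "p \<notin> k ` ?R"
  proof -
    show "k ` ?R \<subseteq> A \<union> B"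
    proof
      fix x assume "x \<in> k ` ?R"
      then obtain z where z: "z \<in> ?R" "x = k z" by blast
      then have "z \<in> h ` (U \<inter> (A \<union> B))" using h by auto
      then obtain w where "w \<in> U" "w \<in> A \<union> B" "z = h w" by blast
      then show "x \<in> A \<union> B" using z hk(1) by auto
    qed
    show "p \<notin> k ` ?R"
    proof
      assume "p \<in> k ` ?R"
      then obtain z where "z \<in> ?R" "p = k z" by blast
      then show False using U(4) hk(2)[of z] fg(2) by auto
    qed
  qed
  moreover have "closed A" "closed B" using A B arc_between_closed by auto
  moreover have "A \<inter> B \<inter> k ` ?R = {}" unfolding AB using R(2) by simp
  ultimately have "A \<inter> k ` ?R = {} \<or> B \<inter> k ` ?R = {}"
    using connected_closedD[of "k ` ?R" A B] by blast
  moreover have yR: "y \<in> k ` ?R" using y fy s hk(3) by (intro image_eqI[of _ k "h y"]) (auto simp: hk(1))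
  ultimately have RB: "k ` ?R \<subseteq> B" using y R(1) by blast
  show thesis
  proof
    show "x \<in> B" if "x \<in> U" "f (h x) = 0" "0 < s * g (h x)" for x
    proof -
      have "x \<in> k ` ?R" using that hk(3) by (intro image_eqI[of _ k "h x"]) (auto simp: hk(1))
      then show ?thesis using RB by blast
    qed
  qed (use y s fy in auto)
qed

text \<open>The quadrant of the chart between the rays in \<open>A2\<close> and \<open>C2\<close> is
  connected and misses the closed curve formed by \<open>A1\<close>, \<open>C1\<close> and
  \<open>D\<close>. From this quadrant one reaches \<open>b\<close> along \<open>A2\<close> and
  \<open>d\<close> along \<open>C2\<close> without meeting the curve.\<close>

lemma crossing_ends_same_side:
  assumes A: "arc_between A1 a p" "arc_between A2 p b" "A1 \<inter> A2 = {p}"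
    and C: "arc_between C1 c p" "arc_between C2 p d" "C1 \<inter> C2 = {p}"
    and cr: "properly_cross_at (A1 \<union> A2) (C1 \<union> C2) p"
    and AC: "(A1 \<union> A2) \<inter> (C1 \<union> C2) = {p}"
    and D: "arc_between D a c" "D \<inter> (A1 \<union> A2) = {a}" "D \<inter> (C1 \<union> C2) = {c}"
  shows "jordan_curve (A1 \<union> C1 \<union> D)"
    and "b \<in> inside (A1 \<union> C1 \<union> D) \<longleftrightarrow> d \<in> inside (A1 \<union> C1 \<union> D)"
proof -
  have ends: "a \<in> A1" "p \<in> A1" "a \<noteq> p" "p \<in> A2" "b \<in> A2" "p \<noteq> b" "c \<in> C1" "p \<in> C1" "c \<noteq> p"
    "p \<in> C2" "d \<in> C2" "p \<noteq> d"
    using arc_between_ends[OF A(1)] arc_between_ends[OF A(2)] arc_between_ends[OF C(1)] arc_between_ends[OF C(2)] by simp_all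
  let ?J = "A1 \<union> C1 \<union> D"
  show J: "jordan_curve ?J"
  proof (rule jordan_curve_triangle)
    show "arc_between A1 a p" "arc_between C1 p c" "arc_between D c a"
      using A C D arc_between_commute by blast+
    show "A1 \<inter> C1 = {p}" using AC ends by blast
    show "C1 \<inter> D = {c}" using D(3) ends by blast
    show "D \<inter> A1 = {a}" using D(2) ends by blast
  qed
  have pD: "p \<notin> D" using D(2) ends by auto
  \<comment> \<open>Adding \<open>D\<close> to both sets makes the chart avoid \<open>D\<close>
    automatically: a point of \<open>D\<close> in \<open>U\<close> would lie on both diameters and
    hence be \<open>p\<close>.\<close>
  have "properly_cross_at (A1 \<union> A2 \<union> D) (C1 \<union> C2 \<union> D) p"
    by (rule properly_cross_at_local[OF cr, of "- D"]) (use pD arc_between_closed[OF D(1)] in auto)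
  then obtain U h k where U: "open U" "p \<in> U" "homeomorphism U (ball 0 1) h k" "h p = 0"
    "h ` (U \<inter> (A1 \<union> A2 \<union> D)) = {z \<in> ball 0 1. Im z = 0}"
    "h ` (U \<inter> (C1 \<union> C2 \<union> D)) = {z \<in> ball 0 1. Re z = 0}"
    unfolding properly_cross_at_def by blast
  note hk = homeomorphism_apply1[OF U(3)] homeomorphism_apply2[OF U(3)]
    homeomorphism_image1[OF U(3)] homeomorphism_image2[OF U(3)]
  have UD: "U \<inter> D = {}"
  proof (rule ccontr)
    assume "U \<inter> D \<noteq> {}"
    then obtain x where x: "x \<in> U" "x \<in> D" by blast
    then have "h x \<in> {z \<in> ball 0 1. Im z = 0}" "h x \<in> {z \<in> ball 0 1. Re z = 0}" using U(5,6) by blast+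
    then have "h x = 0" by (simp add: complex_eq_iff)
    then have "x = p" using hk(1)[OF x(1)] hk(1)[OF U(2)] U(4) by simp
    then show False using x pD by simp
  qed
  have hA: "h ` (U \<inter> (A1 \<union> A2)) = {z \<in> ball 0 1. Im z = 0}"
    and hC: "h ` (U \<inter> (C1 \<union> C2)) = {z \<in> ball 0 1. Re z = 0}"
    using U(5,6) UD by (simp_all add: Int_Un_distrib)
  have con1: "connected {z \<in> ball 0 1. Im z = 0 \<and> 0 < s * Re z}" for s
  proof -
    have "{z \<in> ball 0 1. Im z = 0 \<and> 0 < s * Re z} =
        ball 0 1 \<inter> {z. inner \<i> z = 0} \<inter> {z. inner (Complex s 0) z > 0}" by (auto simp: inner_complex_def)
    then show ?thesis
      by (simp only:) (intro convex_connected convex_Int convex_ball convex_hyperplane convex_halfspace_gt)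
  qed
  have con2: "connected {z \<in> ball 0 1. Re z = 0 \<and> 0 < s * Im z}" for s
  proof -
    have "{z \<in> ball 0 1. Re z = 0 \<and> 0 < s * Im z} =
        ball 0 1 \<inter> {z. inner 1 z = 0} \<inter> {z. inner (Complex 0 s) z > 0}" by (auto simp: inner_complex_def)
    then show ?thesis
      by (simp only:) (intro convex_connected convex_Int convex_ball convex_hyperplane convex_halfspace_gt)
  qed
  have zero: "Im z = 0 \<Longrightarrow> Re z = 0 \<Longrightarrow> z = 0" "Re z = 0 \<Longrightarrow> Im z = 0 \<Longrightarrow> z = 0" for z
    by (simp_all add: complex_eq_iff)
  obtain s y where s: "s = 1 \<or> s = - 1" "y \<in> A2 \<inter> U" "y \<noteq> p" "Im (h y) = 0" "0 < s * Re (h y)"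
    "\<And>x. x \<in> U \<Longrightarrow> Im (h x) = 0 \<Longrightarrow> 0 < s * Re (h x) \<Longrightarrow> x \<in> A2"
    by (rule arc_halves[OF U(1-4) A hA zero(1) _ con1]) simp_all
  obtain q w where q: "q = 1 \<or> q = - 1" "w \<in> C2 \<inter> U" "w \<noteq> p" "Re (h w) = 0" "0 < q * Im (h w)"
    "\<And>x. x \<in> U \<Longrightarrow> Re (h x) = 0 \<Longrightarrow> 0 < q * Im (h x) \<Longrightarrow> x \<in> C2"
    by (rule arc_halves[OF U(1-4) C hC zero(2) _ con2]) simp_all
  \<comment> \<open>A closed quadrant with the origin removed by the strict third inequality;
    written as an intersection of a ball with half planes it is visibly convex.\<close>
  let ?Q = "ball 0 1 \<inter> {z. inner (Complex s 0) z \<ge> 0} \<inter> {z. inner (Complex 0 q) z \<ge> 0} \<inter> {z. inner (Complex s q) z > 0}"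
  have inQ: "z \<in> ?Q \<longleftrightarrow> norm z < 1 \<and> s * Re z \<ge> 0 \<and> q * Im z \<ge> 0 \<and> s * Re z + q * Im z > 0" for z
    by (auto simp: inner_complex_def)
  have "convex ?Q" by (intro convex_Int convex_ball convex_halfspace_ge convex_halfspace_gt)
  then have conQ: "connected (k ` ?Q)"
    by (intro connected_continuous_image convex_connected continuous_on_subset[OF homeomorphism_cont2[OF U(3)]]) auto
  have disQ: "k ` ?Q \<inter> ?J = {}"
  proof (rule ccontr)
    assume "k ` ?Q \<inter> ?J \<noteq> {}"
    then obtain z where z: "z \<in> ?Q" "k z \<in> ?J" by blast
    have zb: "z \<in> ball 0 1" using z(1) by simp
    have kU: "k z \<in> U" and hz: "h (k z) = z" using hk(2)[OF zb] imageI[OF zb, of k] hk(4) by simp_all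
    have kp: "k z \<noteq> p" using z(1)[unfolded inQ] hz U(4) by auto
    consider "k z \<in> A1" | "k z \<in> C1" using z UD kU by blast
    then show False
    proof cases
      case 1
      then have "h (k z) \<in> h ` (U \<inter> (A1 \<union> A2))" using kU by blast
      then have "Im z = 0" unfolding hA hz by simp
      then have "k z \<in> A2" using s(6)[OF kU] hz z(1)[unfolded inQ] by simp
      then show False using 1 A(3) kp by blast
    next
      case 2
      then have "h (k z) \<in> h ` (U \<inter> (C1 \<union> C2))" using kU by blast
      then have "Re z = 0" unfolding hC hz by simp
      then have "k z \<in> C2" using q(6)[OF kU] hz z(1)[unfolded inQ] by simp
      then show False using 2 C(3) kp by blast
    qed
  qed
  have ywQ: "y \<in> k ` ?Q" "w \<in> k ` ?Q"
  proof -
    have "h y \<in> ball 0 1" "h w \<in> ball 0 1" using s(2) q(2) hk(3) by blast+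
    then have yQ: "h y \<in> ?Q" and wQ: "h w \<in> ?Q" unfolding inQ using s(4,5) q(4,5) by auto
    have hky: "k (h y) = y" and hkw: "k (h w) = w" using hk(1) s(2) q(2) by simp_all
    show "y \<in> k ` ?Q" using imageI[OF yQ, of k] unfolding hky .
    show "w \<in> k ` ?Q" using imageI[OF wQ, of k] unfolding hkw .
  qed
  have "y \<in> inside ?J \<longleftrightarrow> w \<in> inside ?J" by (rule connected_same_side[OF J conQ disQ ywQ])
  moreover have "b \<in> inside ?J \<longleftrightarrow> y \<in> inside ?J"
  proof (rule connected_same_side[OF J arc_between_delete_end_connected[OF A(2)]])
    have "a \<notin> A2" using A(3) ends(1,3) by blast
    moreover have "A2 \<inter> D \<subseteq> {a}" unfolding D(2)[symmetric] by blast
    moreover have "A2 \<inter> C1 \<subseteq> {p}" using AC by blast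
    moreover note A(3)
    ultimately show "(A2 - {p}) \<inter> ?J = {}" by blast
  qed (use ends s(2,3) in auto)
  moreover have "d \<in> inside ?J \<longleftrightarrow> w \<in> inside ?J"
  proof (rule connected_same_side[OF J arc_between_delete_end_connected[OF C(2)]])
    have "c \<notin> C2" using C(3) ends(7,9) by blast
    moreover have "C2 \<inter> D \<subseteq> {c}" unfolding D(3)[symmetric] by blast
    moreover have "C2 \<inter> A1 \<subseteq> {p}" using AC by blast
    moreover note C(3)
    ultimately show "(C2 - {p}) \<inter> ?J = {}" by blast
  qed (use ends q(2,3) in auto)
  ultimately show "b \<in> inside ?J \<longleftrightarrow> d \<in> inside ?J" by simp
qed

text \<open>A loop has winding number 1 or -1 around its inside points and 0 around its outside
  points. The winding number of each of the three loops is a difference of the winding numbers of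
  two arcs, so the loop values add up.\<close>

lemma theta_parity:
  assumes arcs: "arc_between A x y" "arc_between B x y" "arc_between C x y"
    and int: "A \<inter> B = {x, y}" "B \<inter> C = {x, y}" "A \<inter> C = {x, y}"
    and z: "z \<notin> A \<union> B \<union> C"
  shows "z \<in> inside (A \<union> B) \<longleftrightarrow> (z \<in> inside (B \<union> C)) \<noteq> (z \<in> inside (A \<union> C))"
proof -
  obtain a where a: "arc a" "path_image a = A" "pathstart a = x" "pathfinish a = y"
    using arcs unfolding arc_between_def by blast
  obtain b where b: "arc b" "path_image b = B" "pathstart b = x" "pathfinish b = y"
    using arcs unfolding arc_between_def by blast
  obtain c where c: "arc c" "path_image c = C" "pathstart c = x" "pathfinish c = y"
    using arcs unfolding arc_between_def by blast
  have loop: "(z \<in> inside (P \<union> Q) \<longrightarrow> winding_number p z - winding_number q z \<in> {1, -1}) \<and>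
      (z \<notin> inside (P \<union> Q) \<longrightarrow> winding_number p z - winding_number q z = 0)"
    if p: "arc p" "path_image p = P" "pathstart p = x" "pathfinish p = y"
      and q: "arc q" "path_image q = Q" "pathstart q = x" "pathfinish q = y"
      and PQ: "P \<inter> Q = {x, y}" "z \<notin> P" "z \<notin> Q" for p q P Q
  proof -
    let ?g = "p +++ reversepath q"
    have im: "path_image ?g = P \<union> Q" using p q by (simp add: path_image_join)
    have sg: "simple_path ?g"
      by (rule simple_path_join_loop) (use p q PQ in \<open>auto simp: arc_reversepath\<close>)
    have cl: "pathfinish ?g = pathstart ?g" using p q by simp
    have w: "winding_number ?g z = winding_number p z - winding_number q z"
      using p q PQ arc_imp_path by (subst winding_number_join) (auto simp: winding_number_reversepath)
    have "winding_number ?g z \<in> {1, -1}" if "z \<in> inside (P \<union> Q)"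
      using simple_closed_path_winding_number_inside[OF sg] that im by (metis insertCI)
    moreover have "winding_number ?g z = 0" if "z \<notin> inside (P \<union> Q)"
    proof (rule winding_number_zero_in_outside[OF simple_path_imp_path[OF sg] cl])
      have "z \<in> inside (P \<union> Q) \<union> outside (P \<union> Q)" unfolding inside_Un_outside using PQ(2,3) by simp
      then show "z \<in> outside (path_image ?g)" unfolding im using that by blast
    qed
    ultimately show ?thesis using w by auto
  qed
  have z': "z \<notin> A" "z \<notin> B" "z \<notin> C" using z by auto
  \<comment> \<open>All of \<open>\<alpha>\<close>, \<open>\<beta>\<close> and
    \<open>\<alpha> + \<beta>\<close> lie in {-1, 0, 1}, so the sum is nonzero precisely if exactly
    one summand is.\<close>
  define \<alpha> \<beta> where "\<alpha> = winding_number a z - winding_number b z" and "\<beta> = winding_number b z - winding_number c z"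
  have "winding_number a z - winding_number c z = \<alpha> + \<beta>" unfolding \<alpha>_def \<beta>_def by simp
  then show ?thesis
    using loop[OF a b int(1) z'(1,2)] loop[OF b c int(2) z'(2,3)] loop[OF a c int(3) z'(1,3)]
    unfolding \<alpha>_def[symmetric] \<beta>_def[symmetric] by auto
qed

text \<open>Each piece holds at most one point, so the parity of the number of hits is the exclusive
  or of the nonemptiness of the pieces. Curves with fewer pieces are handled by empty sets.\<close>

lemma arc_crossing_parity3:
  assumes J: "jordan_curve J" and A: "arc_between A u v" and uv: "u \<notin> J" "v \<notin> J"
    and AJ: "A \<inter> J = P \<union> Q \<union> R" and dis: "P \<inter> Q = {}" "Q \<inter> R = {}" "P \<inter> R = {}"
    and sing: "P = {} \<or> (\<exists>p. P = {p})" "Q = {} \<or> (\<exists>p. Q = {p})" "R = {} \<or> (\<exists>p. R = {p})"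
    and cr: "\<And>p. p \<in> P \<union> Q \<union> R \<Longrightarrow> properly_cross_at J A p"
  shows "(u \<in> inside J) \<noteq> (v \<in> inside J) \<longleftrightarrow> ((P \<noteq> {}) \<noteq> ((Q \<noteq> {}) \<noteq> (R \<noteq> {})))"
proof -
  have fin: "finite P" "finite Q" "finite R" using sing by auto
  have par: "(u \<in> inside J \<longleftrightarrow> v \<in> inside J) \<longleftrightarrow> even (card (A \<inter> J))"
    by (rule arc_crossing_parity[OF J A uv]) (use fin cr AJ in auto)
  have "card (A \<inter> J) = card P + card Q + card R"
    unfolding AJ using fin dis by (subst card_Un_disjoint; (subst card_Un_disjoint)?) auto
  moreover have "odd (card P) \<longleftrightarrow> P \<noteq> {}" "odd (card Q) \<longleftrightarrow> Q \<noteq> {}" "odd (card R) \<longleftrightarrow> R \<noteq> {}"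
    using sing by auto
  ultimately show ?thesis using par by auto
qed

lemma Int_singletonD: "A \<inter> B = {x} \<Longrightarrow> q \<in> A \<Longrightarrow> q \<in> B \<Longrightarrow> q = x"
  by auto

lemma subset_at_most_singleton:
  "A = {} \<or> (\<exists>p. A = {p}) \<Longrightarrow> B \<subseteq> A \<Longrightarrow> B = {} \<or> (\<exists>p. B = {p})"
  by (metis subset_empty subset_singletonD)

section \<open>Crossings in a simple drawing of a complete graph\<close>

text \<open>Edges become a symmetric function of two vertices and only their point sets are kept, so
  that facts about a few vertices can be instantiated at any permutation of them.\<close>

locale simple_drawing =
  fixes V :: "complex set" and E :: "complex \<Rightarrow> complex \<Rightarrow> complex set"
  assumes E_commute: "E u v = E v u"
    and E_arc: "u \<in> V \<Longrightarrow> v \<in> V \<Longrightarrow> u \<noteq> v \<Longrightarrow> arc_between (E u v) u v"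
    and E_vertex: "{u, v, w} \<subseteq> V \<Longrightarrow> distinct [u, v, w] \<Longrightarrow> w \<notin> E u v"
    and E_adjacent: "{u, v, w} \<subseteq> V \<Longrightarrow> distinct [u, v, w] \<Longrightarrow> E u v \<inter> E u w = {u}"
    and E_disjoint: "{u, v, w, x} \<subseteq> V \<Longrightarrow> distinct [u, v, w, x] \<Longrightarrow>
      E u v \<inter> E w x = {} \<or> (\<exists>p. E u v \<inter> E w x = {p} \<and> properly_cross_at (E u v) (E w x) p)"
begin

text \<open>Adjacent edges satisfy this too, through their common end; it means a crossing only for
  four distinct vertices, and the statements about crossings below ensure distinctness.\<close>

definition X :: "complex \<Rightarrow> complex \<Rightarrow> complex \<Rightarrow> complex \<Rightarrow> bool" where
  "X a b c d \<longleftrightarrow> E a b \<inter> E c d \<noteq> {}"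

definition tri :: "complex \<Rightarrow> complex \<Rightarrow> complex \<Rightarrow> complex set" where
  "tri a b c = E a b \<union> E b c \<union> E a c"

lemma X_swap: "X a b c d \<longleftrightarrow> X c d a b" and X_flip: "X a b c d \<longleftrightarrow> X b a c d" "X a b c d \<longleftrightarrow> X a b d c"
  unfolding X_def using E_commute[of a b] E_commute[of c d] by auto

lemma tri_commute: "tri a b c = tri b a c" "tri a b c = tri a c b"
  unfolding tri_def using E_commute[of a b] E_commute[of b c] E_commute[of a c] by auto

lemma adj:
  assumes "{u, v, w} \<subseteq> V" "distinct [u, v, w]"
  shows "E u v \<inter> E u w = {u}" "E v u \<inter> E u w = {u}" "E u v \<inter> E w u = {u}" "E v u \<inter> E w u = {u}"
  using E_adjacent[OF assms] E_commute by metis+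

lemma ends_in_E: "u \<in> V \<Longrightarrow> v \<in> V \<Longrightarrow> u \<noteq> v \<Longrightarrow> u \<in> E u v \<and> v \<in> E u v"
  using E_arc arc_between_ends by blast

lemma closed_E: "u \<in> V \<Longrightarrow> v \<in> V \<Longrightarrow> u \<noteq> v \<Longrightarrow> closed (E u v)"
  using E_arc arc_between_closed by blast

lemma tri_jordan:
  assumes "{a, b, c} \<subseteq> V" "distinct [a, b, c]"
  shows "jordan_curve (tri a b c)"
  unfolding tri_def
proof (rule jordan_curve_triangle)
  show "arc_between (E a b) a b" "arc_between (E b c) b c" using E_arc assms by auto
  show "arc_between (E a c) c a" using E_arc[of a c] assms arc_between_commute by auto
  show "E a b \<inter> E b c = {b}" by (rule adj) (use assms in auto)
  show "E b c \<inter> E a c = {c}" by (rule adj) (use assms in auto)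
  show "E a c \<inter> E a b = {a}" by (rule adj) (use assms in auto)
qed

lemma crossing_single:
  assumes "{u, v, w, x} \<subseteq> V" "distinct [u, v, w, x]"
  shows "E u v \<inter> E w x = {} \<or> (\<exists>p. E u v \<inter> E w x = {p})"
    and "p \<in> E u v \<inter> E w x \<Longrightarrow> properly_cross_at (E u v) (E w x) p"
proof -
  show "E u v \<inter> E w x = {} \<or> (\<exists>p. E u v \<inter> E w x = {p})" using E_disjoint[OF assms] by metis
  assume "p \<in> E u v \<inter> E w x"
  then show "properly_cross_at (E u v) (E w x) p" using E_disjoint[OF assms] by (metis empty_iff singletonD)
qed

lemma triangle_side:
  assumes V: "{a, b, c, d, e} \<subseteq> V" and dist: "distinct [a, b, c, d, e]"
  shows "(d \<in> inside (tri a b c)) \<noteq> (e \<in> inside (tri a b c)) \<longleftrightarrow> (X d e a b \<noteq> (X d e b c \<noteq> X d e a c))"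
  unfolding X_def
proof (rule arc_crossing_parity3)
  show "jordan_curve (tri a b c)" using tri_jordan V dist by simp
  show "arc_between (E d e) d e" using E_arc V dist by simp
  show "d \<notin> tri a b c" "e \<notin> tri a b c" unfolding tri_def using E_vertex V dist by auto
  show "E d e \<inter> tri a b c = E d e \<inter> E a b \<union> E d e \<inter> E b c \<union> E d e \<inter> E a c" unfolding tri_def by blast
  \<comment> \<open>Two sides of the triangle share only a vertex, and \<open>de\<close> avoids the
    vertices, so the three sets of hits are disjoint.\<close>
  have v: "a \<notin> E d e" "b \<notin> E d e" "c \<notin> E d e" using E_vertex V dist by auto
  have "E a b \<inter> E b c = {b}" by (rule adj) (use V dist in auto)
  then have 1: "q \<notin> E b c" if "q \<in> E d e" "q \<in> E a b" for q using that v Int_singletonD by metis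
  have "E b c \<inter> E a c = {c}" by (rule adj) (use V dist in auto)
  then have 2: "q \<notin> E a c" if "q \<in> E d e" "q \<in> E b c" for q using that v Int_singletonD by metis
  have "E a b \<inter> E a c = {a}" by (rule adj) (use V dist in auto)
  then have 3: "q \<notin> E a c" if "q \<in> E d e" "q \<in> E a b" for q using that v Int_singletonD by metis
  show "E d e \<inter> E a b \<inter> (E d e \<inter> E b c) = {}" using 1 by blast
  show "E d e \<inter> E b c \<inter> (E d e \<inter> E a c) = {}" using 2 by blast
  show "E d e \<inter> E a b \<inter> (E d e \<inter> E a c) = {}" using 3 by blast
  show "E d e \<inter> E a b = {} \<or> (\<exists>p. E d e \<inter> E a b = {p})"
    by (rule crossing_single) (use V dist in auto)
  show "E d e \<inter> E b c = {} \<or> (\<exists>p. E d e \<inter> E b c = {p})"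
    by (rule crossing_single) (use V dist in auto)
  show "E d e \<inter> E a c = {} \<or> (\<exists>p. E d e \<inter> E a c = {p})"
    by (rule crossing_single) (use V dist in auto)
  \<comment> \<open>Near a hit only one side of the triangle is present: the complement of the other
    two closed sides is the neighbourhood for \<open>properly_cross_at_local\<close>.\<close>
  have cl: "closed (E a b)" "closed (E b c)" "closed (E a c)" using closed_E V dist by auto
  fix p assume "p \<in> E d e \<inter> E a b \<union> E d e \<inter> E b c \<union> E d e \<inter> E a c"
  then consider "p \<in> E d e" "p \<in> E a b" | "p \<in> E d e" "p \<in> E b c" | "p \<in> E d e" "p \<in> E a c" by blast
  then show "properly_cross_at (tri a b c) (E d e) p"
  proof cases
    case c: 1
    have cr: "properly_cross_at (E a b) (E d e) p"
      by (rule crossing_single) (use V dist c in auto)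
    have "p \<notin> E b c \<union> E a c" using c 1 3 by blast
    then show ?thesis
      by (intro properly_cross_at_local[OF cr, of "- (E b c \<union> E a c)"]) (use cl in \<open>auto simp: tri_def\<close>)
  next
    case c: 2
    have cr: "properly_cross_at (E b c) (E d e) p"
      by (rule crossing_single) (use V dist c in auto)
    have "p \<notin> E a b \<union> E a c" using c 1 2 by blast
    then show ?thesis
      by (intro properly_cross_at_local[OF cr, of "- (E a b \<union> E a c)"]) (use cl in \<open>auto simp: tri_def\<close>)
  next
    case c: 3
    have cr: "properly_cross_at (E a c) (E d e) p"
      by (rule crossing_single) (use V dist c in auto)
    have "p \<notin> E a b \<union> E b c" using c 2 3 by blast
    then show ?thesis
      by (intro properly_cross_at_local[OF cr, of "- (E a b \<union> E b c)"]) (use cl in \<open>auto simp: tri_def\<close>)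
  qed
qed

text \<open>A walk around \<open>d\<close>, \<open>e\<close>, \<open>f\<close> returns to the side
  of the triangle \<open>abc\<close> where it began, so the three side changes cancel modulo
  2.\<close>

lemma two_triangles_cross_evenly:
  assumes "{a, b, c, d, e, f} \<subseteq> V" "distinct [a, b, c, d, e, f]"
  shows "(X d e a b \<noteq> (X d e b c \<noteq> X d e a c)) \<longleftrightarrow>
    ((X e f a b \<noteq> (X e f b c \<noteq> X e f a c)) \<noteq> (X d f a b \<noteq> (X d f b c \<noteq> X d f a c)))"
  using triangle_side[of a b c d e] triangle_side[of a b c e f] triangle_side[of a b c d f] assms by auto

text \<open>The two cells at a crossing \<open>p\<close> of \<open>ab\<close> and \<open>cd\<close> that are opposite to the arc triangle \<open>apc\<close>
  meet, so \<open>b\<close> and \<open>d\<close> lie on the same side of that triangle.\<close>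

lemma crossing_triangle:
  assumes V: "{a, b, c, d} \<subseteq> V" and dist: "distinct [a, b, c, d]"
    and A: "arc_between A1 a p" "arc_between A2 p b" "A1 \<inter> A2 = {p}" "A1 \<union> A2 = E a b"
    and C: "arc_between C1 c p" "arc_between C2 p d" "C1 \<inter> C2 = {p}" "C1 \<union> C2 = E c d"
    and p: "E a b \<inter> E c d = {p}"
  shows "jordan_curve (A1 \<union> C1 \<union> E a c)"
    and "b \<in> inside (A1 \<union> C1 \<union> E a c) \<longleftrightarrow> d \<in> inside (A1 \<union> C1 \<union> E a c)"
proof -
  have cr: "properly_cross_at (A1 \<union> A2) (C1 \<union> C2) p"
    unfolding A C by (rule crossing_single) (use V dist p in auto)
  have AC: "(A1 \<union> A2) \<inter> (C1 \<union> C2) = {p}" unfolding A C by (rule p)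
  have D: "arc_between (E a c) a c" using E_arc V dist by auto
  have D1: "E a c \<inter> (A1 \<union> A2) = {a}" unfolding A by (rule adj) (use V dist in auto)
  have D2: "E a c \<inter> (C1 \<union> C2) = {c}" unfolding C by (rule adj) (use V dist in auto)
  show "jordan_curve (A1 \<union> C1 \<union> E a c)"
    by (rule crossing_ends_same_side(1)[OF A(1-3) C(1-3) cr AC D D1 D2])
  show "b \<in> inside (A1 \<union> C1 \<union> E a c) \<longleftrightarrow> d \<in> inside (A1 \<union> C1 \<union> E a c)"
    by (rule crossing_ends_same_side(2)[OF A(1-3) C(1-3) cr AC D D1 D2])
qed

lemma crossing_split:
  assumes V: "{a, b, c, d} \<subseteq> V" and dist: "distinct [a, b, c, d]" and X: "X a b c d"
  obtains p A1 A2 C1 C2 where "E a b \<inter> E c d = {p}"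
    "arc_between A1 a p" "arc_between A2 p b" "A1 \<inter> A2 = {p}" "A1 \<union> A2 = E a b"
    "arc_between C1 c p" "arc_between C2 p d" "C1 \<inter> C2 = {p}" "C1 \<union> C2 = E c d"
proof -
  obtain p where p: "E a b \<inter> E c d = {p}"
    using crossing_single(1)[OF V dist] X unfolding X_def by auto
  have pv: "p \<in> E a b" "p \<in> E c d" using p by auto
  have "p \<noteq> a" "p \<noteq> b" "p \<noteq> c" "p \<noteq> d"
    using pv E_vertex[of c d a] E_vertex[of c d b] E_vertex[of a b c] E_vertex[of a b d] V dist by auto
  moreover have "arc_between (E a b) a b" "arc_between (E c d) c d" using E_arc V dist by auto
  ultimately show thesis
    using arc_between_split[of "E a b" a b p] arc_between_split[of "E c d" c d p] pv p that by metis
qed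

section \<open>What one crossing implies for four and five vertices\<close>

text \<open>With \<open>p\<close> the crossing of \<open>ab\<close> and \<open>cd\<close>, the ends
  of \<open>bd\<close> lie on the same side of the curve \<open>apc\<close>. The edge
  \<open>bd\<close> meets \<open>ab\<close> and \<open>cd\<close> only at its own ends, so it can
  hit that curve only on \<open>ac\<close>, at most once, and by parity not at all.\<close>

lemma K4_single_crossing:
  assumes V: "{a, b, c, d} \<subseteq> V" and dist: "distinct [a, b, c, d]" and X: "X a b c d"
  shows "\<not> X b d a c"
proof
  assume Y: "X b d a c"
  obtain p A1 A2 C1 C2 where p: "E a b \<inter> E c d = {p}"
    and A: "arc_between A1 a p" "arc_between A2 p b" "A1 \<inter> A2 = {p}" "A1 \<union> A2 = E a b"
    and C: "arc_between C1 c p" "arc_between C2 p d" "C1 \<inter> C2 = {p}" "C1 \<union> C2 = E c d"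
    by (rule crossing_split[OF V dist X])
  let ?J = "A1 \<union> C1 \<union> E a c"
  note J = crossing_triangle[OF V dist A C p]
  have bd: "b \<notin> A1" "d \<notin> C1"
    using arc_between_ends[OF A(2)] arc_between_ends[OF C(2)] Int_singletonD[OF A(3)] Int_singletonD[OF C(3)] by metis+
  have AE: "A1 \<subseteq> E a b" "C1 \<subseteq> E c d" using A(4) C(4) by auto
  have n: "b \<notin> E c d" "b \<notin> E a c" "d \<notin> E a b" "d \<notin> E a c" using E_vertex V dist by auto
  have i1: "E b d \<inter> E a b = {b}" by (rule adj) (use V dist in auto)
  have i2: "E b d \<inter> E c d = {d}" by (rule adj) (use V dist in auto)
  have AC: "E b d \<inter> A1 = {}" "E b d \<inter> C1 = {}"
    using Int_singletonD[OF i1] Int_singletonD[OF i2] AE bd by blast+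
  have cl: "closed A1" "closed C1" using A C arc_between_closed by auto
  have "(b \<in> inside ?J) \<noteq> (d \<in> inside ?J) \<longleftrightarrow> ((E b d \<inter> E a c \<noteq> {}) \<noteq> ((({}::complex set) \<noteq> {}) \<noteq> (({}::complex set) \<noteq> {})))"
  proof (rule arc_crossing_parity3[OF J(1)])
    show "arc_between (E b d) b d" using E_arc V dist by auto
    show "b \<notin> ?J" "d \<notin> ?J" using n AE bd by auto
    show "E b d \<inter> ?J = E b d \<inter> E a c \<union> {} \<union> {}" using AC by auto
    show "E b d \<inter> E a c = {} \<or> (\<exists>p. E b d \<inter> E a c = {p})"
      by (rule crossing_single) (use V dist in auto)
    fix q assume "q \<in> E b d \<inter> E a c \<union> {} \<union> {}"
    then have q: "q \<in> E b d" "q \<in> E a c" by auto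
    have "properly_cross_at (E a c) (E b d) q" by (rule crossing_single) (use V dist q in auto)
    then show "properly_cross_at ?J (E b d) q"
      by (rule properly_cross_at_local[of _ _ _ "- (A1 \<union> C1)"]) (use cl q AC in auto)
  qed auto
  then show False using J(2) Y unfolding X_def by auto
qed

text \<open>The edge \<open>eb\<close> meets \<open>ab\<close> only at \<open>b\<close>, which is
  not on \<open>A1\<close>, so its side changes relative to the curve \<open>apc\<close> occur on
  \<open>C1\<close> or on \<open>ac\<close>, at most once on each.\<close>

lemma crossing_bits_aux:
  assumes V: "{a, b, c, d, e} \<subseteq> V" and dist: "distinct [a, b, c, d, e]"
    and A: "arc_between A1 a p" "arc_between A2 p b" "A1 \<inter> A2 = {p}" "A1 \<union> A2 = E a b"
    and C: "arc_between C1 c p" "arc_between C2 p d" "C1 \<inter> C2 = {p}" "C1 \<union> C2 = E c d"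
    and p: "E a b \<inter> E c d = {p}"
  shows "(e \<in> inside (A1 \<union> C1 \<union> E a c)) \<noteq> (b \<in> inside (A1 \<union> C1 \<union> E a c)) \<longleftrightarrow>
    ((E e b \<inter> C1 \<noteq> {}) \<noteq> X e b a c)"
proof -
  let ?J = "A1 \<union> C1 \<union> E a c"
  have V4: "{a, b, c, d} \<subseteq> V" "distinct [a, b, c, d]" using V dist by auto
  note J = crossing_triangle(1)[OF V4 A C p]
  have bd: "b \<notin> A1" using arc_between_ends[OF A(2)] Int_singletonD[OF A(3)] by metis
  have AE: "A1 \<subseteq> E a b" "C1 \<subseteq> E c d" "C2 \<subseteq> E c d" using A(4) C(4) by auto
  have n: "b \<notin> E c d" "b \<notin> E a c" "e \<notin> E a b" "e \<notin> E c d" "e \<notin> E a c" "c \<notin> E e b"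
    using E_vertex V dist by auto
  have i1: "E e b \<inter> E a b = {b}" by (rule adj) (use V dist in auto)
  have i2: "E c d \<inter> E a c = {c}" by (rule adj) (use V dist in auto)
  have eA: "E e b \<inter> A1 = {}" using Int_singletonD[OF i1] AE(1) bd by blast
  have pe: "p \<notin> E e b"
  proof
    assume "p \<in> E e b"
    moreover have "p \<in> E a b" "p \<in> E c d" using p by auto
    ultimately show False using Int_singletonD[OF i1] n(1) by blast
  qed
  have cl: "closed A1" "closed C1" "closed C2" "closed (E a c)"
    using A C arc_between_closed closed_E V dist by auto
  have "(e \<in> inside ?J) \<noteq> (b \<in> inside ?J) \<longleftrightarrow> ((E e b \<inter> C1 \<noteq> {}) \<noteq> ((E e b \<inter> E a c \<noteq> {}) \<noteq> (({}::complex set) \<noteq> {})))"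
  proof (rule arc_crossing_parity3[OF J])
    show "arc_between (E e b) e b" using E_arc V dist by auto
    show "e \<notin> ?J" "b \<notin> ?J" using n AE bd by auto
    show "E e b \<inter> ?J = E e b \<inter> C1 \<union> E e b \<inter> E a c \<union> {}" using eA by auto
    show "E e b \<inter> C1 \<inter> (E e b \<inter> E a c) = {}"
    proof (rule ccontr)
      assume "E e b \<inter> C1 \<inter> (E e b \<inter> E a c) \<noteq> {}"
      then obtain q where "q \<in> E e b" "q \<in> C1" "q \<in> E a c" by blast
      then show False using AE(2) Int_singletonD[OF i2, of q] n(6) by blast
    qed
    show "E e b \<inter> E a c = {} \<or> (\<exists>p. E e b \<inter> E a c = {p})"
      by (rule crossing_single) (use V dist in auto)
    have "E e b \<inter> E c d = {} \<or> (\<exists>p. E e b \<inter> E c d = {p})"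
      by (rule crossing_single) (use V dist in auto)
    then show "E e b \<inter> C1 = {} \<or> (\<exists>p. E e b \<inter> C1 = {p})"
      by (rule subset_at_most_singleton) (use AE(2) in blast)
    fix q assume "q \<in> E e b \<inter> C1 \<union> E e b \<inter> E a c \<union> {}"
    then consider "q \<in> E e b" "q \<in> C1" | "q \<in> E e b" "q \<in> E a c" by auto
    then show "properly_cross_at ?J (E e b) q"
    proof cases
      case 1
      have "q \<in> E c d" using 1 AE by blast
      then have cr: "properly_cross_at (E c d) (E e b) q"
        by (intro crossing_single) (use V dist 1 in auto)
      have "q \<notin> C2" using 1 pe Int_singletonD[OF C(3), of q] by blast
      moreover have "q \<notin> A1" using 1 eA by blast
      moreover have "q \<notin> E a c" using 1 AE(2) Int_singletonD[OF i2, of q] n(6) by blast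
      ultimately show ?thesis
        by (intro properly_cross_at_local[OF cr, of "- (A1 \<union> E a c \<union> C2)"])
          (use cl in \<open>auto simp: C(4)[symmetric]\<close>)
    next
      case 2
      then have cr: "properly_cross_at (E a c) (E e b) q"
        by (intro crossing_single) (use V dist in auto)
      have "q \<notin> C1" using 2 AE(2) Int_singletonD[OF i2, of q] n(6) by blast
      moreover have "q \<notin> A1" using 2 eA by blast
      ultimately show ?thesis
        by (intro properly_cross_at_local[OF cr, of "- (A1 \<union> C1)"]) (use cl in auto)
    qed
  qed auto
  then show ?thesis unfolding X_def by auto
qed

text \<open>Since \<open>b\<close> and \<open>d\<close> lie on the same side of the curve
  \<open>apc\<close>, the edges from \<open>e\<close> to \<open>b\<close> and to \<open>d\<close>
  change sides with equal parity, and the unknown position of \<open>e\<close> drops out.\<close>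

lemma crossing_bits_pair:
  assumes V: "{a, b, c, d, e} \<subseteq> V" and dist: "distinct [a, b, c, d, e]"
    and A: "arc_between A1 a p" "arc_between A2 p b" "A1 \<inter> A2 = {p}" "A1 \<union> A2 = E a b"
    and C: "arc_between C1 c p" "arc_between C2 p d" "C1 \<inter> C2 = {p}" "C1 \<union> C2 = E c d"
    and p: "E a b \<inter> E c d = {p}"
  shows "(E e b \<inter> C1 \<noteq> {}) \<noteq> X e b a c \<longleftrightarrow> (E e d \<inter> A1 \<noteq> {}) \<noteq> X e d a c"
proof -
  have V': "{c, d, a, b, e} \<subseteq> V" "distinct [c, d, a, b, e]" "{a, b, c, d} \<subseteq> V" "distinct [a, b, c, d]"
    using V dist by auto
  have p': "E c d \<inter> E a b = {p}" using p by auto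
  have eq: "C1 \<union> A1 \<union> E c a = A1 \<union> C1 \<union> E a c" using E_commute by auto
  show ?thesis
    using crossing_bits_aux[OF V dist A C p] crossing_bits_aux[OF V'(1,2) C A p', unfolded eq]
      crossing_triangle(2)[OF V'(3,4) A C p] X_flip(2)[of e d c a] by auto
qed

text \<open>The edge \<open>eb\<close> crosses \<open>cd\<close> on the part \<open>cp\<close> (bit \<open>bc\<close>) or on the part \<open>dp\<close> (bit \<open>bd\<close>), where \<open>p\<close> is the
  crossing of \<open>ab\<close> and \<open>cd\<close>.\<close>

lemma crossing_bits:
  assumes V: "{a, b, c, d, e} \<subseteq> V" and dist: "distinct [a, b, c, d, e]" and X: "X a b c d"
  shows "\<exists>ac ad bc bd ca cb da db.
    (bc \<noteq> X e b a c \<longleftrightarrow> da \<noteq> X e d a c) \<and> (bd \<noteq> X e b a d \<longleftrightarrow> ca \<noteq> X e c a d) \<and>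
    (ac \<noteq> X e a b c \<longleftrightarrow> db \<noteq> X e d b c) \<and> (ad \<noteq> X e a b d \<longleftrightarrow> cb \<noteq> X e c b d) \<and>
    (X e a c d \<longleftrightarrow> ac \<noteq> ad) \<and> \<not> (ac \<and> ad) \<and> (X e b c d \<longleftrightarrow> bc \<noteq> bd) \<and> \<not> (bc \<and> bd) \<and>
    (X e c a b \<longleftrightarrow> ca \<noteq> cb) \<and> \<not> (ca \<and> cb) \<and> (X e d a b \<longleftrightarrow> da \<noteq> db) \<and> \<not> (da \<and> db)"
proof -
  have V4: "{a, b, c, d} \<subseteq> V" "distinct [a, b, c, d]" using V dist by auto
  obtain p A1 A2 C1 C2 where p: "E a b \<inter> E c d = {p}"
    and A: "arc_between A1 a p" "arc_between A2 p b" "A1 \<inter> A2 = {p}" "A1 \<union> A2 = E a b"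
    and C: "arc_between C1 c p" "arc_between C2 p d" "C1 \<inter> C2 = {p}" "C1 \<union> C2 = E c d"
    by (rule crossing_split[OF V4 X])
  have A': "arc_between A2 b p" "arc_between A1 p a" "A2 \<inter> A1 = {p}" "A2 \<union> A1 = E b a"
    using A arc_between_commute E_commute by (auto simp: Int_commute Un_commute)
  have C': "arc_between C2 d p" "arc_between C1 p c" "C2 \<inter> C1 = {p}" "C2 \<union> C1 = E d c"
    using C arc_between_commute E_commute by (auto simp: Int_commute Un_commute)
  have p': "E b a \<inter> E c d = {p}" "E a b \<inter> E d c = {p}" "E b a \<inter> E d c = {p}"
    using p E_commute by auto
  have Vs: "{b, a, c, d, e} \<subseteq> V" "{a, b, d, c, e} \<subseteq> V" "{b, a, d, c, e} \<subseteq> V" using V by auto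
  have ds: "distinct [b, a, c, d, e]" "distinct [a, b, d, c, e]" "distinct [b, a, d, c, e]" using dist by auto
  \<comment> \<open>The edge \<open>ex\<close> misses the point \<open>p\<close> where the two parts
    of \<open>yz\<close> meet, so a crossing with \<open>yz\<close> lies on exactly one
    part.\<close>
  have split: "(X e x y z \<longleftrightarrow> (E e x \<inter> B \<noteq> {}) \<noteq> (E e x \<inter> D \<noteq> {})) \<and> \<not> (E e x \<inter> B \<noteq> {} \<and> E e x \<inter> D \<noteq> {})"
    if h: "B \<union> D = E y z" "B \<inter> D = {p}" "{e, x, y, z} \<subseteq> V" "distinct [e, x, y, z]" "p \<notin> E e x" for x y z B D
  proof -
    obtain q where q: "E e x \<inter> E y z \<subseteq> {q}" using crossing_single(1)[OF h(3,4)] by auto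
    then have "E e x \<inter> B \<subseteq> {q}" "E e x \<inter> D \<subseteq> {q}" unfolding h(1)[symmetric] by blast+
    moreover have "\<not> (q \<in> E e x \<and> q \<in> B \<and> q \<in> D)" using Int_singletonD[OF h(2)] h(5) by metis
    moreover have "X e x y z \<longleftrightarrow> E e x \<inter> B \<noteq> {} \<or> E e x \<inter> D \<noteq> {}"
      unfolding X_def h(1)[symmetric] by blast
    ultimately show ?thesis by blast
  qed
  have pn: "p \<notin> E e a" "p \<notin> E e b" "p \<notin> E e c" "p \<notin> E e d"
  proof -
    have pE: "p \<in> E a b" "p \<in> E c d" using p by auto
    have "E e a \<inter> E a b = {a}" by (rule adj) (use V dist in auto)
    moreover have "a \<notin> E c d" by (rule E_vertex) (use V dist in auto)
    ultimately show "p \<notin> E e a" using pE Int_singletonD by metis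
    have "E e b \<inter> E a b = {b}" by (rule adj) (use V dist in auto)
    moreover have "b \<notin> E c d" by (rule E_vertex) (use V dist in auto)
    ultimately show "p \<notin> E e b" using pE Int_singletonD by metis
    have "E e c \<inter> E c d = {c}" by (rule adj) (use V dist in auto)
    moreover have "c \<notin> E a b" by (rule E_vertex) (use V dist in auto)
    ultimately show "p \<notin> E e c" using pE Int_singletonD by metis
    have "E e d \<inter> E c d = {d}" by (rule adj) (use V dist in auto)
    moreover have "d \<notin> E a b" by (rule E_vertex) (use V dist in auto)
    ultimately show "p \<notin> E e d" using pE Int_singletonD by metis
  qed
  have s1: "(X e x c d \<longleftrightarrow> (E e x \<inter> C1 \<noteq> {}) \<noteq> (E e x \<inter> C2 \<noteq> {})) \<and> \<not> (E e x \<inter> C1 \<noteq> {} \<and> E e x \<inter> C2 \<noteq> {})"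
    if "x = a \<or> x = b" for x
    by (rule split) (use that C V dist pn in auto)
  have s2: "(X e x a b \<longleftrightarrow> (E e x \<inter> A1 \<noteq> {}) \<noteq> (E e x \<inter> A2 \<noteq> {})) \<and> \<not> (E e x \<inter> A1 \<noteq> {} \<and> E e x \<inter> A2 \<noteq> {})"
    if "x = c \<or> x = d" for x
    by (rule split) (use that A V dist pn in auto)
  show ?thesis
    apply (rule exI[of _ "E e a \<inter> C1 \<noteq> {}"], rule exI[of _ "E e a \<inter> C2 \<noteq> {}"])
    apply (rule exI[of _ "E e b \<inter> C1 \<noteq> {}"], rule exI[of _ "E e b \<inter> C2 \<noteq> {}"])
    apply (rule exI[of _ "E e c \<inter> A1 \<noteq> {}"], rule exI[of _ "E e c \<inter> A2 \<noteq> {}"])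
    apply (rule exI[of _ "E e d \<inter> A1 \<noteq> {}"], rule exI[of _ "E e d \<inter> A2 \<noteq> {}"])
    by (intro conjI crossing_bits_pair[OF V dist A C p] crossing_bits_pair[OF Vs(1) ds(1) A' C p'(1)]
      crossing_bits_pair[OF Vs(2) ds(2) A C' p'(2)] crossing_bits_pair[OF Vs(3) ds(3) A' C' p'(3)]
      s1[THEN conjunct1] s1[THEN conjunct2] s2[THEN conjunct1] s2[THEN conjunct2]) simp_all
qed

end

section \<open>Non-planarity of the complete graph on five vertices\<close>

context simple_drawing
begin

definition plane_on :: "complex set \<Rightarrow> bool" where
  "plane_on S \<longleftrightarrow> (\<forall>u v w x. {u, v, w, x} \<subseteq> S \<longrightarrow> distinct [u, v, w, x] \<longrightarrow> E u v \<inter> E w x = {})"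

lemma plane_onD: "plane_on S \<Longrightarrow> {u, v, w, x} \<subseteq> S \<Longrightarrow> distinct [u, v, w, x] \<Longrightarrow> E u v \<inter> E w x = {}"
  unfolding plane_on_def by blast

lemma spoke_off_triangle:
  assumes "plane_on S" "S \<subseteq> V" "{a, b, c, d} \<subseteq> S" "distinct [a, b, c, d]"
  shows "(E a d - {a}) \<inter> tri a b c = {}"
proof -
  have "E a d \<inter> E a b = {a}" by (rule adj) (use assms in auto)
  moreover have "E a d \<inter> E a c = {a}" by (rule adj) (use assms in auto)
  moreover have "E a d \<inter> E b c = {}" by (rule plane_onD[OF assms(1)]) (use assms in auto)
  ultimately show ?thesis unfolding tri_def by blast
qed

lemma spoke_same_side:
  assumes "plane_on S" "S \<subseteq> V" "{a, b, c, d} \<subseteq> S" "distinct [a, b, c, d]" "q \<in> E a d" "q \<noteq> a"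
  shows "q \<in> inside (tri a b c) \<longleftrightarrow> d \<in> inside (tri a b c)"
proof (rule connected_same_side)
  show "jordan_curve (tri a b c)" by (rule tri_jordan) (use assms in auto)
  have arc: "arc_between (E a d) a d" by (rule E_arc) (use assms in auto)
  show "connected (E a d - {a})" by (rule arc_between_delete_end_connected[OF arc])
  show "d \<in> E a d - {a}" using arc_between_ends[OF arc] by auto
  show "(E a d - {a}) \<inter> tri a b c = {}" by (rule spoke_off_triangle[OF assms(1-4)])
qed (use assms in auto)

lemma vertices_same_side:
  assumes "plane_on S" "S \<subseteq> V" "{a, b, c, d, e} \<subseteq> S" "distinct [a, b, c, d, e]"
  shows "d \<in> inside (tri a b c) \<longleftrightarrow> e \<in> inside (tri a b c)"
proof -
  have "\<not> X d e a b" "\<not> X d e b c" "\<not> X d e a c"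
    using plane_onD[OF assms(1), of d e] assms(3,4) unfolding X_def by auto
  then show ?thesis using triangle_side[of a b c d e] assms by auto
qed

text \<open>If \<open>d\<close> is inside \<open>abc\<close>, the triangle \<open>abd\<close> stays
  within the closed region of \<open>abc\<close>. The outside of \<open>abc\<close> is then
  connected and misses \<open>abd\<close>; being unbounded it does not lie inside
  \<open>abd\<close>. But it comes arbitrarily close to \<open>c\<close>.\<close>

lemma plane_nested_triangle:
  assumes S: "plane_on S" "S \<subseteq> V" "{a, b, c, d} \<subseteq> S" "distinct [a, b, c, d]"
    and d: "d \<in> inside (tri a b c)"
  shows "c \<notin> inside (tri a b d)"
proof
  assume c: "c \<in> inside (tri a b d)"
  have J: "jordan_curve (tri a b c)" by (rule tri_jordan) (use S in auto)
  have K: "jordan_curve (tri a b d)" by (rule tri_jordan) (use S in auto)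
  note Jf = jordan_curve_facts[OF J] and Kf = jordan_curve_facts[OF K]
  have spoke: "q \<in> inside (tri a b c) \<union> tri a b c" if "q \<in> E a d" for q
  proof (cases "q = a")
    case True
    then show ?thesis unfolding tri_def using ends_in_E[of a b] S by auto
  next
    case False
    then show ?thesis using spoke_same_side[OF S that] d by blast
  qed
  have spoke': "q \<in> inside (tri a b c) \<union> tri a b c" if "q \<in> E b d" for q
  proof (cases "q = b")
    case True
    then show ?thesis unfolding tri_def using ends_in_E[of a b] S by auto
  next
    case False
    have S': "{b, a, c, d} \<subseteq> S" "distinct [b, a, c, d]" using S by auto
    show ?thesis using spoke_same_side[OF S(1,2) S' that False] d tri_commute(1)[of b a c] by simp
  qed
  have "tri a b d \<subseteq> inside (tri a b c) \<union> tri a b c"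
    using spoke spoke' unfolding tri_def[of a b d] by (auto simp: tri_def[of a b c])
  then have dis: "outside (tri a b c) \<inter> tri a b d = {}"
    using Jf(7) outside_no_overlap[of "tri a b c"] by blast
  have out: "outside (tri a b c) \<inter> inside (tri a b d) = {}"
  proof (rule ccontr)
    assume "outside (tri a b c) \<inter> inside (tri a b d) \<noteq> {}"
    then obtain x where x: "x \<in> outside (tri a b c)" "x \<in> inside (tri a b d)" by blast
    have "outside (tri a b c) \<subseteq> inside (tri a b d)"
      using connected_same_side[OF K Jf(5) dis x(1)] x(2) by blast
    then show False using Jf(6) Kf(11) bounded_subset by blast
  qed
  have "c \<in> tri a b c" unfolding tri_def using ends_in_E[of a c] S by auto
  then have "c \<in> closure (outside (tri a b c))" using Jf(10) unfolding frontier_def by blast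
  then show False
    using out open_Int_closure_eq_empty[OF Kf(2), of "outside (tri a b c)"] c by blast
qed

lemma detour:
  assumes "{a, b, c} \<subseteq> V" "distinct [a, b, c]"
  shows "arc_between (E a c \<union> E c b) a b"
proof (rule arc_between_join)
  show "E a c \<inter> E c b = {c}" by (rule adj) (use assms in auto)
qed (use E_arc assms in auto)

text \<open>This is \<open>theta_parity\<close> for the three routes from \<open>a\<close> to
  \<open>b\<close>: directly, through \<open>c\<close> and through \<open>d\<close>. Without
  crossings they meet only at their ends.\<close>

lemma plane_theta:
  assumes S: "plane_on S" "S \<subseteq> V" "{a, b, c, d} \<subseteq> S" "distinct [a, b, c, d]"
    and z: "z \<notin> E a b" "z \<notin> E a c" "z \<notin> E b c" "z \<notin> E a d" "z \<notin> E b d"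
  shows "z \<in> inside (tri a b c) \<longleftrightarrow>
    (z \<in> inside (E a c \<union> E b c \<union> (E a d \<union> E b d))) \<noteq> (z \<in> inside (tri a b d))"
proof -
  have com: "E c b = E b c" "E d b = E b d" by (rule E_commute)+
  have "arc_between (E a b) a b" by (rule E_arc) (use S in auto)
  moreover have "arc_between (E a c \<union> E b c) a b" "arc_between (E a d \<union> E b d) a b"
    using detour[of a b c] detour[of a b d] S com by auto
  moreover have i: "E a b \<inter> E a c = {a}" "E a b \<inter> E b c = {b}" "E a b \<inter> E a d = {a}" "E a b \<inter> E b d = {b}"
    "E a c \<inter> E a d = {a}" "E b c \<inter> E b d = {b}"
    by (rule adj; use S in auto)+
  moreover have j: "E a c \<inter> E b d = {}" "E b c \<inter> E a d = {}"
    by (rule plane_onD[OF S(1)]; use S in auto)+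
  moreover have "E a b \<inter> (E a c \<union> E b c) = {a, b}" "E a b \<inter> (E a d \<union> E b d) = {a, b}"
    unfolding Int_Un_distrib i by auto
  moreover have "(E a c \<union> E b c) \<inter> (E a d \<union> E b d) = {a, b}"
    unfolding Int_Un_distrib Int_Un_distrib2 i j by auto
  ultimately have "z \<in> inside (E a b \<union> (E a c \<union> E b c)) \<longleftrightarrow>
      (z \<in> inside (E a c \<union> E b c \<union> (E a d \<union> E b d))) \<noteq> (z \<in> inside (E a b \<union> (E a d \<union> E b d)))"
    using z by (intro theta_parity) auto
  moreover have "E a b \<union> (E a c \<union> E b c) = tri a b c" "E a b \<union> (E a d \<union> E b d) = tri a b d"
    unfolding tri_def by auto
  ultimately show ?thesis by simp
qed

text \<open>If \<open>d\<close> is inside \<open>abc\<close>, so is \<open>e\<close>, while nesting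
  and \<open>vertices_same_side\<close> put \<open>e\<close> outside \<open>abd\<close>,
  \<open>bcd\<close> and \<open>acd\<close>. Yet two theta curves sharing the quadrilateral
  \<open>acbd\<close> show that \<open>e\<close> is inside an even number of the four
  triangles.\<close>

lemma plane_vertex_outside:
  assumes S: "plane_on S" "S \<subseteq> V" "{a, b, c, d, e} \<subseteq> S" "distinct [a, b, c, d, e]"
  shows "d \<notin> inside (tri a b c)"
proof
  assume d: "d \<in> inside (tri a b c)"
  then have e: "e \<in> inside (tri a b c)" using vertices_same_side[OF S] by simp
  have "c \<notin> inside (tri a b d)" by (rule plane_nested_triangle[OF S(1,2)]) (use S d in auto)
  then have e1: "e \<notin> inside (tri a b d)"
    using vertices_same_side[OF S(1,2), of a b d c e] S by auto
  have "a \<notin> inside (tri b c d)"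
    by (rule plane_nested_triangle[OF S(1,2)]) (use S d tri_commute in auto)
  then have e2: "e \<notin> inside (tri b c d)"
    using vertices_same_side[OF S(1,2), of b c d a e] S by auto
  have "b \<notin> inside (tri a c d)"
    by (rule plane_nested_triangle[OF S(1,2)]) (use S d tri_commute in auto)
  then have e3: "e \<notin> inside (tri a c d)"
    using vertices_same_side[OF S(1,2), of a c d b e] S by auto
  have z: "e \<notin> E u v" if "{u, v} \<subseteq> {a, b, c, d}" "u \<noteq> v" for u v
    by (rule E_vertex) (use that S in auto)
  have "e \<in> inside (tri a b c) \<longleftrightarrow>
      (e \<in> inside (E a c \<union> E b c \<union> (E a d \<union> E b d))) \<noteq> (e \<in> inside (tri a b d))"
    by (rule plane_theta[OF S(1,2)]) (use S z in auto)
  moreover have "e \<in> inside (tri c d a) \<longleftrightarrow>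
      (e \<in> inside (E c a \<union> E d a \<union> (E c b \<union> E d b))) \<noteq> (e \<in> inside (tri c d b))"
    by (rule plane_theta[OF S(1,2)]) (use S z in auto)
  moreover have "E c a \<union> E d a \<union> (E c b \<union> E d b) = E a c \<union> E b c \<union> (E a d \<union> E b d)"
    using E_commute by blast
  moreover have "tri c d a = tri a c d" "tri c d b = tri b c d" using tri_commute by metis+
  ultimately show False using e e1 e2 e3 by simp
qed

text \<open>The inside of \<open>abc\<close> misses \<open>ab\<close> and the edges from
  \<open>a\<close> and \<open>b\<close> to \<open>d\<close>, so it lies entirely inside or entirely
  off the inside of \<open>abd\<close>. If the insides met, the symmetric argument would make them
  equal, hence also their frontiers, but \<open>c\<close> is only on one of the triangles.\<close>

lemma plane_insides_disjoint:
  assumes S: "plane_on S" "S \<subseteq> V" "{a, b, c, d} \<subseteq> S" "distinct [a, b, c, d]"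
    and c: "c \<notin> inside (tri a b d)" and d: "d \<notin> inside (tri a b c)"
  shows "inside (tri a b c) \<inter> inside (tri a b d) = {}"
    and "inside (tri a b c) \<inter> (E a d \<union> E b d) = {}"
proof -
  have off: "inside (tri a b x) \<inter> (E a y \<union> E b y) = {}"
    if xy: "{a, b, x, y} \<subseteq> S" "distinct [a, b, x, y]" and y: "y \<notin> inside (tri a b x)" for x y
  proof -
    have xy': "{b, a, x, y} \<subseteq> S" "distinct [b, a, x, y]" using xy by auto
    have ab: "a \<in> tri a b x" "b \<in> tri a b x" unfolding tri_def using ends_in_E[of a b] xy S by auto
    then have "a \<notin> inside (tri a b x)" "b \<notin> inside (tri a b x)"
      using inside_no_overlap[of "tri a b x"] by blast+
    then show ?thesis
      using spoke_same_side[OF S(1,2) xy] spoke_same_side[OF S(1,2) xy'] y tri_commute(1)[of a b x] by auto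
  qed
  have sub: "inside (tri a b x) \<subseteq> inside (tri a b y)"
    if xy: "{a, b, x, y} \<subseteq> S" "distinct [a, b, x, y]" and y: "y \<notin> inside (tri a b x)"
      and z: "z \<in> inside (tri a b x)" "z \<in> inside (tri a b y)" for x y z
  proof -
    have J: "jordan_curve (tri a b x)" by (rule tri_jordan) (use xy S in auto)
    have K: "jordan_curve (tri a b y)" by (rule tri_jordan) (use xy S in auto)
    have "inside (tri a b x) \<inter> E a b = {}" using inside_no_overlap[of "tri a b x"] unfolding tri_def by blast
    then have "inside (tri a b x) \<inter> tri a b y = {}" using off[OF xy y] unfolding tri_def[of a b y] by blast
    then show ?thesis
      using connected_same_side[OF K jordan_curve_facts(3)[OF J]] z by blast
  qed
  have S': "{a, b, d, c} \<subseteq> S" "distinct [a, b, d, c]" using S by auto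
  show "inside (tri a b c) \<inter> (E a d \<union> E b d) = {}" by (rule off[OF S(3,4) d])
  show "inside (tri a b c) \<inter> inside (tri a b d) = {}"
  proof (rule ccontr)
    assume "inside (tri a b c) \<inter> inside (tri a b d) \<noteq> {}"
    then obtain z where z: "z \<in> inside (tri a b c)" "z \<in> inside (tri a b d)" by blast
    then have "inside (tri a b c) = inside (tri a b d)"
      using sub[OF S(3,4) d] sub[OF S' c] by blast
    moreover have "jordan_curve (tri a b c)" "jordan_curve (tri a b d)"
      by (rule tri_jordan; use S in auto)+
    ultimately have "tri a b c = tri a b d" using jordan_curve_facts(9) by metis
    moreover have "c \<in> tri a b c" unfolding tri_def using ends_in_E[of a c] S by auto
    moreover have "c \<notin> tri a b d" unfolding tri_def using E_vertex[of _ _ c] S by auto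
    ultimately show False by simp
  qed
qed

text \<open>The edge \<open>ab\<close> has only two sides, but \<open>abc\<close>,
  \<open>abd\<close>, \<open>abe\<close> have disjoint insides that all reach an inner point
  \<open>x\<close> of \<open>ab\<close>. By the theta curve, \<open>x\<close> is inside the
  quadrilateral \<open>acbd\<close>, and near \<open>x\<close> this inside consists of points of
  \<open>ab\<close> and of the insides of \<open>abc\<close> and \<open>abd\<close>; no room is left
  for \<open>abe\<close>.\<close>

theorem K5_not_plane:
  assumes S: "plane_on S" "S \<subseteq> V" "{a, b, c, d, e} \<subseteq> S" "distinct [a, b, c, d, e]"
  shows False
proof -
  have out: "y \<notin> inside (tri a b x)" if "{x, y} \<subseteq> {c, d, e}" "x \<noteq> y" for x y
  proof -
    obtain w where w: "w \<in> {c, d, e}" "w \<noteq> x" "w \<noteq> y" using S(4) that by auto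
    show ?thesis by (rule plane_vertex_outside[OF S(1,2), of a b x y w]) (use S that w in auto)
  qed
  have dis: "inside (tri a b x) \<inter> inside (tri a b y) = {}" "inside (tri a b x) \<inter> (E a y \<union> E b y) = {}"
    if "{x, y} \<subseteq> {c, d, e}" "x \<noteq> y" for x y
  proof -
    have xy: "{a, b, x, y} \<subseteq> S" "distinct [a, b, x, y]" using that S by auto
    show "inside (tri a b x) \<inter> inside (tri a b y) = {}" "inside (tri a b x) \<inter> (E a y \<union> E b y) = {}"
      using plane_insides_disjoint[OF S(1,2) xy] out that by auto
  qed
  have own: "inside (tri a b x) \<inter> (E a b \<union> E a x \<union> E b x) = {}" for x
    using inside_no_overlap[of "tri a b x"] unfolding tri_def by blast
  let ?Q = "E a c \<union> E b c \<union> (E a d \<union> E b d)"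
  have com: "E c b = E b c" "E d b = E b d" by (rule E_commute)+
  have Q: "jordan_curve ?Q"
  proof (rule jordan_curve_join)
    show "arc_between (E a c \<union> E b c) a b" "arc_between (E a d \<union> E b d) a b"
      using detour[of a b c] detour[of a b d] S com by auto
    have i: "E a c \<inter> E a d = {a}" "E b c \<inter> E b d = {b}" by (rule adj; use S in auto)+
    have j: "E a c \<inter> E b d = {}" "E b c \<inter> E a d = {}"
      by (rule plane_onD[OF S(1)]; use S in auto)+
    show "(E a c \<union> E b c) \<inter> (E a d \<union> E b d) = {a, b}"
      unfolding Int_Un_distrib Int_Un_distrib2 i j by auto
  qed
  have ab: "arc_between (E a b) a b" by (rule E_arc) (use S in auto)
  obtain x where x: "x \<in> E a b" "x \<noteq> a" "x \<noteq> b"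
    using arc_between_dense[OF ab] by (metis Diff_iff closure_empty empty_iff ex_in_conv insertCI)
  have xc: "x \<in> closure (inside (tri a b y))" if "y \<in> {c, d, e}" for y
  proof -
    have "jordan_curve (tri a b y)" by (rule tri_jordan) (use S that in auto)
    then have "frontier (inside (tri a b y)) = tri a b y" by (rule jordan_curve_facts)
    moreover have "x \<in> tri a b y" using x unfolding tri_def by blast
    ultimately show ?thesis unfolding frontier_def by blast
  qed
  have theta: "z \<in> inside (tri a b c) \<longleftrightarrow> (z \<in> inside ?Q) \<noteq> (z \<in> inside (tri a b d))"
    if "z \<notin> E a b" "z \<notin> E a c" "z \<notin> E b c" "z \<notin> E a d" "z \<notin> E b d" for z
    by (rule plane_theta[OF S(1,2)]) (use S that in auto)
  have "inside (tri a b c) \<subseteq> inside ?Q"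
  proof
    fix z assume z: "z \<in> inside (tri a b c)"
    then have "z \<notin> inside (tri a b d)" "z \<notin> E a d" "z \<notin> E b d" using dis[of c d] S by auto
    moreover have "z \<notin> E a b" "z \<notin> E a c" "z \<notin> E b c" using own[of c] z by auto
    ultimately show "z \<in> inside ?Q" using theta z by blast
  qed
  then have "x \<in> closure (inside ?Q)" using xc[of c] closure_mono by blast
  moreover have "x \<notin> ?Q"
  proof -
    have "E a b \<inter> E a y = {a}" "E a b \<inter> E b y = {b}" if "y = c \<or> y = d" for y
      by (rule adj; use S that in auto)+
    then show ?thesis using x Int_singletonD by (metis UnE)
  qed
  ultimately have "x \<in> inside ?Q"
    using jordan_curve_facts(2,9)[OF Q] unfolding frontier_def by (metis DiffI interior_open)
  then have "inside ?Q \<inter> inside (tri a b e) \<noteq> {}"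
    using xc[of e] open_Int_closure_eq_empty[OF jordan_curve_facts(2)[OF Q], of "inside (tri a b e)"] by blast
  then obtain z where z: "z \<in> inside ?Q" "z \<in> inside (tri a b e)" by blast
  have "z \<notin> E a b" using own[of e] z by auto
  moreover have "z \<notin> E a c" "z \<notin> E b c" "z \<notin> E a d" "z \<notin> E b d"
    "z \<notin> inside (tri a b c)" "z \<notin> inside (tri a b d)"
    using dis[of e c] dis[of e d] z S by auto
  ultimately show False using theta z by blast
qed

end

section \<open>The crossing patterns on five vertices as propositional rules\<close>

context simple_drawing
begin

definition five :: "complex \<Rightarrow> complex \<Rightarrow> complex \<Rightarrow> complex \<Rightarrow> complex \<Rightarrow> bool" where
  "five a b c d e \<longleftrightarrow> {a, b, c, d, e} \<subseteq> V \<and> distinct [a, b, c, d, e]"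

lemma K4_at_most_one:
  assumes "five a b c d e"
  shows "\<not> (X a b c d \<and> X a c b d) \<and> \<not> (X a b c d \<and> X a d b c) \<and> \<not> (X a c b d \<and> X a d b c)"
  using K4_single_crossing[of a b c d] K4_single_crossing[of a b d c] K4_single_crossing[of a c d b] assms
  unfolding five_def by (auto simp: X_flip X_swap)

text \<open>Elimination of the eight bits from \<open>crossing_bits\<close>. Up to the symmetries of the crossing there are
  three kinds of rules; with \<open>K4_at_most_one\<close> and \<open>K5_crossing\<close> they leave exactly the five realizable
  crossing patterns of \<open>K\<^sub>5\<close>.\<close>

lemma crossing_rules:
  assumes five: "five a b c d e"
  shows "X a b c d \<longrightarrow>
    (\<not> X e b c d \<and> \<not> X e d a b \<longrightarrow> (X e b a c \<longleftrightarrow> X e d a c)) \<and>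
    (\<not> X e b c d \<and> \<not> X e c a b \<longrightarrow> (X e b a d \<longleftrightarrow> X e c a d)) \<and>
    (\<not> X e a c d \<and> \<not> X e d a b \<longrightarrow> (X e a b c \<longleftrightarrow> X e d b c)) \<and>
    (\<not> X e a c d \<and> \<not> X e c a b \<longrightarrow> (X e a b d \<longleftrightarrow> X e c b d)) \<and>
    (X e b a c \<and> X e d a c \<and> X e b c d \<longrightarrow> X e b a d \<or> X e d a b) \<and>
    (X e b a d \<and> X e c a d \<and> X e b c d \<longrightarrow> X e b a c \<or> X e c a b) \<and>
    (X e a b c \<and> X e d b c \<and> X e a c d \<longrightarrow> X e a b d \<or> X e d a b) \<and>
    (X e a b d \<and> X e c b d \<and> X e a c d \<longrightarrow> X e a b c \<or> X e c a b) \<and>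
    (X e d a c \<and> X e b a c \<and> X e d a b \<longrightarrow> X e d b c \<or> X e b c d) \<and>
    (X e d b c \<and> X e a b c \<and> X e d a b \<longrightarrow> X e d a c \<or> X e a c d) \<and>
    (X e c a d \<and> X e b a d \<and> X e c a b \<longrightarrow> X e c b d \<or> X e b c d) \<and>
    (X e c b d \<and> X e a b d \<and> X e c a b \<longrightarrow> X e c a d \<or> X e a c d) \<and>
    (X e b c d \<longrightarrow> X e b a c \<or> X e d a c \<or> X e b a d \<or> X e c a d \<or> X e c a b \<or> X e d a b) \<and>
    (X e a c d \<longrightarrow> X e a b c \<or> X e d b c \<or> X e a b d \<or> X e c b d \<or> X e c a b \<or> X e d a b) \<and>
    (X e d a b \<longrightarrow> X e d a c \<or> X e b a c \<or> X e d b c \<or> X e a b c \<or> X e a c d \<or> X e b c d) \<and>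
    (X e c a b \<longrightarrow> X e c a d \<or> X e b a d \<or> X e c b d \<or> X e a b d \<or> X e a c d \<or> X e b c d)"
    (is "_ \<longrightarrow> ?C")
proof
  assume cr: "X a b c d"
  have h: "{a, b, c, d, e} \<subseteq> V" "distinct [a, b, c, d, e]" using five unfolding five_def by auto
  \<comment> \<open>These give the four 4-subsets containing \<open>e\<close>; on the remaining one
    the crossing of \<open>ab\<close> and \<open>cd\<close> is assumed.\<close>
  have f: "five e a b c d" "five e a b d c" "five e a c d b" "five e b c d a"
    using h unfolding five_def by auto
  from crossing_bits[OF h cr] K4_at_most_one[OF f(1)] K4_at_most_one[OF f(2)] K4_at_most_one[OF f(3)]
    K4_at_most_one[OF f(4)]
  show ?C by (elim exE, intro conjI; sat)
qed

text \<open>The disjuncts are the three pairings of each of the five 4-subsets; if all fail, the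
  five vertices span a drawing without crossings.\<close>

lemma K5_crossing:
  assumes five: "five a b c d e"
  shows "X a b c d \<or> X a c b d \<or> X a d b c \<or> X a b c e \<or> X a c b e \<or> X a e b c \<or>
    X a b d e \<or> X a d b e \<or> X a e b d \<or> X a c d e \<or> X a d c e \<or> X a e c d \<or>
    X b c d e \<or> X b d c e \<or> X b e c d"
proof (rule ccontr)
  assume n: "\<not> ?thesis"
  have ne: "a \<noteq> b" "a \<noteq> c" "a \<noteq> d" "a \<noteq> e" "b \<noteq> c" "b \<noteq> d" "b \<noteq> e" "c \<noteq> d" "c \<noteq> e" "d \<noteq> e"
    using five unfolding five_def by auto
  let ?S = "{a, b, c, d, e}"
  \<comment> \<open>\<open>X_flip\<close> and \<open>X_swap\<close> act as ordered rewrite rules and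
    bring every crossing to one of fifteen normal forms.\<close>
  have all: "\<forall>u\<in>?S. \<forall>v\<in>?S. \<forall>w\<in>?S. \<forall>x\<in>?S. u \<noteq> v \<and> u \<noteq> w \<and> u \<noteq> x \<and> v \<noteq> w \<and> v \<noteq> x \<and> w \<noteq> x \<longrightarrow> \<not> X u v w x"
    by (simp only: ball_simps simp_thms ne ne[symmetric] X_flip X_swap n[simplified de_Morgan_disj X_flip X_swap])
  have "plane_on ?S"
    unfolding plane_on_def
  proof (intro allI impI)
    fix u v w x assume h: "{u, v, w, x} \<subseteq> ?S" "distinct [u, v, w, x]"
    then have "u \<in> ?S" "v \<in> ?S" "w \<in> ?S" "x \<in> ?S" by (simp_all only: insert_subset)
    from all[rule_format, OF this] h(2) show "E u v \<inter> E w x = {}" unfolding X_def by simp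
  qed
  then show False using K5_not_plane[of ?S a b c d e] five unfolding five_def by auto
qed

text \<open>\<open>sep v i j k l\<close> says that around \<open>v\<close> the edges \<open>vi\<close>, \<open>vj\<close> separate the edges \<open>vk\<close>, \<open>vl\<close>: by
  \<open>triangle_side\<close> it is the parity with which the path \<open>v k l v\<close> changes sides of the triangle \<open>v i j\<close>.\<close>

definition sep :: "complex \<Rightarrow> complex \<Rightarrow> complex \<Rightarrow> complex \<Rightarrow> complex \<Rightarrow> bool" where
  "sep v i j k l \<longleftrightarrow> (X v k i j \<noteq> (X v l i j \<noteq> (X k l i j \<noteq> (X k l v i \<noteq> X k l v j))))"

text \<open>The orders list each of the fifteen pairs of disjoint edges once, as first two and next
  two vertices, with the remaining vertex last; this is how \<open>crossing_rules\<close> reads its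
  arguments. Numbers 1, 4, 7, 10 and 13 represent the five 4-subsets for
  \<open>K4_at_most_one\<close>.\<close>

lemma five_rules:
  assumes "five v i j k l"
  shows "five v i j k l"
    "five v j i k l"
    "five v k i j l"
    "five v i j l k"
    "five v j i l k"
    "five v l i j k"
    "five v i k l j"
    "five v k i l j"
    "five v l i k j"
    "five v j k l i"
    "five v k j l i"
    "five v l j k i"
    "five i j k l v"
    "five i k j l v"
    "five i l j k v"
  using assms unfolding five_def by auto

text \<open>Behind this is the cyclic order of four edges at \<open>v\<close>; the proof is a
  propositional check over the fifteen crossing variables. Rewriting with \<open>X_flip\<close> and
  \<open>X_swap\<close> first gives each crossing a single name, so that \<open>sat\<close> sees the
  same atoms everywhere.\<close>

lemma sep_not_both:
  assumes five: "five v i j k l"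
  shows "\<not> (sep v i j k l \<and> sep v i k j l)"
proof -
  note f = five_rules[OF five]
  show ?thesis
    unfolding sep_def
    using crossing_rules[OF f(1)]
      crossing_rules[OF f(2)]
      crossing_rules[OF f(3)]
      crossing_rules[OF f(4)]
      crossing_rules[OF f(5)]
      crossing_rules[OF f(6)]
      crossing_rules[OF f(7)]
      crossing_rules[OF f(8)]
      crossing_rules[OF f(9)]
      crossing_rules[OF f(10)]
      crossing_rules[OF f(11)]
      crossing_rules[OF f(12)]
      crossing_rules[OF f(13)]
      crossing_rules[OF f(14)]
      crossing_rules[OF f(15)]
      K4_at_most_one[OF f(1)] K4_at_most_one[OF f(4)] K4_at_most_one[OF f(7)] K4_at_most_one[OF f(10)] K4_at_most_one[OF f(13)]
    by (simp (no_asm_use) only: X_flip X_swap) sat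
qed

text \<open>In a pattern without crossings all three parities would vanish, so this is where
  non-planarity enters.\<close>

lemma sep_some:
  assumes five: "five v i j k l"
  shows "sep v i j k l \<or> sep v i k j l \<or> sep v i l j k"
proof -
  note f = five_rules[OF five]
  show ?thesis
    unfolding sep_def
    using K5_crossing[OF five] crossing_rules[OF f(1)]
      crossing_rules[OF f(2)]
      crossing_rules[OF f(3)]
      crossing_rules[OF f(4)]
      crossing_rules[OF f(5)]
      crossing_rules[OF f(6)]
      crossing_rules[OF f(7)]
      crossing_rules[OF f(8)]
      crossing_rules[OF f(9)]
      crossing_rules[OF f(10)]
      crossing_rules[OF f(11)]
      crossing_rules[OF f(12)]
      crossing_rules[OF f(13)]
      crossing_rules[OF f(14)]
      crossing_rules[OF f(15)]
      K4_at_most_one[OF f(1)] K4_at_most_one[OF f(4)] K4_at_most_one[OF f(7)] K4_at_most_one[OF f(10)] K4_at_most_one[OF f(13)]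
    by (simp (no_asm_use) only: X_flip X_swap) sat
qed

end

section \<open>The rotation at a vertex\<close>

text \<open>The number of predecessors is strictly increasing along \<open>R\<close>, hence a
  bijection onto an initial segment; its inverse is the enumeration.\<close>

lemma ex_strict_enumeration:
  assumes fin: "finite P"
    and irr: "\<And>x. x \<in> P \<Longrightarrow> \<not> R x x"
    and tot: "\<And>x y. x \<in> P \<Longrightarrow> y \<in> P \<Longrightarrow> x \<noteq> y \<Longrightarrow> R x y \<or> R y x"
    and trans: "\<And>x y z. x \<in> P \<Longrightarrow> y \<in> P \<Longrightarrow> z \<in> P \<Longrightarrow> R x y \<Longrightarrow> R y z \<Longrightarrow> R x z"
  obtains p where "bij_betw p {..<card P} P" "\<And>i j. i < j \<Longrightarrow> j < card P \<Longrightarrow> R (p i) (p j)"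
proof -
  define r where "r x = card {y \<in> P. R y x}" for x
  have mono: "r x < r y" if "x \<in> P" "y \<in> P" "R x y" for x y
    unfolding r_def
  proof (rule psubset_card_mono)
    have "x \<in> {z \<in> P. R z y}" "x \<notin> {z \<in> P. R z x}" using that irr by auto
    moreover have "{z \<in> P. R z x} \<subseteq> {z \<in> P. R z y}" using trans that by blast
    ultimately show "{z \<in> P. R z x} \<subset> {z \<in> P. R z y}" by blast
  qed (use fin in auto)
  have inj: "inj_on r P"
    by (rule inj_onI) (metis mono tot less_irrefl)
  have "r ` P \<subseteq> {..<card P}"
  proof
    fix n assume "n \<in> r ` P"
    then obtain x where x: "x \<in> P" "n = r x" by blast
    have "{y \<in> P. R y x} \<subset> P" using x irr by blast
    then show "n \<in> {..<card P}" unfolding x r_def using fin by (simp add: psubset_card_mono)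
  qed
  then have "r ` P = {..<card P}"
    by (intro card_subset_eq) (auto simp: card_image[OF inj])
  then have bij: "bij_betw r P {..<card P}" using inj by (simp add: bij_betw_def)
  let ?p = "the_inv_into P r"
  have bp: "bij_betw ?p {..<card P} P" by (rule bij_betw_the_inv_into[OF bij])
  show thesis
  proof
    show "bij_betw ?p {..<card P} P" by (rule bp)
    fix i j assume ij: "i < j" "j < card P"
    have P: "?p i \<in> P" "?p j \<in> P" using bp ij by (auto simp: bij_betw_def)
    have r: "r (?p i) = i" "r (?p j) = j" using f_the_inv_into_f_bij_betw[OF bij] ij by auto
    then have "?p i \<noteq> ?p j" using ij by auto
    then have "R (?p i) (?p j) \<or> R (?p j) (?p i)" using tot P by blast
    then show "R (?p i) (?p j)" using mono[OF P(2,1)] r ij by auto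
  qed
qed

context simple_drawing
begin

lemma sep_commute:
  "sep v i j k l \<longleftrightarrow> sep v j i k l" "sep v i j k l \<longleftrightarrow> sep v i j l k" "sep v i j k l \<longleftrightarrow> sep v k l i j"
  unfolding sep_def by (simp only: X_flip X_swap; sat)+

lemma sep_exactly_one:
  assumes "five v i j k l"
  shows "sep v i j k l \<or> sep v i k j l \<or> sep v i l j k"
    "\<not> (sep v i j k l \<and> sep v i k j l)" "\<not> (sep v i j k l \<and> sep v i l j k)" "\<not> (sep v i k j l \<and> sep v i l j k)"
proof -
  have f: "five v i j l k" "five v i k l j" using assms unfolding five_def by auto
  show "sep v i j k l \<or> sep v i k j l \<or> sep v i l j k" by (rule sep_some[OF assms])
  show "\<not> (sep v i j k l \<and> sep v i k j l)" by (rule sep_not_both[OF assms])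
  show "\<not> (sep v i j k l \<and> sep v i l j k)" using sep_not_both[OF f(1)] sep_commute(2) by blast
  show "\<not> (sep v i k j l \<and> sep v i l j k)" using sep_not_both[OF f(2)] sep_commute(2) by blast
qed

text \<open>In the sum of the two parities on the right the terms for the edge \<open>vl\<close>
  cancel, and the side changes along \<open>kl\<close> and \<open>lm\<close> add up to those along
  \<open>km\<close>, because two disjoint triangles cross evenly.\<close>

lemma sep_additive:
  assumes "{v, i, j, k, l, m} \<subseteq> V" "distinct [v, i, j, k, l, m]"
  shows "sep v i j k m \<longleftrightarrow> sep v i j k l \<noteq> sep v i j l m"
proof -
  have "(X k l v i \<noteq> (X k l i j \<noteq> X k l v j)) \<longleftrightarrow>
    ((X l m v i \<noteq> (X l m i j \<noteq> X l m v j)) \<noteq> (X k m v i \<noteq> (X k m i j \<noteq> X k m v j)))"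
    by (rule two_triangles_cross_evenly) (use assms in auto)
  then show ?thesis unfolding sep_def by argo
qed

text \<open>The separation relation is cyclic. To obtain a linear order, two reference edges
  \<open>va\<close> and \<open>ve\<close> are chosen and only the larger of the two sectors between
  them is kept. The 3 pays for \<open>v\<close>, \<open>a\<close>, \<open>e\<close> and the factor 2
  for the discarded sector.\<close>

lemma rotation_order:
  assumes fin: "finite V" and v: "v \<in> V"
  obtains N p where "2 * N + 3 \<ge> card V" "inj_on p {..<N}" "p ` {..<N} \<subseteq> V - {v}"
    "\<And>i j k l. i < j \<Longrightarrow> j < k \<Longrightarrow> k < l \<Longrightarrow> l < N \<Longrightarrow> sep v (p i) (p k) (p j) (p l)"
proof (cases "card V \<le> 3")
  case True
  show ?thesis by (rule that[of 0 id]) (use True in auto)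
next
  case False
  have "card (V - {v}) \<ge> 2" using False fin v by auto
  then obtain W where W: "W \<subseteq> V - {v}" "card W = 2"
    by (metis obtain_subset_with_card_n)
  then obtain a e where ae: "W = {a, e}" "a \<noteq> e" by (meson card_2_iff)
  have aeV: "a \<in> V" "e \<in> V" "v \<noteq> a" "v \<noteq> e" using W ae by auto
  define U where "U = V - {v, a, e}"
  have cU: "card U + 3 = card V"
  proof -
    have "card {v, a, e} = 3" using aeV ae by auto
    moreover have "card U = card V - card {v, a, e}"
      unfolding U_def by (rule card_Diff_subset) (use aeV v in auto)
    ultimately show ?thesis using False by simp
  qed
  then obtain u where u: "u \<in> U" using False by fastforce
  \<comment> \<open>The two sectors, told apart by a base vertex \<open>u\<close>: \<open>Q\<close>
    holds the vertices that \<open>va\<close> and \<open>ve\<close> separate from \<open>u\<close>,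
    and its complement in \<open>U\<close> holds \<open>u\<close> and the rest.\<close>
  define Q where "Q = {x \<in> U. x \<noteq> u \<and> sep v a e u x}"
  have cross: "sep v a e x y \<longleftrightarrow> sep v a e u x \<noteq> sep v a e u y"
    if "x \<in> U" "y \<in> U" "distinct [u, x, y]" for x y
  proof -
    have "sep v a e x y \<longleftrightarrow> sep v a e x u \<noteq> sep v a e u y"
      by (rule sep_additive) (use that u aeV v ae in \<open>auto simp: U_def\<close>)
    then show ?thesis using sep_commute(2) by blast
  qed
  have Q1: "\<not> sep v a e x y" if "x \<in> Q" "y \<in> Q" "x \<noteq> y" for x y
    using that cross[of x y] unfolding Q_def by auto
  have Q2: "\<not> sep v a e x y" if "x \<in> U - Q" "y \<in> U - Q" "x \<noteq> y" for x y
  proof (cases "u = x \<or> u = y")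
    case True
    then show ?thesis using that sep_commute(2) unfolding Q_def by blast
  next
    case False
    then show ?thesis using that cross[of x y] unfolding Q_def by auto
  qed
  have finU: "finite U" using fin unfolding U_def by auto
  have "card Q + card (U - Q) = card U"
    using finU by (metis (no_types, lifting) Q_def card_Diff_subset card_mono finite_subset le_add_diff_inverse mem_Collect_eq subsetI)
  then obtain P where P: "P \<subseteq> U" "2 * card P \<ge> card U" "\<And>x y. x \<in> P \<Longrightarrow> y \<in> P \<Longrightarrow> x \<noteq> y \<Longrightarrow> \<not> sep v a e x y"
    using that
  proof (cases "card Q \<ge> card (U - Q)")
    case True
    have "Q \<subseteq> U" unfolding Q_def by auto
    then show ?thesis using that(1)[of Q] Q1 True \<open>card Q + card (U - Q) = card U\<close> by auto
  next
    case False
    then show ?thesis using that(1)[of "U - Q"] Q2 \<open>card Q + card (U - Q) = card U\<close> by auto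
  qed
  have finP: "finite P" using P(1) finU finite_subset by blast
  have PV: "x \<in> V" "x \<noteq> v" "x \<noteq> a" "x \<noteq> e" if "x \<in> P" for x using that P(1) unfolding U_def by auto
  \<comment> \<open>The pair \<open>va\<close>, \<open>vy\<close> separates \<open>vx\<close> from
    \<open>ve\<close> exactly when, going from \<open>a\<close> to \<open>e\<close> through the
    chosen sector, \<open>x\<close> comes before \<open>y\<close>.\<close>
  define R where "R x y \<longleftrightarrow> x \<noteq> y \<and> sep v a y x e" for x y
  have one: "R x y \<longleftrightarrow> \<not> R y x" if "x \<in> P" "y \<in> P" "x \<noteq> y" for x y
  proof -
    have "five v a y x e" unfolding five_def using that PV aeV v ae by auto
    from sep_exactly_one[OF this] P(3)[OF that] that show ?thesis
      unfolding R_def using sep_commute(2) by metis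
  qed
  have add: "sep v x y k m \<longleftrightarrow> sep v x y k l \<noteq> sep v x y l m"
    if "{x, y, k, l, m} \<subseteq> P \<union> {a, e}" "distinct [x, y, k, l, m]" for x y k l m
    by (rule sep_additive) (use that PV aeV v in auto)
  have five: "five v x y z w" if "{x, y, z, w} \<subseteq> P \<union> {a, e}" "distinct [x, y, z, w]" for x y z w
    unfolding five_def using that PV aeV v by auto
  have base: "sep v a y x z" if "x \<in> P" "y \<in> P" "z \<in> P" "R x y" "R y z" "x \<noteq> z" for x y z
  proof -
    have d: "distinct [a, y, x, e, z]" using that PV ae unfolding R_def by auto
    have "sep v a y x z \<longleftrightarrow> sep v a y x e \<noteq> sep v a y e z" by (rule add) (use that d in auto)
    moreover have "\<not> sep v a y z e" using one[of y z] that unfolding R_def by auto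
    ultimately show ?thesis using that sep_commute(2) unfolding R_def by blast
  qed
  have trans: "R x z" if "x \<in> P" "y \<in> P" "z \<in> P" "R x y" "R y z" for x y z
  proof -
    have xz: "x \<noteq> z" using that one[of x y] unfolding R_def by auto
    have d: "distinct [a, z, x, y, e]" using that PV ae xz unfolding R_def by auto
    have "five v a y x z" by (rule five) (use that d in auto)
    then have "\<not> sep v a z x y" using base[OF that xz] sep_exactly_one sep_commute(2) by metis
    moreover have "sep v a z x e \<longleftrightarrow> sep v a z x y \<noteq> sep v a z y e" by (rule add) (use that d in auto)
    ultimately show ?thesis using that xz unfolding R_def by auto
  qed
  obtain p where p: "bij_betw p {..<card P} P" "\<And>i j. i < j \<Longrightarrow> j < card P \<Longrightarrow> R (p i) (p j)"
  proof (rule ex_strict_enumeration[OF finP, of R])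
    show "\<not> R x x" for x unfolding R_def by simp
    show "R x y \<or> R y x" if "x \<in> P" "y \<in> P" "x \<noteq> y" for x y using one that by blast
  qed (use trans in blast)+
  show thesis
  proof (rule that[of "card P" p])
    show "2 * card P + 3 \<ge> card V" using P(2) cU by simp
    show "inj_on p {..<card P}" using p(1) by (simp add: bij_betw_def)
    show "p ` {..<card P} \<subseteq> V - {v}" using p(1) PV by (auto simp: bij_betw_def)
    fix i j k l assume o: "i < j" "j < k" "k < l" "l < card P"
    let ?i = "p i" and ?j = "p j" and ?k = "p k" and ?l = "p l"
    have P4: "?i \<in> P" "?j \<in> P" "?k \<in> P" "?l \<in> P" using p(1) o by (auto simp: bij_betw_def)
    have R: "R ?i ?j" "R ?j ?k" "R ?k ?l" "R ?i ?k" "R ?i ?l" "R ?j ?l" using p(2) o by auto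
    then have d: "distinct [?i, ?k, ?j, a, ?l]" using PV P4 unfolding R_def by auto
    \<comment> \<open>The circle is cut open at \<open>a\<close>: \<open>vi\<close> and
      \<open>vk\<close> separate \<open>vj\<close> from \<open>va\<close> but not \<open>va\<close>
      from \<open>vl\<close>, and adding the two gives the claim.\<close>
    have "sep v a ?j ?i ?k" "sep v a ?k ?i ?l" using base P4 R d by auto
    moreover have "five v a ?k ?i ?l" by (rule five) (use P4 d in auto)
    ultimately have "sep v ?i ?k ?j a" "\<not> sep v ?i ?k a ?l"
      using sep_exactly_one[of v a ?k ?i ?l] sep_commute by metis+
    moreover have "sep v ?i ?k ?j ?l \<longleftrightarrow> sep v ?i ?k ?j a \<noteq> sep v ?i ?k a ?l"
      by (rule add) (use P4 d in auto)
    ultimately show "sep v ?i ?k ?j ?l" by blast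
  qed
qed

lemma triple_types:
  assumes five: "five v i j k l" and s: "sep v i k j l"
  shows
    "X v i j k \<and> X v i j l \<and> X v j k l \<longrightarrow> X v i k l"
    "X v j i k \<and> X v j i l \<and> X v k j l \<longrightarrow> X v k i l"
    "\<not> X v i j k \<and> \<not> X v j i k \<and> \<not> X v i j l \<and> \<not> X v j i l \<and> \<not> X v j k l \<and> \<not> X v k j l \<longrightarrow>
      \<not> X v i k l \<and> \<not> X v k i l"
    "\<not> X v i j k \<and> \<not> X v j i k \<and> \<not> X v i j l \<and> \<not> X v j i l \<and> \<not> X v j k l \<and> \<not> X v k j l \<and>
      X v l i j \<and> X v l j k \<longrightarrow> X v k i j \<and> X v l i k"
    "\<not> X v i j k \<and> \<not> X v j i k \<and> \<not> X v i j l \<and> \<not> X v j i l \<and> \<not> X v j k l \<and> \<not> X v k j l \<and>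
      X v k i j \<longrightarrow> X v l i j"
    "X v i j k \<and> X v i j l \<and> X v i k l \<and> X v j k l \<longrightarrow> X i l j k"
    "X v k i j \<and> X v l i j \<and> X v l i k \<and> X v l j k \<longrightarrow> X i l j k"
    "X v j i k \<and> X v j i l \<and> X v k i l \<and> X v k j l \<longrightarrow> X i k j l"
    "\<not> (X v i j k \<or> X v j i k \<or> X v k i j) \<and> \<not> (X v i j l \<or> X v j i l \<or> X v l i j) \<and>
      \<not> (X v i k l \<or> X v k i l \<or> X v l i k) \<and> \<not> (X v j k l \<or> X v k j l \<or> X v l j k) \<longrightarrow> X i k j l"
proof -
  note f = five_rules[OF five]
  have n: "\<not> sep v i j k l" "\<not> sep v i l j k" using sep_exactly_one[OF five] s by blast+
  note facts = s[unfolded sep_def] n[unfolded sep_def]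
    K4_at_most_one[OF f(1)] K4_at_most_one[OF f(4)] K4_at_most_one[OF f(7)] K4_at_most_one[OF f(10)] K4_at_most_one[OF f(13)]
    crossing_rules[OF f(1)] crossing_rules[OF f(2)] crossing_rules[OF f(3)] crossing_rules[OF f(4)] crossing_rules[OF f(5)]
    crossing_rules[OF f(6)] crossing_rules[OF f(7)] crossing_rules[OF f(8)] crossing_rules[OF f(9)] crossing_rules[OF f(10)]
    crossing_rules[OF f(11)] crossing_rules[OF f(12)] crossing_rules[OF f(13)] crossing_rules[OF f(14)] crossing_rules[OF f(15)]
  note facts' = facts[simplified X_flip X_swap]
  show "X v i j k \<and> X v i j l \<and> X v j k l \<longrightarrow> X v i k l"
    "X v j i k \<and> X v j i l \<and> X v k j l \<longrightarrow> X v k i l"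
    "\<not> X v i j k \<and> \<not> X v j i k \<and> \<not> X v i j l \<and> \<not> X v j i l \<and> \<not> X v j k l \<and> \<not> X v k j l \<longrightarrow>
      \<not> X v i k l \<and> \<not> X v k i l"
    "\<not> X v i j k \<and> \<not> X v j i k \<and> \<not> X v i j l \<and> \<not> X v j i l \<and> \<not> X v j k l \<and> \<not> X v k j l \<and>
      X v l i j \<and> X v l j k \<longrightarrow> X v k i j \<and> X v l i k"
    "\<not> X v i j k \<and> \<not> X v j i k \<and> \<not> X v i j l \<and> \<not> X v j i l \<and> \<not> X v j k l \<and> \<not> X v k j l \<and>
      X v k i j \<longrightarrow> X v l i j"
    "X v i j k \<and> X v i j l \<and> X v i k l \<and> X v j k l \<longrightarrow> X i l j k"
    "X v k i j \<and> X v l i j \<and> X v l i k \<and> X v l j k \<longrightarrow> X i l j k"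
    "X v j i k \<and> X v j i l \<and> X v k i l \<and> X v k j l \<longrightarrow> X i k j l"
    "\<not> (X v i j k \<or> X v j i k \<or> X v k i j) \<and> \<not> (X v i j l \<or> X v j i l \<or> X v l i j) \<and>
      \<not> (X v i k l \<or> X v k i l \<or> X v l i k) \<and> \<not> (X v j k l \<or> X v k j l \<or> X v l j k) \<longrightarrow> X i k j l"
    by (simp only: X_flip X_swap; use facts' in sat)+
qed

end

section \<open>A Ramsey theorem for uniform paths in triple systems\<close>

text \<open>\<open>S\<close> is the reservoir of possible later vertices. The colour of a
  consecutive pair is promised for all of \<open>S\<close> in advance, which is what makes the path
  extendable.\<close>

definition uniform_path :: "(nat \<Rightarrow> nat \<Rightarrow> nat \<Rightarrow> nat) \<Rightarrow> nat \<Rightarrow> nat list \<Rightarrow> nat set \<Rightarrow> bool" where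
  "uniform_path \<kappa> c ps S \<longleftrightarrow> sorted_wrt (<) ps \<and> (\<forall>x\<in>S. \<forall>y\<in>set ps. y < x) \<and>
    (\<forall>i. Suc i < length ps \<longrightarrow> (\<forall>w \<in> S \<union> set (drop (i + 2) ps). \<kappa> (ps ! i) (ps ! Suc i) w = c))"

lemma uniform_path_singleton: "\<forall>x\<in>S. v < x \<Longrightarrow> uniform_path \<kappa> c [v] S"
  unfolding uniform_path_def by auto

lemma uniform_path_snoc:
  assumes p: "uniform_path \<kappa> c ps S" and ne: "ps \<noteq> []" and v: "v \<in> S" and S': "S' \<subseteq> S" "\<forall>x\<in>S'. v < x"
    and col: "\<And>x. x \<in> S' \<Longrightarrow> \<kappa> (last ps) v x = c"
  shows "uniform_path \<kappa> c (ps @ [v]) S'"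
  unfolding uniform_path_def
proof (intro conjI allI impI ballI)
  show "sorted_wrt (<) (ps @ [v])" using p v unfolding uniform_path_def by (auto simp: sorted_wrt_append)
  show "y < x" if "x \<in> S'" "y \<in> set (ps @ [v])" for x y
    using p S' that unfolding uniform_path_def by auto
  fix i w assume i: "Suc i < length (ps @ [v])" and w: "w \<in> S' \<union> set (drop (i + 2) (ps @ [v]))"
  show "\<kappa> ((ps @ [v]) ! i) ((ps @ [v]) ! Suc i) w = c"
  proof (cases "Suc i < length ps")
    case True
    then have "w \<in> S \<union> set (drop (i + 2) ps)" using w S' v by auto
    then show ?thesis using p True unfolding uniform_path_def by (auto simp: nth_append)
  next
    case False
    then have len: "Suc i = length ps" using i by simp
    then have "w \<in> S'" using w by auto
    moreover have "ps ! i = last ps" using len ne by (metis last_conv_nth diff_Suc_1)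
    ultimately show ?thesis using col len by (simp add: nth_append)
  qed
qed

text \<open>Induction on the distance of the first two positions: consecutive pairs are good by
  definition, and \<open>closed\<close> moves the second position one step further along the
  path.\<close>

lemma uniform_path_clique:
  assumes p: "uniform_path \<kappa> c ps S"
    and closed: "\<And>i j k l. i < j \<Longrightarrow> j < k \<Longrightarrow> k < l \<Longrightarrow> {i, j, k, l} \<subseteq> set ps \<Longrightarrow>
      \<kappa> i j k = c \<Longrightarrow> \<kappa> i j l = c \<Longrightarrow> \<kappa> j k l = c \<Longrightarrow> \<kappa> i k l = c"
    and "i < j" "j < k" "k < length ps"
  shows "\<kappa> (ps ! i) (ps ! j) (ps ! k) = c"
proof -
  have srt: "ps ! a < ps ! b" if "a < b" "b < length ps" for a b
    using p that unfolding uniform_path_def by (simp add: sorted_wrt_iff_nth_less)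
  have unif: "\<kappa> (ps ! a) (ps ! Suc a) (ps ! b) = c" if "Suc a < b" "b < length ps" for a b
  proof -
    have "a + 2 + (b - (a + 2)) = b" using that by simp
    then have "drop (a + 2) ps ! (b - (a + 2)) = ps ! b" using that by (subst nth_drop) auto
    moreover have "b - (a + 2) < length (drop (a + 2) ps)" using that by auto
    ultimately have "ps ! b \<in> set (drop (a + 2) ps)" by (metis nth_mem)
    then show ?thesis using p that unfolding uniform_path_def by auto
  qed
  have "\<forall>k. i + Suc d < k \<longrightarrow> k < length ps \<longrightarrow> \<kappa> (ps ! i) (ps ! (i + Suc d)) (ps ! k) = c" for d
  proof (induction d)
    case 0
    then show ?case using unif by simp
  next
    case (Suc d)
    show ?case
    proof (intro allI impI)
      fix k assume k: "i + Suc (Suc d) < k" "k < length ps"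
      show "\<kappa> (ps ! i) (ps ! (i + Suc (Suc d))) (ps ! k) = c"
      proof (rule closed[of _ "ps ! (i + Suc d)"])
        show "\<kappa> (ps ! i) (ps ! (i + Suc d)) (ps ! (i + Suc (Suc d))) = c"
          "\<kappa> (ps ! i) (ps ! (i + Suc d)) (ps ! k) = c" using Suc k by auto
        show "\<kappa> (ps ! (i + Suc d)) (ps ! (i + Suc (Suc d))) (ps ! k) = c" using unif[of "i + Suc d" k] k by simp
      qed (use k srt in auto)
    qed
  qed
  from this[of "j - Suc i"] show ?thesis using assms(3-5) by simp
qed

lemma pigeonhole_fiber:
  assumes fin: "finite S" and f: "f ` S \<subseteq> F" "finite F" and big: "card S > card F * m"
  obtains y where "card {x \<in> S. f x = y} > m"
proof (rule ccontr)
  assume "\<not> thesis"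
  then have le: "card {x \<in> S. f x = y} \<le> m" for y using that by (meson not_le)
  have "card S = (\<Sum>y\<in>F. card {x \<in> S. f x = y})"
    using sum.group[OF fin f(2,1), of "\<lambda>_. 1::nat"] by simp
  also have "\<dots> \<le> card F * m" using sum_bounded_above[of F "\<lambda>y. card {x \<in> S. f x = y}" m] le by simp
  finally show False using big by simp
qed

text \<open>A new vertex \<open>v\<close> is attached, for each colour, only to the end of a longest path of that colour, so
  \<open>(T + 1) ^ q\<close> classes of continuations suffice; the vectors of path lengths still separate vertices.\<close>

lemma online_labelling:
  fixes \<kappa> :: "nat \<Rightarrow> nat \<Rightarrow> nat \<Rightarrow> nat"
  assumes col: "\<And>i j k. \<kappa> i j k < q" and fin: "finite S0"
    and D: "D = (T + 1) ^ q + 1" and big: "card S0 \<ge> D ^ T" and "t \<le> T"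
  shows "\<exists>U S L. finite U \<and> card U = t \<and> U \<subseteq> S0 \<and> S \<subseteq> S0 \<and> card S \<ge> D ^ (T - t) \<and> (\<forall>u\<in>U. \<forall>x\<in>S. u < x) \<and>
    (\<forall>u\<in>U. \<forall>u'\<in>U. u \<noteq> u' \<longrightarrow> (\<exists>c<q. L u c \<noteq> L u' c)) \<and>
    (\<forall>u\<in>U. \<forall>c<q. \<exists>ps. ps \<noteq> [] \<and> last ps = u \<and> length ps = Suc (L u c) \<and> set ps \<subseteq> S0 \<and> uniform_path \<kappa> c ps S)"
  using \<open>t \<le> T\<close>
proof (induction t)
  case 0
  show ?case by (rule exI[of _ "{}"], rule exI[of _ S0]) (use big in auto)
next
  case (Suc t)
  then have "t \<le> T" by simp
  from Suc.IH[OF this] obtain U S and L :: "nat \<Rightarrow> nat \<Rightarrow> nat" where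
    U: "finite U" "card U = t" "U \<subseteq> S0" and S: "S \<subseteq> S0" "card S \<ge> D ^ (T - t)"
    and US0: "\<forall>u\<in>U. \<forall>x\<in>S. u < x"
    and inj0: "\<forall>u\<in>U. \<forall>u'\<in>U. u \<noteq> u' \<longrightarrow> (\<exists>c<q. L u c \<noteq> L u' c)"
    and paths0: "\<forall>u\<in>U. \<forall>c<q. \<exists>ps. ps \<noteq> [] \<and> last ps = u \<and> length ps = Suc (L u c) \<and> set ps \<subseteq> S0 \<and> uniform_path \<kappa> c ps S"
    by (elim exE conjE) (rule that)
  note US = US0[rule_format] and inj = inj0[rule_format] and paths = paths0[rule_format]
  have finS: "finite S" using S(1) fin finite_subset by blast
  have D2: "D \<ge> 2" unfolding D by simp
  define m where "m = D ^ (T - Suc t)"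
  have m1: "m \<ge> 1" unfolding m_def using D2 by simp
  have Dm: "card S \<ge> D * m" unfolding m_def using S(2) Suc.prems by (metis Suc_diff_Suc Suc_le_eq power_Suc)
  then have "S \<noteq> {}" using D2 m1 by fastforce
  define v where "v = Min S"
  have v: "v \<in> S" "\<And>x. x \<in> S - {v} \<Longrightarrow> v < x"
    unfolding v_def using finS \<open>S \<noteq> {}\<close> by (auto simp: order.not_eq_order_implies_strict)
  have vU: "v \<notin> U" using US v(1) by blast
  \<comment> \<open>Among the earlier vertices \<open>u\<close> with colour \<open>c\<close> on
    \<open>u\<close>, \<open>v\<close>, \<open>x\<close>, those with the largest label for
    \<open>c\<close>. The function \<open>wit x\<close> records one of them per colour, or
    \<open>None\<close>, so there are at most \<open>(t + 1) ^ q\<close> such functions.\<close>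
  define best where "best x c u \<longleftrightarrow> u \<in> U \<and> \<kappa> u v x = c \<and> (\<forall>u'\<in>U. \<kappa> u' v x = c \<longrightarrow> L u' c \<le> L u c)" for x c u
  define wit where "wit x = (\<lambda>c\<in>{..<q}. if \<exists>u\<in>U. \<kappa> u v x = c then Some (SOME u. best x c u) else None)" for x
  have best_ex: "best x c (SOME u. best x c u)" if "\<exists>u\<in>U. \<kappa> u v x = c" for x c
  proof -
    let ?W = "{u \<in> U. \<kappa> u v x = c}"
    have "finite ?W" "?W \<noteq> {}" using U that by auto
    then have "Max ((\<lambda>u. L u c) ` ?W) \<in> (\<lambda>u. L u c) ` ?W" by (intro Max_in) auto
    then obtain u where u: "u \<in> ?W" "L u c = Max ((\<lambda>u. L u c) ` ?W)" by auto
    have "L u' c \<le> L u c" if "u' \<in> ?W" for u' unfolding u(2) using that \<open>finite ?W\<close> by auto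
    then have "best x c u" using u(1) unfolding best_def by auto
    then show ?thesis by (rule someI)
  qed
  let ?F = "{..<q} \<rightarrow>\<^sub>E insert None (Some ` U)"
  have "wit ` (S - {v}) \<subseteq> ?F"
  proof (rule image_subsetI, rule PiE_I)
    fix x c assume "x \<in> S - {v}" "c \<in> {..<q}"
    then show "wit x c \<in> insert None (Some ` U)" using best_ex[of x c] unfolding wit_def best_def by auto
  qed (auto simp: wit_def)
  moreover have "finite ?F" using U by (intro finite_PiE) auto
  moreover have "card (S - {v}) > card ?F * (m - 1)"
  proof -
    have "card ?F = (t + 1) ^ q" using U by (simp add: card_PiE card_image)
    also have "\<dots> \<le> D - 1" unfolding D using Suc.prems by (simp add: power_mono)
    finally have "card ?F * (m - 1) \<le> (D - 1) * (m - 1)" by simp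
    \<comment> \<open>The 1 subtracted on the right is \<open>v\<close>, which leaves the reservoir;
      the extra 1 in \<open>D\<close> leaves room for it.\<close>
    also have "\<dots> < D * m - 1" using D2 m1 by (cases D; cases m) auto
    also have "\<dots> \<le> card (S - {v})" using Dm v(1) finS by simp
    finally show ?thesis .
  qed
  moreover have "finite (S - {v})" using finS by simp
  ultimately obtain W where W: "card {x \<in> S - {v}. wit x = W} > m - 1"
    using pigeonhole_fiber[of "S - {v}" wit ?F "m - 1"] by blast
  define S' where "S' = {x \<in> S - {v}. wit x = W}"
  have S': "S' \<subseteq> S" "card S' \<ge> m" "\<And>x. x \<in> S' \<Longrightarrow> v < x" "\<And>x. x \<in> S' \<Longrightarrow> wit x = W"
    using W v(2) m1 unfolding S'_def by auto
  have "S' \<noteq> {}" using S'(2) m1 by auto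
  then obtain x0 where x0: "x0 \<in> S'" by blast
  have Wsome: "u \<in> U \<and> (\<forall>x\<in>S'. best x c u)" if "W c = Some u" "c < q" for c u
  proof -
    have "best x c u" if "x \<in> S'" for x
      using S'(4)[OF that] \<open>W c = Some u\<close> \<open>c < q\<close> best_ex[of x c] unfolding wit_def
      by (auto split: if_splits)
    then show ?thesis using x0 unfolding best_def by blast
  qed
  \<comment> \<open>A label is the length of a path minus one: \<open>v\<close> starts a new path of
    colour \<open>c\<close> if there is no witness, and prolongs the path of its witness
    otherwise.\<close>
  define l where "l c = (case W c of None \<Rightarrow> 0 | Some u \<Rightarrow> Suc (L u c))" for c
  define L' where "L' = L(v := l)"
  \<comment> \<open>The separating colour is that of \<open>u\<close>, \<open>v\<close> and any
    reservoir vertex: its witness has a label at least that of \<open>u\<close>, and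
    \<open>v\<close> gets one more.\<close>
  have sep: "\<exists>c<q. L u c \<noteq> l c" if u: "u \<in> U" for u
  proof -
    let ?c = "\<kappa> u v x0"
    have c: "?c < q" by (rule col)
    have "wit x0 ?c \<noteq> None" using u c unfolding wit_def by auto
    then obtain u' where u': "W ?c = Some u'" using S'(4)[OF x0] by auto
    then have "best x0 ?c u'" using Wsome c x0 by blast
    then have "L u ?c \<le> L u' ?c" using u unfolding best_def by blast
    then show ?thesis using c u' unfolding l_def by (intro exI[of _ ?c]) auto
  qed
  show ?case
  proof (rule exI[of _ "insert v U"], rule exI[of _ S'], rule exI[of _ L'], intro conjI ballI allI impI)
    show "finite (insert v U)" "card (insert v U) = Suc t" "insert v U \<subseteq> S0" "S' \<subseteq> S0" using U vU S S' v(1) by auto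
    show "D ^ (T - Suc t) \<le> card S'" using S'(2) unfolding m_def .
    show "u < x" if "u \<in> insert v U" "x \<in> S'" for u x using that S' US by auto
    show "\<exists>c<q. L' u c \<noteq> L' u' c" if "u \<in> insert v U" "u' \<in> insert v U" "u \<noteq> u'" for u u'
      using that inj[of u u'] sep[of u] sep[of u'] vU unfolding L'_def by (auto simp: eq_commute)
    fix u c assume u: "u \<in> insert v U" and c: "c < q"
    have mono: "uniform_path \<kappa> c ps S'" if "uniform_path \<kappa> c ps S" for ps
      using that S'(1) unfolding uniform_path_def by blast
    show "\<exists>ps. ps \<noteq> [] \<and> last ps = u \<and> length ps = Suc (L' u c) \<and> set ps \<subseteq> S0 \<and> uniform_path \<kappa> c ps S'"
    proof (cases "u = v")
      case False
      then have "u \<in> U" using u by simp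
      from paths[OF this c] show ?thesis using mono False unfolding L'_def by auto
    next
      case True
      show ?thesis
      proof (cases "W c")
        case None
        have "uniform_path \<kappa> c [v] S'" using S'(3) by (intro uniform_path_singleton) auto
        then show ?thesis using None True v(1) S(1) unfolding L'_def l_def by (intro exI[of _ "[v]"]) auto
      next
        case (Some w)
        have w: "w \<in> U" "\<And>x. x \<in> S' \<Longrightarrow> best x c w" using Wsome[OF Some c] by auto
        obtain ps where ps: "ps \<noteq> []" "last ps = w" "length ps = Suc (L w c)" "set ps \<subseteq> S0" "uniform_path \<kappa> c ps S"
          using paths[OF w(1) c] by blast
        have "uniform_path \<kappa> c (ps @ [v]) S'"
          by (rule uniform_path_snoc[OF ps(5,1) v(1) S'(1)]) (use S' w ps in \<open>auto simp: best_def\<close>)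
        then show ?thesis using Some True ps v(1) S(1) unfolding L'_def l_def by (intro exI[of _ "ps @ [v]"]) auto
      qed
    qed
  qed
qed

text \<open>\<open>T\<close> distinct label vectors do not fit into the box with sides
  \<open>len c\<close>, so some label reaches \<open>len c\<close>, and its path has one vertex
  more.\<close>

lemma uniform_path_exists:
  fixes \<kappa> :: "nat \<Rightarrow> nat \<Rightarrow> nat \<Rightarrow> nat" and len :: "nat \<Rightarrow> nat"
  assumes col: "\<And>i j k. \<kappa> i j k < q" and T: "T = (\<Prod>c<q. len c) + 1"
    and big: "n \<ge> ((T + 1) ^ q + 1) ^ T"
  obtains c ps where "c < q" "length ps > len c" "set ps \<subseteq> {..<n}" "uniform_path \<kappa> c ps {}"
proof -
  have "card {..<n} \<ge> ((T + 1) ^ q + 1) ^ T" using big by simp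
  from online_labelling[where \<kappa> = \<kappa> and q = q and t = T, OF col finite_lessThan refl this order_refl]
  obtain U S and L :: "nat \<Rightarrow> nat \<Rightarrow> nat" where U: "finite U" "card U = T"
    and inj0: "\<forall>u\<in>U. \<forall>u'\<in>U. u \<noteq> u' \<longrightarrow> (\<exists>c<q. L u c \<noteq> L u' c)"
    and paths0: "\<forall>u\<in>U. \<forall>c<q. \<exists>ps. ps \<noteq> [] \<and> last ps = u \<and> length ps = Suc (L u c) \<and> set ps \<subseteq> {..<n} \<and> uniform_path \<kappa> c ps S"
    by (elim exE conjE) (rule that)
  note inj = inj0[rule_format] and paths = paths0[rule_format]
  have "\<exists>u\<in>U. \<exists>c<q. L u c \<ge> len c"
  proof (rule ccontr)
    assume "\<not> ?thesis"
    then have small: "L u c < len c" if "u \<in> U" "c < q" for u c using that by (meson not_le)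
    let ?f = "\<lambda>u. \<lambda>c\<in>{..<q}. L u c"
    have "inj_on ?f U"
    proof (rule inj_onI, rule ccontr)
      fix u u' assume u: "u \<in> U" "u' \<in> U" "?f u = ?f u'" "u \<noteq> u'"
      then obtain c where c: "c < q" "L u c \<noteq> L u' c" using inj by blast
      have "?f u c = ?f u' c" using u(3) by simp
      then show False using c by simp
    qed
    moreover have "?f ` U \<subseteq> (\<Pi>\<^sub>E c\<in>{..<q}. {..<len c})" using small by (auto split: if_splits)
    moreover have "finite (\<Pi>\<^sub>E c\<in>{..<q}. {..<len c})" by (intro finite_PiE) auto
    ultimately have "card U \<le> card (\<Pi>\<^sub>E c\<in>{..<q}. {..<len c})" by (metis card_image card_mono)
    then show False using U T by (simp add: card_PiE)
  qed
  then obtain u c where u: "u \<in> U" "c < q" "L u c \<ge> len c" by blast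
  obtain ps where "length ps = Suc (L u c)" "set ps \<subseteq> {..<n}" "uniform_path \<kappa> c ps S" using paths[OF u(1,2)] by blast
  moreover from this have "uniform_path \<kappa> c ps {}" unfolding uniform_path_def by blast
  ultimately show thesis using that[of c ps] u by simp
qed

text \<open>Label \<open>i\<close> by the size of a largest chain that ends in \<open>i\<close>.
  Labels grow strictly along \<open>Z\<close>, so either some label reaches \<open>m\<close>, or a
  frequent label gives a set on which \<open>Z\<close> fails.\<close>

lemma chain_or_antichain:
  fixes Z :: "nat \<Rightarrow> nat \<Rightarrow> bool"
  assumes trans: "\<And>i j k. i < j \<Longrightarrow> j < k \<Longrightarrow> k < M \<Longrightarrow> Z i j \<Longrightarrow> Z j k \<Longrightarrow> Z i k"
    and M: "M \<ge> m * m" and m: "m \<ge> 1"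
  obtains C where "C \<subseteq> {..<M}" "card C \<ge> m"
    "(\<forall>i\<in>C. \<forall>j\<in>C. i < j \<longrightarrow> Z i j) \<or> (\<forall>i\<in>C. \<forall>j\<in>C. i < j \<longrightarrow> \<not> Z i j)"
proof -
  define ch where "ch i C \<longleftrightarrow> C \<subseteq> {..i} \<and> i \<in> C \<and> (\<forall>a\<in>C. \<forall>b\<in>C. a < b \<longrightarrow> Z a b)" for i C
  define h where "h i = Max (card ` {C. ch i C})" for i
  have fin: "finite {C. ch i C}" for i
    by (rule finite_subset[of _ "Pow {..i}"]) (auto simp: ch_def)
  have ne: "ch i {i}" for i unfolding ch_def by auto
  have hle: "card C \<le> h i" if "ch i C" for i C unfolding h_def using fin that by (intro Max_ge) auto
  have hex: "\<exists>C. ch i C \<and> card C = h i" for i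
  proof -
    have "h i \<in> card ` {C. ch i C}" unfolding h_def using fin ne by (intro Max_in) auto
    then show ?thesis by auto
  qed
  have h1: "h i \<ge> 1" for i using hle[OF ne[of i]] by simp
  have step: "h i < h j" if ij: "i < j" "j < M" "Z i j" for i j
  proof -
    obtain C where C: "ch i C" "card C = h i" using hex by blast
    have "ch j (insert j C)"
      unfolding ch_def
    proof (intro conjI ballI impI)
      show "insert j C \<subseteq> {..j}" using C(1) ij unfolding ch_def by auto
      fix a b assume ab: "a \<in> insert j C" "b \<in> insert j C" "a < b"
      have le: "x \<le> i" if "x \<in> C" for x using C(1) that unfolding ch_def by auto
      show "Z a b"
      proof (cases "b = j")
        case True
        then have "a \<in> C" using ab by auto
        then have "a = i \<or> a < i \<and> Z a i" using le C(1) unfolding ch_def by (metis order_le_less)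
        then show ?thesis using trans[of a i j] ij True by auto
      next
        case False
        then show ?thesis using ab C(1) le ij unfolding ch_def by force
      qed
    qed auto
    moreover have "finite C" "j \<notin> C" using C(1) ij finite_subset unfolding ch_def by fastforce+
    ultimately show ?thesis using hle[of j "insert j C"] C(2) by simp
  qed
  show thesis
  proof (cases "\<exists>i<M. h i \<ge> m")
    case True
    then obtain i where i: "i < M" "h i \<ge> m" by blast
    obtain C where C: "ch i C" "card C = h i" using hex by blast
    show thesis by (rule that[of C]) (use C i in \<open>auto simp: ch_def\<close>)
  next
    case False
    have "h ` {..<M} \<subseteq> {1..<m}" using False h1 by (auto simp: not_le)
    moreover have "card {..<M} > card {1..<m} * (m - 1)"
    proof -
      have "(m - 1) * (m - 1) < m * m" using m by (cases m) auto
      then show ?thesis using M by simp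
    qed
    ultimately obtain y where y: "card {x \<in> {..<M}. h x = y} > m - 1"
      using pigeonhole_fiber[of "{..<M}" h "{1..<m}" "m - 1"] by blast
    show thesis
    proof (rule that[of "{x \<in> {..<M}. h x = y}"])
      show "card {x \<in> {..<M}. h x = y} \<ge> m" using y by simp
      have "\<not> Z i j" if "h i = y" "h j = y" "i < j" "j < M" for i j using step[of i j] that by auto
      then show "(\<forall>i\<in>{x \<in> {..<M}. h x = y}. \<forall>j\<in>{x \<in> {..<M}. h x = y}. i < j \<longrightarrow> Z i j) \<or>
        (\<forall>i\<in>{x \<in> {..<M}. h x = y}. \<forall>j\<in>{x \<in> {..<M}. h x = y}. i < j \<longrightarrow> \<not> Z i j)" by blast
    qed auto
  qed
qed

section \<open>From uniform paths to cliques of one crossing pattern\<close>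

context simple_drawing
begin

lemma nested_or_alternating_clique:
  assumes fin: "finite V" and m: "m \<ge> 1"
    and big: "card V \<ge> 2 * ((m ^ 4 + 2) ^ 3 + 1) ^ (m ^ 4 + 1) + 3"
  obtains w where "inj_on w {..<m}" "w ` {..<m} \<subseteq> V"
    "(\<forall>i j k l. i < j \<longrightarrow> j < k \<longrightarrow> k < l \<longrightarrow> l < m \<longrightarrow> X (w i) (w l) (w j) (w k)) \<or>
     (\<forall>i j k l. i < j \<longrightarrow> j < k \<longrightarrow> k < l \<longrightarrow> l < m \<longrightarrow> X (w i) (w k) (w j) (w l))"
proof -
  obtain v where v: "v \<in> V" using big by fastforce
  obtain N p where N: "2 * N + 3 \<ge> card V" and p: "inj_on p {..<N}" "p ` {..<N} \<subseteq> V - {v}"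
    and rot: "\<And>i j k l. i < j \<Longrightarrow> j < k \<Longrightarrow> k < l \<Longrightarrow> l < N \<Longrightarrow> sep v (p i) (p k) (p j) (p l)"
    by (rule rotation_order[OF fin v]) blast
  \<comment> \<open>The values 0, 1 and 2 stand for the classes of \<open>x\<close>, of
    \<open>y\<close>, and of \<open>0\<close> together with \<open>z\<close>.\<close>
  define \<kappa> :: "nat \<Rightarrow> nat \<Rightarrow> nat \<Rightarrow> nat" where
    "\<kappa> i j k = (if X v (p i) (p j) (p k) then 0 else if X v (p j) (p i) (p k) then 1 else 2)" for i j k
  \<comment> \<open>The joint class needs \<open>m * m\<close> because it is split once more; the
    product of the three lengths is \<open>m ^ 4\<close>.\<close>
  define len :: "nat \<Rightarrow> nat" where "len c = (if c = 2 then m * m else m)" for c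
  have F: "five v (p i) (p j) (p k) (p l)" and S: "sep v (p i) (p k) (p j) (p l)"
    if "i < j" "j < k" "k < l" "l < N" for i j k l
  proof -
    have "x < N \<Longrightarrow> p x \<in> V - {v}" for x using p(2) by blast
    then have "p i \<in> V - {v}" "p j \<in> V - {v}" "p k \<in> V - {v}" "p l \<in> V - {v}" using that by auto
    moreover have "p x \<noteq> p y" if "x < y" "y < N" for x y using inj_onD[OF p(1), of x y] that by auto
    then have "distinct [p i, p j, p k, p l]" using that by simp
    ultimately show "five v (p i) (p j) (p k) (p l)" unfolding five_def using v by auto
    show "sep v (p i) (p k) (p j) (p l)" by (rule rot) (use that in auto)
  qed
  have excl: "\<not> (X v a b c \<and> X v b a c)" "\<not> (X v a b c \<and> X v c a b)" "\<not> (X v b a c \<and> X v c a b)"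
    if "five v a b c d" for a b c d using K4_at_most_one[OF that] by auto
  have k01: "\<kappa> i j k = 0 \<longleftrightarrow> X v (p i) (p j) (p k)"
    "\<kappa> i j k = 2 \<longleftrightarrow> \<not> X v (p i) (p j) (p k) \<and> \<not> X v (p j) (p i) (p k)"
    "\<kappa> i j k = 1 \<longleftrightarrow> \<not> X v (p i) (p j) (p k) \<and> X v (p j) (p i) (p k)" for i j k
    unfolding \<kappa>_def by auto
  have T: "m ^ 4 + 1 = (\<Prod>c<3. len c) + 1"
    unfolding len_def by (simp add: numeral_eq_Suc lessThan_Suc mult.assoc)
  have "m ^ 4 + 1 + 1 = m ^ 4 + 2" by simp
  then have "N \<ge> ((m ^ 4 + 1 + 1) ^ 3 + 1) ^ (m ^ 4 + 1)" using N big by (simp only:)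
  moreover have "\<kappa> i j k < 3" for i j k unfolding \<kappa>_def by simp
  ultimately obtain c ps where c: "c < 3" "length ps > len c" and psN: "set ps \<subseteq> {..<N}" and path: "uniform_path \<kappa> c ps {}"
    using uniform_path_exists[of \<kappa> 3 "m ^ 4 + 1" len N] T by metis
  have srt: "ps ! a < ps ! b" if "a < b" "b < length ps" for a b
    using path that unfolding uniform_path_def by (simp add: sorted_wrt_iff_nth_less)
  have inN: "ps ! a < N" if "a < length ps" for a using psN that nth_mem by blast
  have closed: "\<kappa> i k l = c" if o: "i < j" "j < k" "k < l" "{i, j, k, l} \<subseteq> set ps"
      and col: "\<kappa> i j k = c" "\<kappa> i j l = c" "\<kappa> j k l = c" for i j k l
  proof -
    have "l < N" using o psN by auto
    note f = F[OF o(1-3) this] and t = triple_types[OF F[OF o(1-3) this] S[OF o(1-3) this]]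
    have f': "five v (p i) (p k) (p l) (p j)" using f unfolding five_def by auto
    consider "c = 0" | "c = 1" | "c = 2" using c(1) by linarith
    then show ?thesis
    proof cases
      case 1
      then show ?thesis using col t(1) k01 by simp
    next
      case 2
      then have "X v (p k) (p i) (p l)" using col t(2) k01 by simp
      then show ?thesis using excl(1)[OF f'] 2 k01 by simp
    next
      case 3
      then show ?thesis using col t(3) k01 by simp
    qed
  qed
  define r where "r a = p (ps ! a)" for a
  have col: "\<kappa> (ps ! i) (ps ! j) (ps ! k) = c" if "i < j" "j < k" "k < length ps" for i j k
    by (rule uniform_path_clique[OF path]) (use closed that in blast)+
  have F': "five v (r i) (r j) (r k) (r l)" and T': "sep v (r i) (r k) (r j) (r l)"
    if "i < j" "j < k" "k < l" "l < length ps" for i j k l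
    unfolding r_def using F[of "ps ! i" "ps ! j" "ps ! k" "ps ! l"] S[of "ps ! i" "ps ! j" "ps ! k" "ps ! l"] srt inN that by auto
  note types = triple_types[OF F' T']
  have injr: "inj_on r {..<length ps}"
  proof (rule linorder_inj_onI)
    fix a b assume ab: "a < b" "a \<in> {..<length ps}" "b \<in> {..<length ps}"
    show "r a \<noteq> r b"
      unfolding r_def using inj_onD[OF p(1), of "ps ! a" "ps ! b"] srt[of a b] inN[of a] inN[of b] ab by auto
  qed auto
  have rV: "r a \<in> V" if "a < length ps" for a unfolding r_def using p(2) inN[OF that] by auto
  consider "c = 0" | "c = 1" | "c = 2" using c(1) by linarith
  then show thesis
  proof cases
    case 1
    have x: "X v (r i) (r j) (r k)" if "i < j" "j < k" "k < length ps" for i j k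
      using col[OF that] k01(1) 1 unfolding r_def by simp
    have len: "m < length ps" using c(2) 1 unfolding len_def by simp
    have "X (r i) (r l) (r j) (r k)" if "i < j" "j < k" "k < l" "l < m" for i j k l
      using types(6)[of i j k l] x[of i j k] x[of i j l] x[of i k l] x[of j k l] that len by auto
    then show ?thesis using that[of r] inj_on_subset[OF injr, of "{..<m}"] rV len by fastforce
  next
    case 2
    have y: "X v (r j) (r i) (r k)" if "i < j" "j < k" "k < length ps" for i j k
      using col[OF that] k01(3) 2 unfolding r_def by simp
    have len: "m < length ps" using c(2) 2 unfolding len_def by simp
    have "X (r i) (r k) (r j) (r l)" if "i < j" "j < k" "k < l" "l < m" for i j k l
      using types(8)[of i j k l] y[of i j k] y[of i j l] y[of i k l] y[of j k l] that len by auto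
    then show ?thesis using that[of r] inj_on_subset[OF injr, of "{..<m}"] rV len by fastforce
  next
    case 3
    have n: "\<not> X v (r i) (r j) (r k)" "\<not> X v (r j) (r i) (r k)" if "i < j" "j < k" "k < length ps" for i j k
      using col[OF that] k01(2) 3 unfolding r_def by simp_all
    have len: "m * m < length ps" using c(2) 3 unfolding len_def by simp
    \<comment> \<open>The path has more than \<open>m * m\<close> vertices, so position
      \<open>m * m\<close> serves as a common last vertex beyond all candidates. By
      \<open>Z4\<close> chains of \<open>Z\<close> have all triples of colour \<open>z\<close>, and
      by \<open>Z5\<close> sets on which \<open>Z\<close> fails have none.\<close>
    define Z where "Z i j \<longleftrightarrow> X v (r (m * m)) (r i) (r j)" for i j
    have Z4: "X v (r k) (r i) (r j) \<and> Z i k" if "i < j" "j < k" "k < m * m" "Z i j" "Z j k" for i j k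
      using types(4)[of i j k "m * m"] n[of i j k] n[of i j "m * m"] n[of j k "m * m"] that len unfolding Z_def by auto
    have Z5: "Z i j" if "i < j" "j < k" "k < m * m" "X v (r k) (r i) (r j)" for i j k
      using types(5)[of i j k "m * m"] n[of i j k] n[of i j "m * m"] n[of j k "m * m"] that len unfolding Z_def by auto
    obtain C where C: "C \<subseteq> {..<m * m}" "card C \<ge> m"
      "(\<forall>i\<in>C. \<forall>j\<in>C. i < j \<longrightarrow> Z i j) \<or> (\<forall>i\<in>C. \<forall>j\<in>C. i < j \<longrightarrow> \<not> Z i j)"
      by (rule chain_or_antichain[of "m * m" Z m]) (use Z4 m in blast)+
    define s where "s = sorted_list_of_set C"
    have finC: "finite C" using C(1) finite_subset by blast
    have sC: "s ! a \<in> C" "s ! a < m * m" if "a < m" for a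
    proof -
      have "s ! a \<in> set s" using that C(2) finC unfolding s_def by (intro nth_mem) simp
      then show "s ! a \<in> C" using finC unfolding s_def by simp
      then show "s ! a < m * m" using C(1) by auto
    qed
    have sl: "s ! a < s ! b" if "a < b" "b < m" for a b
      using that C(2) strict_sorted_list_of_set[of C] unfolding s_def by (simp add: sorted_wrt_iff_nth_less)
    have inj: "inj_on (\<lambda>a. r (s ! a)) {..<m}"
    proof (rule linorder_inj_onI)
      fix a b assume ab: "a < b" "a \<in> {..<m}" "b \<in> {..<m}"
      show "r (s ! a) \<noteq> r (s ! b)"
        using inj_onD[OF injr, of "s ! a" "s ! b"] sl[of a b] sC[of a] sC[of b] len ab by auto
    qed auto
    have sub: "(\<lambda>a. r (s ! a)) ` {..<m} \<subseteq> V"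
    proof (rule image_subsetI)
      fix a assume "a \<in> {..<m}"
      then show "r (s ! a) \<in> V" using rV[of "s ! a"] sC[of a] len by auto
    qed
    from C(3) show thesis
    proof
      assume chain: "\<forall>i\<in>C. \<forall>j\<in>C. i < j \<longrightarrow> Z i j"
      have z: "X v (r (s ! k)) (r (s ! i)) (r (s ! j))" if "i < j" "j < k" "k < m" for i j k
        using Z4[of "s ! i" "s ! j" "s ! k"] chain sC[of i] sC[of j] sC[of k] sl[of i j] sl[of j k] that by auto
      have "X (r (s ! i)) (r (s ! l)) (r (s ! j)) (r (s ! k))" if o: "i < j" "j < k" "k < l" "l < m" for i j k l
      proof -
        have "s ! l < length ps" using sC[of l] o len by simp
        then show ?thesis
          using types(7)[of "s ! i" "s ! j" "s ! k" "s ! l"] sl[of i j] sl[of j k] sl[of k l]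
            z[of i j k] z[of i j l] z[of i k l] z[of j k l] o by auto
      qed
      then show thesis using that[OF inj sub] by blast
    next
      assume anti: "\<forall>i\<in>C. \<forall>j\<in>C. i < j \<longrightarrow> \<not> Z i j"
      have z: "\<not> (X v (r (s ! i)) (r (s ! j)) (r (s ! k)) \<or> X v (r (s ! j)) (r (s ! i)) (r (s ! k)) \<or> X v (r (s ! k)) (r (s ! i)) (r (s ! j)))"
        if "i < j" "j < k" "k < m" for i j k
        using Z5[of "s ! i" "s ! j" "s ! k"] n[of "s ! i" "s ! j" "s ! k"] anti sC[of i] sC[of j] sC[of k] sl[of i j] sl[of j k] that len
        by auto
      have "X (r (s ! i)) (r (s ! k)) (r (s ! j)) (r (s ! l))" if o: "i < j" "j < k" "k < l" "l < m" for i j k l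
      proof -
        have "s ! l < length ps" using sC[of l] o len by simp
        then show ?thesis
          using types(9)[of "s ! i" "s ! j" "s ! k" "s ! l"] sl[of i j] sl[of j k] sl[of k l]
            z[of i j k] z[of i j l] z[of i k l] z[of j k l] o by auto
      qed
      then show thesis using that[OF inj sub] by blast
    qed
  qed
qed

end

section \<open>The convex graph on a parabola\<close>

text \<open>Weak isomorphism also compares an edge with itself; this makes \<open>cross\<close>
  false there.\<close>

lemma not_properly_cross_at_self: "\<not> properly_cross_at A A p"
proof
  assume "properly_cross_at A A p"
  then have "{z \<in> ball (0::complex) 1. Im z = 0} = {z \<in> ball 0 1. Re z = 0}"
    unfolding properly_cross_at_def by metis
  moreover have "of_real (1/2) \<in> {z \<in> ball (0::complex) 1. Im z = 0}" by simp
  ultimately show False by auto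
qed

text \<open>The chart is affine: coordinates at \<open>p\<close> with respect to the direction
  vectors of the two lines. Its scale \<open>r\<close> is the smallest horizontal distance from
  \<open>p\<close> to an end of a segment, so that the segments look like full lines inside the
  chart.\<close>

lemma properly_cross_at_lines:
  fixes p :: complex
  assumes st: "s \<noteq> t"
    and A: "A = {z. a \<le> Re z \<and> Re z \<le> b \<and> Im z = s * Re z + c}" and p: "p \<in> A" "p \<in> B"
    and B: "B = {z. a' \<le> Re z \<and> Re z \<le> b' \<and> Im z = t * Re z + c'}"
    and strict: "a < Re p" "Re p < b" "a' < Re p" "Re p < b'"
  shows "properly_cross_at A B p"
proof -
  define r where "r = Min {Re p - a, b - Re p, Re p - a', b' - Re p}"
  have r: "r > 0" "r \<le> Re p - a" "r \<le> b - Re p" "r \<le> Re p - a'" "r \<le> b' - Re p"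
    using strict unfolding r_def by auto
  \<comment> \<open>\<open>k\<close> sends the unit vectors to \<open>r\<close> times the directions
    \<open>(1, s)\<close> and \<open>(1, t)\<close>; \<open>h\<close> is its inverse, with
    determinant factor \<open>s - t\<close>.\<close>
  define h where "h z = Complex ((Im (z - p) - t * Re (z - p)) / (r * (s - t))) ((s * Re (z - p) - Im (z - p)) / (r * (s - t)))" for z
  define k where "k w = p + Complex (r * (Re w + Im w)) (r * (s * Re w + t * Im w))" for w
  have rst: "r * (s - t) \<noteq> 0" using r st by auto
  have hk: "h (k w) = w" for w
    using r(1) st unfolding h_def k_def by (simp add: complex_eq_iff field_simps)
  have kh: "k (h z) = z" for z
  proof -
    have \<alpha>: "Re (h z) * (r * (s - t)) = Im (z - p) - t * Re (z - p)"
      and \<beta>: "Im (h z) * (r * (s - t)) = s * Re (z - p) - Im (z - p)"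
      using rst unfolding h_def by simp_all
    have "(s - t) * (r * (Re (h z) + Im (h z))) = (s - t) * Re (z - p)"
      using \<alpha> \<beta> by (simp add: algebra_simps)
    then have "r * (Re (h z) + Im (h z)) = Re (z - p)" using st by simp
    moreover have "(s - t) * (r * (s * Re (h z) + t * Im (h z))) =
        s * (Re (h z) * (r * (s - t))) + t * (Im (h z) * (r * (s - t)))" by (simp add: algebra_simps)
    then have "(s - t) * (r * (s * Re (h z) + t * Im (h z))) = (s - t) * Im (z - p)"
      unfolding \<alpha> \<beta> by (simp add: algebra_simps)
    then have "r * (s * Re (h z) + t * Im (h z)) = Im (z - p)" using st by simp
    ultimately show ?thesis unfolding k_def by (simp add: complex_eq_iff)
  qed
  have ch: "continuous_on S h" for S
    unfolding h_def Complex_eq by (intro continuous_intros) (use rst in auto)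
  have ck: "continuous_on S k" for S
    unfolding k_def Complex_eq by (intro continuous_intros)
  define U where "U = h -` ball 0 1"
  have opU: "open U" unfolding U_def by (rule open_vimage) (auto intro: ch)
  have hp: "h p = 0" unfolding h_def by (simp add: complex_eq_iff)
  have hom: "homeomorphism U (ball 0 1) h k"
    by (rule homeomorphismI) (use ch ck hk kh in \<open>auto simp: U_def\<close>)
  have pA: "Im p = s * Re p + c" "Im p = t * Re p + c'" using p A B by auto
  have lineA: "z \<in> A \<longleftrightarrow> Im (h z) = 0" if "z \<in> U" for z
  proof -
    have "Im (h z) = 0 \<longleftrightarrow> Im z = s * Re z + c"
      using rst pA(1) unfolding h_def by (auto simp: field_simps)
    moreover have "a \<le> Re z \<and> Re z \<le> b" if "Im (h z) = 0"
    proof -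
      have "Re z = Re p + r * Re (h z)" using arg_cong[OF kh[of z], of Re] that unfolding k_def by simp
      moreover have "\<bar>Re (h z)\<bar> < 1" using \<open>z \<in> U\<close> abs_Re_le_cmod[of "h z"] unfolding U_def by simp
      then have "\<bar>r * Re (h z)\<bar> \<le> r" using r(1) by (simp add: abs_mult)
      ultimately show ?thesis using r by linarith
    qed
    ultimately show ?thesis using A by auto
  qed
  have lineB: "z \<in> B \<longleftrightarrow> Re (h z) = 0" if "z \<in> U" for z
  proof -
    have "Re (h z) = 0 \<longleftrightarrow> Im z = t * Re z + c'"
      using rst pA(2) unfolding h_def by (auto simp: field_simps)
    moreover have "a' \<le> Re z \<and> Re z \<le> b'" if "Re (h z) = 0"
    proof -
      have "Re z = Re p + r * Im (h z)" using arg_cong[OF kh[of z], of Re] that unfolding k_def by simp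
      moreover have "\<bar>Im (h z)\<bar> < 1" using \<open>z \<in> U\<close> abs_Im_le_cmod[of "h z"] unfolding U_def by simp
      then have "\<bar>r * Im (h z)\<bar> \<le> r" using r(1) by (simp add: abs_mult)
      ultimately show ?thesis using r by linarith
    qed
    ultimately show ?thesis using B by auto
  qed
  have img: "h ` (U \<inter> S) = {w \<in> ball 0 1. f w = 0}" if "\<And>z. z \<in> U \<Longrightarrow> z \<in> S \<longleftrightarrow> f (h z) = 0"
    for S and f :: "complex \<Rightarrow> real"
  proof (intro set_eqI iffI)
    fix w assume "w \<in> h ` (U \<inter> S)"
    then show "w \<in> {w \<in> ball 0 1. f w = 0}" using that unfolding U_def by auto
  next
    fix w assume w: "w \<in> {w \<in> ball 0 1. f w = 0}"
    then have "k w \<in> U" unfolding U_def by (simp add: hk)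
    then have "k w \<in> U \<inter> S" using that[of "k w"] w by (simp add: hk)
    then show "w \<in> h ` (U \<inter> S)" using hk by (metis imageI)
  qed
  show ?thesis
    unfolding properly_cross_at_def
    using opU hom hp img[OF lineA] img[OF lineB] unfolding U_def by (metis centre_in_ball vimageI2 zero_less_one)
qed

text \<open>On the parabola the chord of \<open>i\<close> and \<open>j\<close> has slope
  \<open>i + j\<close> and intercept \<open>- i * j\<close>, which turns questions about chords into
  arithmetic.\<close>

definition parab :: "nat \<Rightarrow> complex" where
  "parab k = Complex (real k) ((real k)\<^sup>2)"

text \<open>An edge is an unordered set, so the smaller and the larger index are used to choose a
  direction of the segment.\<close>

definition parabola_graph :: "nat \<Rightarrow> topgraph" where
  "parabola_graph m = \<lparr>verts = parab ` {..<m}, edges = {e. e \<subseteq> parab ` {..<m} \<and> card e = 2},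
    curve = (\<lambda>e. linepath (parab (Min {k. parab k \<in> e})) (parab (Max {k. parab k \<in> e})))\<rparr>"

lemma inj_parab: "inj parab"
  unfolding parab_def by (auto intro: injI)

lemma parab_eq_iff [simp]: "parab i = parab j \<longleftrightarrow> i = j"
  using inj_parab by (auto dest: injD)

lemma parabola_edges: "e \<in> edges (parabola_graph m) \<longleftrightarrow> (\<exists>i j. i < j \<and> j < m \<and> e = {parab i, parab j})"
proof
  assume "e \<in> edges (parabola_graph m)"
  then have e: "e \<subseteq> parab ` {..<m}" "card e = 2" unfolding parabola_graph_def by auto
  then obtain x y where xy: "e = {x, y}" "x \<noteq> y" by (meson card_2_iff)
  then obtain i j where ij: "x = parab i" "y = parab j" "i < m" "j < m" using e by auto
  then consider "i < j" | "j < i" using xy by fastforce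
  then show "\<exists>i j. i < j \<and> j < m \<and> e = {parab i, parab j}" using ij xy by cases (auto simp: insert_commute)
qed (auto simp: parabola_graph_def)

lemma parabola_curve:
  assumes "i < j"
  shows "curve (parabola_graph m) {parab i, parab j} = linepath (parab i) (parab j)"
proof -
  have "{k. parab k \<in> {parab i, parab j}} = {i, j}" by auto
  then show ?thesis using assms unfolding parabola_graph_def by (simp add: min_def max_def)
qed

lemma parabola_arc_segment:
  assumes "i < j"
  shows "edge_arc (parabola_graph m) {parab i, parab j} = closed_segment (parab i) (parab j)"
  unfolding edge_arc_def parabola_curve[OF assms] by simp

lemma parabola_chord:
  assumes "i < j"
  shows "closed_segment (parab i) (parab j) =
    {z. real i \<le> Re z \<and> Re z \<le> real j \<and> Im z = (real i + real j) * Re z + (- real i * real j)}"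
proof (intro set_eqI iffI)
  fix z assume "z \<in> closed_segment (parab i) (parab j)"
  then obtain u where u: "0 \<le> u" "u \<le> 1" "z = (1 - u) *\<^sub>R parab i + u *\<^sub>R parab j"
    unfolding closed_segment_def by auto
  then have re: "Re z = (1 - u) * real i + u * real j" and im: "Im z = (1 - u) * (real i)\<^sup>2 + u * (real j)\<^sup>2"
    unfolding parab_def by auto
  have "Re z = real i + u * (real j - real i)" "Re z = real j - (1 - u) * (real j - real i)"
    unfolding re by (auto simp: algebra_simps)
  moreover have "0 \<le> u * (real j - real i)" "0 \<le> (1 - u) * (real j - real i)"
    using u assms by (auto intro!: mult_nonneg_nonneg)
  ultimately have "real i \<le> Re z" "Re z \<le> real j" by linarith+
  moreover have "Im z = (real i + real j) * Re z + (- real i * real j)"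
    unfolding re im by (simp add: algebra_simps power2_eq_square)
  ultimately show "z \<in> {z. real i \<le> Re z \<and> Re z \<le> real j \<and> Im z = (real i + real j) * Re z + (- real i * real j)}" by simp
next
  fix z assume z: "z \<in> {z. real i \<le> Re z \<and> Re z \<le> real j \<and> Im z = (real i + real j) * Re z + (- real i * real j)}"
  define u where "u = (Re z - real i) / (real j - real i)"
  have d: "real j - real i > 0" using assms by simp
  have u: "0 \<le> u" "u \<le> 1" using z d unfolding u_def by (auto simp: field_simps)
  have ud: "u * (real j - real i) = Re z - real i" using d unfolding u_def by simp
  have "Re z = (1 - u) * real i + u * real j" using ud by (simp add: algebra_simps)
  moreover have "Im z = (1 - u) * (real i)\<^sup>2 + u * (real j)\<^sup>2"
  proof -
    have "(1 - u) * (real i)\<^sup>2 + u * (real j)\<^sup>2 = (real i)\<^sup>2 + u * (real j - real i) * (real j + real i)"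
      by (simp add: algebra_simps power2_eq_square)
    also have "\<dots> = Im z" unfolding ud using z by (simp add: algebra_simps power2_eq_square)
    finally show ?thesis by simp
  qed
  ultimately have "z = (1 - u) *\<^sub>R parab i + u *\<^sub>R parab j" unfolding parab_def by (simp add: complex_eq_iff)
  then show "z \<in> closed_segment (parab i) (parab j)" unfolding closed_segment_def using u by auto
qed

lemma parab_in_chord:
  assumes "i < j"
  shows "parab n \<in> closed_segment (parab i) (parab j) \<longleftrightarrow> n = i \<or> n = j"
proof
  assume "parab n \<in> closed_segment (parab i) (parab j)"
  then have "(real n)\<^sup>2 = (real i + real j) * real n + (- real i * real j)"
    unfolding parabola_chord[OF assms] by (simp add: parab_def)
  then have "(real n - real i) * (real n - real j) = 0" by (simp add: algebra_simps power2_eq_square)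
  then show "n = i \<or> n = j" by simp
qed auto

lemma chord_interior:
  assumes ij: "i < j"
  shows "z \<in> closed_segment (parab i) (parab j) - {parab i, parab j} \<longleftrightarrow>
    real i < Re z \<and> Re z < real j \<and> Im z = (real i + real j) * Re z + (- real i * real j)"
proof (cases "Im z = (real i + real j) * Re z + (- real i * real j)")
  case True
  have "z = parab i \<longleftrightarrow> Re z = real i" "z = parab j \<longleftrightarrow> Re z = real j"
    unfolding complex_eq_iff True parab_def by (auto simp: algebra_simps power2_eq_square)
  then show ?thesis using True unfolding parabola_chord[OF ij] by auto
next
  case False
  then show ?thesis unfolding parabola_chord[OF ij] by simp
qed

text \<open>Both pairs are the roots of the same monic quadratic.\<close>

lemma chords_same_slope:
  assumes "(i :: nat) < j" "k < l" "i + j = k + l" "i * j = k * l"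
  shows "i = k \<and> j = l"
proof -
  have "(int i - int k) * (int i - int l) = int i * int i - int i * int (k + l) + int (k * l)"
    by (simp add: algebra_simps)
  also have "\<dots> = 0" unfolding assms(3,4)[symmetric] by (simp add: algebra_simps)
  finally have "i = k \<or> i = l" by simp
  then show ?thesis using assms by auto
qed

text \<open>Meeting chords of equal slope lie on one line, so sum and product of their indices
  agree.\<close>

lemma chords_meet:
  assumes ij: "i < j" and kl: "k < l" and ne: "(i, j) \<noteq> (k, l)"
    and z: "z \<in> closed_segment (parab i) (parab j)" "z \<in> closed_segment (parab k) (parab l)"
  shows "real i + real j \<noteq> real k + real l"
proof
  assume eq: "real i + real j = real k + real l"
  then have "real i * real j = real k * real l"
    using z unfolding parabola_chord[OF ij] parabola_chord[OF kl] by auto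
  then have "i * j = k * l" "i + j = k + l" using eq by (metis of_nat_eq_iff of_nat_mult, metis of_nat_add of_nat_eq_iff)
  then show False using chords_same_slope[OF ij kl] ne by auto
qed

lemma chords_cross:
  assumes ij: "i < j" and kl: "k < l" and ne: "(i, j) \<noteq> (k, l)"
    and p: "p \<in> closed_segment (parab i) (parab j) - {parab i, parab j}"
      "p \<in> closed_segment (parab k) (parab l) - {parab k, parab l}"
  shows "properly_cross_at (closed_segment (parab i) (parab j)) (closed_segment (parab k) (parab l)) p"
proof -
  have "real i + real j \<noteq> real k + real l" by (rule chords_meet[OF ij kl ne]) (use p in auto)
  moreover have "p \<in> closed_segment (parab i) (parab j)" "p \<in> closed_segment (parab k) (parab l)"
    using p by blast+
  moreover have "real i < Re p" "Re p < real j" "real k < Re p" "Re p < real l"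
    using p(1)[unfolded chord_interior[OF ij]] p(2)[unfolded chord_interior[OF kl]] by simp_all
  ultimately show ?thesis
    by (intro properly_cross_at_lines[OF _ parabola_chord[OF ij] _ _ parabola_chord[OF kl]])
qed

lemma parabola_topological: "topological_graph (parabola_graph m)"
proof -
  let ?G = "parabola_graph m"
  have V: "verts ?G = parab ` {..<m}" unfolding parabola_graph_def by simp
  show ?thesis
    unfolding topological_graph_def
  proof (intro conjI ballI impI)
    show "finite (verts ?G)" unfolding V by simp
  next
    fix e assume "e \<in> edges ?G"
    then show "e \<subseteq> verts ?G" "card e = 2" unfolding parabola_graph_def by auto
  next
    fix e assume "e \<in> edges ?G"
    then obtain i j where e: "i < j" "j < m" "e = {parab i, parab j}" using parabola_edges by blast
    then show "arc (curve ?G e)" "{pathstart (curve ?G e), pathfinish (curve ?G e)} = e"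
      by (auto simp: parabola_curve)
    show "edge_arc ?G e \<inter> verts ?G = e"
      unfolding V using e parab_in_chord[OF e(1)] by (auto simp: parabola_arc_segment)
  next
    fix e e' p assume e: "e \<in> edges ?G" "e' \<in> edges ?G" "e \<noteq> e'" and p: "p \<in> edge_interior ?G e \<inter> edge_interior ?G e'"
    obtain i j where ij: "i < j" "j < m" "e = {parab i, parab j}" using e parabola_edges by blast
    obtain k l where kl: "k < l" "l < m" "e' = {parab k, parab l}" using e parabola_edges by blast
    show "properly_cross_at (edge_arc ?G e) (edge_arc ?G e') p"
      unfolding ij(3) kl(3) parabola_arc_segment[OF ij(1)] parabola_arc_segment[OF kl(1)]
      by (rule chords_cross[OF ij(1) kl(1)])
        (use p e(3) ij kl in \<open>auto simp: edge_interior_def parabola_arc_segment\<close>)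
  qed
qed

lemma parabola_simple: "simple_topological_graph (parabola_graph m)"
  unfolding simple_topological_graph_def
proof (intro conjI ballI impI)
  let ?G = "parabola_graph m"
  show top: "topological_graph ?G" by (rule parabola_topological)
  fix e e' assume e: "e \<in> edges ?G" "e' \<in> edges ?G" "e \<noteq> e'"
  obtain i j where ij: "i < j" "j < m" "e = {parab i, parab j}" using e parabola_edges by blast
  obtain k l where kl: "k < l" "l < m" "e' = {parab k, parab l}" using e parabola_edges by blast
  have A: "edge_arc ?G e = closed_segment (parab i) (parab j)" "edge_arc ?G e' = closed_segment (parab k) (parab l)"
    unfolding ij(3) kl(3) using ij kl parabola_arc_segment by auto
  have ne: "(i, j) \<noteq> (k, l)" using e(3) ij(3) kl(3) by auto
  show "edge_arc ?G e \<inter> edge_arc ?G e' = {} \<or>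
       (\<exists>p. edge_arc ?G e \<inter> edge_arc ?G e' = {p} \<and>
            (p \<in> e \<inter> e' \<or> properly_cross_at (edge_arc ?G e) (edge_arc ?G e') p))"
  proof (cases "edge_arc ?G e \<inter> edge_arc ?G e' = {}")
    case False
    then obtain p where p: "p \<in> edge_arc ?G e" "p \<in> edge_arc ?G e'" by blast
    have sl: "real i + real j \<noteq> real k + real l"
      by (rule chords_meet[OF ij(1) kl(1) ne]) (use p A in auto)
    have "q = p" if "q \<in> edge_arc ?G e" "q \<in> edge_arc ?G e'" for q
    proof -
      have P: "Im p = (real i + real j) * Re p + (- real i * real j)" "Im p = (real k + real l) * Re p + (- real k * real l)"
        using p unfolding A parabola_chord[OF ij(1)] parabola_chord[OF kl(1)] by auto
      have Q: "Im q = (real i + real j) * Re q + (- real i * real j)" "Im q = (real k + real l) * Re q + (- real k * real l)"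
        using that unfolding A parabola_chord[OF ij(1)] parabola_chord[OF kl(1)] by auto
      have d: "Im q - Im p = (real i + real j) * (Re q - Re p)" using P(1) Q(1) by (simp add: algebra_simps)
      moreover have "Im q - Im p = (real k + real l) * (Re q - Re p)" using P(2) Q(2) by (simp add: algebra_simps)
      ultimately have "(real i + real j - (real k + real l)) * (Re q - Re p) = 0" by (auto simp: left_diff_distrib)
      moreover note d
      ultimately have "Re q = Re p" "Im q - Im p = (real i + real j) * (Re q - Re p)" using sl by auto
      then show ?thesis by (simp add: complex_eq_iff)
    qed
    then have single: "edge_arc ?G e \<inter> edge_arc ?G e' = {p}" using p by blast
    have vert: "x \<in> verts ?G" if "x \<in> e \<or> x \<in> e'" for x
      using that ij kl unfolding parabola_graph_def by auto
    have inter: "edge_arc ?G e \<inter> verts ?G = e" "edge_arc ?G e' \<inter> verts ?G = e'"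
      using top e unfolding topological_graph_def by auto
    have "p \<in> e \<inter> e' \<or> properly_cross_at (edge_arc ?G e) (edge_arc ?G e') p"
    proof (cases "p \<in> e \<or> p \<in> e'")
      case True
      then show ?thesis using p inter vert by blast
    next
      case False
      then have "p \<in> edge_interior ?G e \<inter> edge_interior ?G e'" using p unfolding edge_interior_def by blast
      then show ?thesis using top e unfolding topological_graph_def by blast
    qed
    then show ?thesis using single by blast
  qed simp
qed

text \<open>At abscissa \<open>x\<close> the chord of \<open>i\<close> and \<open>j\<close> is
  \<open>(x - i) * (j - x)\<close> above the parabola. For nested chords, also with one common end,
  the outer one is strictly higher over the open inner interval, so only interleaving chords can
  cross.\<close>

lemma parabola_cross:
  assumes ij: "i < j" and kl: "k < l"
  shows "cross (parabola_graph m) {parab i, parab j} {parab k, parab l} \<longleftrightarrow>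
    (i < k \<and> k < j \<and> j < l) \<or> (k < i \<and> i < l \<and> l < j)"
proof -
  have alt: "\<exists>z. z \<in> closed_segment (parab i) (parab j) - {parab i, parab j} \<and>
      z \<in> closed_segment (parab k) (parab l) - {parab k, parab l}"
    if o: "i < k" "k < j" "j < l" for i j k l
  proof -
    \<comment> \<open>\<open>x\<close> solves the equality of the two chord equations;
      \<open>d\<close> is the difference of their slopes.\<close>
    define d x where "d = real k + real l - real i - real j" and "x = (real k * real l - real i * real j) / d"
    have d: "d > 0" using o unfolding d_def by simp
    have xd: "x * d = real k * real l - real i * real j" using d unfolding x_def by simp
    have "(x - real k) * d = (real k - real i) * (real j - real k)"
      using xd unfolding d_def by (simp add: algebra_simps)
    also have "\<dots> > 0" using o by simp
    finally have xk: "real k < x" using d by (simp add: zero_less_mult_iff)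
    have "(real j - x) * d = (real j - real k) * (real l - real j)"
      using xd unfolding d_def by (simp add: algebra_simps)
    also have "\<dots> > 0" using o by simp
    finally have xj: "x < real j" using d by (simp add: zero_less_mult_iff)
    have "(real i + real j) * x + (- real i * real j) = (real k + real l) * x + (- real k * real l)"
      using xd unfolding d_def by (simp add: algebra_simps)
    then show ?thesis
      using xk xj o chord_interior[of i j] chord_interior[of k l]
      by (intro exI[of _ "Complex x ((real i + real j) * x + (- real i * real j))"]) auto
  qed
  have nest: False if o: "i \<le> k" "l \<le> j" "(i, j) \<noteq> (k, l)" "real k < x" "x < real l"
    and eq: "(real i + real j) * x + (- real i * real j) = (real k + real l) * x + (- real k * real l)"
    for i j k l x
  proof -
    have eq': "(x - real i) * (real j - x) = (x - real k) * (real l - x)"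
      using eq by (simp add: algebra_simps)
    have pos: "0 < x - real k" "0 < real l - x" "x - real k \<le> x - real i" "real l - x \<le> real j - x"
      using o by auto
    have "x - real k < x - real i \<or> real l - x < real j - x" using o by auto
    then have "(x - real k) * (real l - x) < (x - real i) * (real j - x)"
    proof
      assume "x - real k < x - real i"
      then show ?thesis using pos by (intro mult_less_le_imp_less) auto
    next
      assume "real l - x < real j - x"
      then show ?thesis using pos by (intro mult_le_less_imp_less) auto
    qed
    then show False using eq' by simp
  qed
  show ?thesis
  proof
    assume cr: "cross (parabola_graph m) {parab i, parab j} {parab k, parab l}"
    then obtain z where z: "z \<in> closed_segment (parab i) (parab j) - {parab i, parab j}"
      "z \<in> closed_segment (parab k) (parab l) - {parab k, parab l}"
      unfolding cross_def edge_interior_def parabola_arc_segment[OF ij] parabola_arc_segment[OF kl] by blast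
    have ne: "(i, j) \<noteq> (k, l)" using cr not_properly_cross_at_self unfolding cross_def by auto
    have zi: "real i < Re z" "Re z < real j" "Im z = (real i + real j) * Re z + (- real i * real j)"
      using z(1) unfolding chord_interior[OF ij] by auto
    have zk: "real k < Re z" "Re z < real l" "Im z = (real k + real l) * Re z + (- real k * real l)"
      using z(2) unfolding chord_interior[OF kl] by auto
    have "\<not> (i \<le> k \<and> l \<le> j)" using nest[of i k l j "Re z"] ne zi zk by auto
    moreover have "\<not> (k \<le> i \<and> j \<le> l)" using nest[of k i j l "Re z"] ne zi zk by auto
    moreover have "real k < real j" "real i < real l" using zi zk by linarith+
    ultimately show "(i < k \<and> k < j \<and> j < l) \<or> (k < i \<and> i < l \<and> l < j)" by auto
  next
    assume "(i < k \<and> k < j \<and> j < l) \<or> (k < i \<and> i < l \<and> l < j)"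
    then obtain z where z: "z \<in> closed_segment (parab i) (parab j) - {parab i, parab j}"
      "z \<in> closed_segment (parab k) (parab l) - {parab k, parab l}" and ne: "(i, j) \<noteq> (k, l)"
      using alt[of i k j l] alt[of k i l j] by auto
    show "cross (parabola_graph m) {parab i, parab j} {parab k, parab l}"
      unfolding cross_def edge_interior_def parabola_arc_segment[OF ij] parabola_arc_segment[OF kl]
      using z chords_cross[OF ij kl ne z] by blast
  qed
qed

lemma parabola_convex: "complete_convex_geometric m (parabola_graph m)"
  unfolding complete_convex_geometric_def
proof (intro conjI allI impI)
  let ?G = "parabola_graph m"
  show "topological_graph ?G" by (rule parabola_topological)
  show "complete_graph ?G" unfolding complete_graph_def parabola_graph_def by simp
  show "card (verts ?G) = m" unfolding parabola_graph_def by (simp add: card_image inj_on_def)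
  show "convex_position (verts ?G)"
    unfolding convex_position_def
  proof
    fix v assume "v \<in> verts ?G"
    then obtain n where n: "v = parab n" unfolding parabola_graph_def by auto
    \<comment> \<open>The open half plane above the tangent at \<open>parab n\<close>; the other
      vertices exceed the tangent by \<open>(k - n)^2\<close>.\<close>
    let ?H = "{z. inner (Complex (- 2 * real n) 1) z > - (real n)\<^sup>2}"
    have "verts ?G - {v} \<subseteq> ?H"
    proof
      fix z assume "z \<in> verts ?G - {v}"
      then obtain k where k: "z = parab k" "k \<noteq> n" using n unfolding parabola_graph_def by auto
      have "(real k - real n)\<^sup>2 > 0" using k by simp
      then show "z \<in> ?H" unfolding k parab_def by (simp add: inner_complex_def power2_eq_square algebra_simps)
    qed
    then have "convex hull (verts ?G - {v}) \<subseteq> ?H" by (rule hull_minimal) (rule convex_halfspace_gt)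
    moreover have "v \<notin> ?H" unfolding n parab_def by (simp add: inner_complex_def power2_eq_square)
    ultimately show "v \<notin> convex hull (verts ?G - {v})" by blast
  qed
  fix u v assume "{u, v} \<in> edges ?G"
  then obtain i j where ij: "i < j" "{u, v} = {parab i, parab j}" using parabola_edges by metis
  then have "u = parab i \<and> v = parab j \<or> u = parab j \<and> v = parab i" by (auto simp: doubleton_eq_iff)
  then show "edge_arc ?G {u, v} = closed_segment u v"
    using parabola_arc_segment[OF ij(1)] ij(2) by (auto simp: closed_segment_commute)
qed

section \<open>The unavoidable patterns\<close>

context simple_drawing
begin

text \<open>The known crossing in each 4-subset excludes the other two pairings by
  \<open>K4_single_crossing\<close>; six relative orders of the indices remain.\<close>

lemma alternating_crossing:
  fixes w :: "nat \<Rightarrow> complex"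
  assumes w: "inj_on w {..<m}" "w ` {..<m} \<subseteq> V"
    and alt: "\<And>a b c d. a < b \<Longrightarrow> b < c \<Longrightarrow> c < d \<Longrightarrow> d < m \<Longrightarrow> X (w a) (w c) (w b) (w d)"
    and o: "i < j" "j < m" "k < l" "l < m"
  shows "distinct [w i, w j, w k, w l] \<and> X (w i) (w j) (w k) (w l) \<longleftrightarrow>
    (i < k \<and> k < j \<and> j < l) \<or> (k < i \<and> i < l \<and> l < j)"
proof (cases "distinct [i, j, k, l]")
  case False
  then have "i = k \<or> i = l \<or> j = k \<or> j = l" using o(1,3) by auto
  then show ?thesis using o by auto
next
  case True
  have dist: "distinct [w i, w j, w k, w l]"
    using True o inj_on_eq_iff[OF w(1)] by auto
  have no: "\<not> X (w a) (w b) (w c) (w d)" "\<not> X (w a) (w d) (w b) (w c)" if "a < b" "b < c" "c < d" "d < m" for a b c d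
  proof -
    have V: "{w a, w b, w c, w d} \<subseteq> V" using w(2) that by auto
    have D: "distinct [w a, w b, w c, w d]" using that inj_on_eq_iff[OF w(1)] by auto
    have x: "X (w a) (w c) (w b) (w d)" by (rule alt[OF that])
    have "\<not> X (w c) (w d) (w a) (w b)" by (rule K4_single_crossing) (use V D x in auto)
    then show "\<not> X (w a) (w b) (w c) (w d)" using X_swap by blast
    have "\<not> X (w c) (w b) (w a) (w d)" by (rule K4_single_crossing) (use V D x X_flip in auto)
    then show "\<not> X (w a) (w d) (w b) (w c)" using X_swap X_flip(1)[of "w c" "w b"] by blast
  qed
  consider "i < j" "j < k" "k < l" | "i < k" "k < j" "j < l" | "i < k" "k < l" "l < j"
    | "k < l" "l < i" "i < j" | "k < i" "i < l" "l < j" | "k < i" "i < j" "j < l"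
    using True o by fastforce
  then show ?thesis
  proof cases
    case 1 then show ?thesis using no(1)[of i j k l] o by auto
  next
    case 2 then show ?thesis using alt[of i k j l] o dist by auto
  next
    case 3 then show ?thesis using no(2)[of i k l j] o by auto
  next
    case 4 then show ?thesis using no(1)[of k l i j] o X_swap[of "w i" "w j" "w k" "w l"] by auto
  next
    case 5 then show ?thesis using alt[of k i l j] o dist X_swap[of "w i" "w j" "w k" "w l"] by auto
  next
    case 6 then show ?thesis using no(2)[of k i j l] o X_swap[of "w i" "w j" "w k" "w l"] by auto
  qed
qed

lemma nested_crossing:
  fixes w :: "nat \<Rightarrow> complex"
  assumes w: "inj_on w {..<m}" "w ` {..<m} \<subseteq> V"
    and nest: "\<And>a b c d. a < b \<Longrightarrow> b < c \<Longrightarrow> c < d \<Longrightarrow> d < m \<Longrightarrow> X (w a) (w d) (w b) (w c)"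
    and o: "i < j" "j < m" "k < l" "l < m"
  shows "distinct [w i, w j, w k, w l] \<and> X (w i) (w j) (w k) (w l) \<longleftrightarrow>
    (i < k \<and> k < l \<and> l < j) \<or> (k < i \<and> i < j \<and> j < l)"
proof (cases "distinct [i, j, k, l]")
  case False
  then have "i = k \<or> i = l \<or> j = k \<or> j = l" using o(1,3) by auto
  then show ?thesis using o by auto
next
  case True
  have dist: "distinct [w i, w j, w k, w l]"
    using True o inj_on_eq_iff[OF w(1)] by auto
  have no: "\<not> X (w a) (w b) (w c) (w d)" "\<not> X (w a) (w c) (w b) (w d)" if "a < b" "b < c" "c < d" "d < m" for a b c d
  proof -
    have V: "{w a, w b, w c, w d} \<subseteq> V" using w(2) that by auto
    have D: "distinct [w a, w b, w c, w d]" using that inj_on_eq_iff[OF w(1)] by auto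
    have x: "X (w a) (w d) (w b) (w c)" by (rule nest[OF that])
    have "\<not> X (w d) (w c) (w a) (w b)" by (rule K4_single_crossing) (use V D x in auto)
    then show "\<not> X (w a) (w b) (w c) (w d)" using X_swap X_flip(1)[of "w d" "w c"] by blast
    have "\<not> X (w d) (w b) (w a) (w c)" by (rule K4_single_crossing) (use V D x X_flip in auto)
    then show "\<not> X (w a) (w c) (w b) (w d)" using X_swap X_flip(1)[of "w d" "w b"] by blast
  qed
  consider "i < j" "j < k" "k < l" | "i < k" "k < j" "j < l" | "i < k" "k < l" "l < j"
    | "k < l" "l < i" "i < j" | "k < i" "i < l" "l < j" | "k < i" "i < j" "j < l"
    using True o by fastforce
  then show ?thesis
  proof cases
    case 1 then show ?thesis using no(1)[of i j k l] o by auto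
  next
    case 2 then show ?thesis using no(2)[of i k j l] o by auto
  next
    case 3 then show ?thesis using nest[of i k l j] o dist by auto
  next
    case 4 then show ?thesis using no(1)[of k l i j] o X_swap[of "w i" "w j" "w k" "w l"] by auto
  next
    case 5 then show ?thesis using no(2)[of k i l j] o X_swap[of "w i" "w j" "w k" "w l"] by auto
  next
    case 6 then show ?thesis using nest[of k i j l] o dist X_swap[of "w i" "w j" "w k" "w l"] by auto
  qed
qed

end

section \<open>Transfer between topological graphs and drawings\<close>

lemma topological_graphD:
  assumes "topological_graph G"
  shows "finite (verts G)" "e \<in> edges G \<Longrightarrow> edge_arc G e \<inter> verts G = e"
    "e \<in> edges G \<Longrightarrow> arc (curve G e)" "e \<in> edges G \<Longrightarrow> {pathstart (curve G e), pathfinish (curve G e)} = e"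
    "e \<in> edges G \<Longrightarrow> e' \<in> edges G \<Longrightarrow> e \<noteq> e' \<Longrightarrow> p \<in> edge_interior G e \<inter> edge_interior G e' \<Longrightarrow>
      properly_cross_at (edge_arc G e) (edge_arc G e') p"
proof -
  note t = assms[unfolded topological_graph_def]
  have f: "finite (verts G)" using t by (elim conjE)
  have v: "\<forall>e\<in>edges G. edge_arc G e \<inter> verts G = e" using t by (elim conjE)
  have a: "\<forall>e\<in>edges G. arc (curve G e) \<and> {pathstart (curve G e), pathfinish (curve G e)} = e"
    using t by (elim conjE)
  have c: "\<forall>e\<in>edges G. \<forall>e'\<in>edges G. e \<noteq> e' \<longrightarrow>
      (\<forall>p \<in> edge_interior G e \<inter> edge_interior G e'. properly_cross_at (edge_arc G e) (edge_arc G e') p)"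
    using t by (elim conjE)
  show "finite (verts G)" by (rule f)
  show "e \<in> edges G \<Longrightarrow> edge_arc G e \<inter> verts G = e" using v by (rule bspec)
  show "e \<in> edges G \<Longrightarrow> arc (curve G e)"
    "e \<in> edges G \<Longrightarrow> {pathstart (curve G e), pathfinish (curve G e)} = e"
    by (rule conjunct1[OF bspec[OF a]], assumption) (rule conjunct2[OF bspec[OF a]])
  show "e \<in> edges G \<Longrightarrow> e' \<in> edges G \<Longrightarrow> e \<noteq> e' \<Longrightarrow> p \<in> edge_interior G e \<inter> edge_interior G e' \<Longrightarrow>
      properly_cross_at (edge_arc G e) (edge_arc G e') p"
    using c[rule_format] .
qed

lemma simple_drawing_of_graph:
  assumes G: "simple_topological_graph G" "complete_graph G"
  shows "simple_drawing (verts G) (\<lambda>u v. edge_arc G {u, v})"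
proof
  have top: "topological_graph G" using G(1) unfolding simple_topological_graph_def by simp
  have edge: "{u, v} \<in> edges G" if "u \<in> verts G" "v \<in> verts G" "u \<noteq> v" for u v
    using G(2) that unfolding complete_graph_def by auto
  have vert: "edge_arc G e \<inter> verts G = e" if "e \<in> edges G" for e
    using topological_graphD(2)[OF top that] .
  have meet: "edge_arc G e \<inter> edge_arc G e' = {} \<or>
       (\<exists>p. edge_arc G e \<inter> edge_arc G e' = {p} \<and>
            (p \<in> e \<inter> e' \<or> properly_cross_at (edge_arc G e) (edge_arc G e') p))"
    if "e \<in> edges G" "e' \<in> edges G" "e \<noteq> e'" for e e'
    using G(1) that unfolding simple_topological_graph_def by blast
  show "edge_arc G {u, v} = edge_arc G {v, u}" for u v by (simp add: insert_commute)
  show "arc_between (edge_arc G {u, v}) u v" if uv: "u \<in> verts G" "v \<in> verts G" "u \<noteq> v" for u v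
  proof -
    let ?g = "curve G {u, v}"
    have g: "arc ?g" "pathstart ?g = u \<and> pathfinish ?g = v \<or> pathstart ?g = v \<and> pathfinish ?g = u"
      using topological_graphD(3,4)[OF top edge[OF uv]] by (simp_all only: doubleton_eq_iff)
    then have "arc_between (edge_arc G {u, v}) (pathstart ?g) (pathfinish ?g)"
      unfolding arc_between_def edge_arc_def by blast
    then show ?thesis using g(2) arc_between_commute[of "edge_arc G {u, v}" u v] by auto
  qed
  show "w \<notin> edge_arc G {u, v}" if "{u, v, w} \<subseteq> verts G" "distinct [u, v, w]" for u v w
    using vert[OF edge[of u v]] that by auto
  show "edge_arc G {u, v} \<inter> edge_arc G {u, w} = {u}" if uvw: "{u, v, w} \<subseteq> verts G" "distinct [u, v, w]" for u v w
  proof -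
    have e: "{u, v} \<in> edges G" "{u, w} \<in> edges G" using edge uvw by auto
    have u: "u \<in> edge_arc G {u, v} \<inter> edge_arc G {u, w}" using vert[OF e(1)] vert[OF e(2)] by auto
    have "{u, v} \<noteq> {u, w}" using uvw by (auto simp: doubleton_eq_iff)
    from meet[OF e this] u obtain p where "edge_arc G {u, v} \<inter> edge_arc G {u, w} = {p}" by (metis empty_iff)
    then show ?thesis using u by simp
  qed
  show "edge_arc G {u, v} \<inter> edge_arc G {w, x} = {} \<or>
      (\<exists>p. edge_arc G {u, v} \<inter> edge_arc G {w, x} = {p} \<and> properly_cross_at (edge_arc G {u, v}) (edge_arc G {w, x}) p)"
    if uvwx: "{u, v, w, x} \<subseteq> verts G" "distinct [u, v, w, x]" for u v w x
  proof -
    have e: "{u, v} \<in> edges G" "{w, x} \<in> edges G" using edge uvwx by auto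
    have d: "{u, v} \<inter> {w, x} = {}" "{u, v} \<noteq> {w, x}" using uvwx by auto
    from meet[OF e d(2)] show ?thesis unfolding d(1) by blast
  qed
qed

text \<open>Distinct edges with a common vertex meet only there, outside their interiors, and an
  edge does not properly cross itself. Disjoint edges avoid each other's ends, so their common point
  is interior to both.\<close>

lemma cross_iff:
  assumes G: "simple_topological_graph G" "complete_graph G"
    and V: "{u, v, w, x} \<subseteq> verts G" "u \<noteq> v" "w \<noteq> x"
  shows "cross G {u, v} {w, x} \<longleftrightarrow> distinct [u, v, w, x] \<and> edge_arc G {u, v} \<inter> edge_arc G {w, x} \<noteq> {}"
proof -
  interpret simple_drawing "verts G" "\<lambda>u v. edge_arc G {u, v}" by (rule simple_drawing_of_graph[OF G])
  show ?thesis
  proof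
    assume cr: "cross G {u, v} {w, x}"
    then obtain p where p: "p \<in> edge_arc G {u, v}" "p \<in> edge_arc G {w, x}" "p \<notin> {u, v}" "p \<notin> {w, x}"
      unfolding cross_def edge_interior_def by blast
    have "{u, v} \<noteq> {w, x}" using cr not_properly_cross_at_self unfolding cross_def by metis
    moreover have share: False if "a = c" "a \<noteq> b" "c \<noteq> d" "b \<noteq> d" "{a, b, d} \<subseteq> verts G"
        "p \<in> edge_arc G {a, b}" "p \<in> edge_arc G {c, d}" "p \<noteq> a" for a b c d
      using Int_singletonD[OF adj(1)[of a b d]] that by auto
    ultimately have "distinct [u, v, w, x]"
      using share[of u w v x] share[of u x v w] share[of v w u x] share[of v x u w] p V
      by (auto simp: insert_commute)
    then show "distinct [u, v, w, x] \<and> edge_arc G {u, v} \<inter> edge_arc G {w, x} \<noteq> {}" using p by blast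
  next
    assume r: "distinct [u, v, w, x] \<and> edge_arc G {u, v} \<inter> edge_arc G {w, x} \<noteq> {}"
    then obtain p where p: "p \<in> edge_arc G {u, v}" "p \<in> edge_arc G {w, x}" by blast
    have "u \<notin> edge_arc G {w, x}" "v \<notin> edge_arc G {w, x}" "w \<notin> edge_arc G {u, v}" "x \<notin> edge_arc G {u, v}"
      by (rule E_vertex; use r V in auto)+
    then have "p \<in> edge_interior G {u, v} \<inter> edge_interior G {w, x}" using p unfolding edge_interior_def by auto
    moreover have "properly_cross_at (edge_arc G {u, v}) (edge_arc G {w, x}) p"
      by (rule crossing_single(2)) (use p r V in auto)
    ultimately show "cross G {u, v} {w, x}" unfolding cross_def by blast
  qed
qed

text \<open>The whole function \<open>curve\<close> is kept, so arcs and crossings are literally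
  those of \<open>G\<close>.\<close>

definition induced_subgraph :: "topgraph \<Rightarrow> complex set \<Rightarrow> topgraph" where
  "induced_subgraph G W = \<lparr>verts = W, edges = {e. e \<subseteq> W \<and> card e = 2}, curve = curve G\<rparr>"

lemma induced_subgraph_simps [simp]:
  "verts (induced_subgraph G W) = W" "edges (induced_subgraph G W) = {e. e \<subseteq> W \<and> card e = 2}"
  "curve (induced_subgraph G W) = curve G" "edge_arc (induced_subgraph G W) = edge_arc G"
  "edge_interior (induced_subgraph G W) = edge_interior G" "cross (induced_subgraph G W) = cross G"
  unfolding induced_subgraph_def edge_arc_def edge_interior_def cross_def by (auto simp: fun_eq_iff)

lemma induced_subgraph:
  assumes G: "simple_topological_graph G" "complete_graph G" and W: "W \<subseteq> verts G"
  shows "simple_topological_graph (induced_subgraph G W)" "complete_graph (induced_subgraph G W)"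
    "topological_subgraph (induced_subgraph G W) G"
proof -
  let ?H = "induced_subgraph G W"
  have sub: "e \<in> edges G" if "e \<subseteq> W" "card e = 2" for e
    using G(2) that W unfolding complete_graph_def by auto
  have top: "topological_graph G" using G(1) unfolding simple_topological_graph_def by simp
  have topH: "topological_graph ?H"
    unfolding topological_graph_def induced_subgraph_simps
  proof (intro conjI ballI impI)
    show "finite W" using topological_graphD(1)[OF top] W finite_subset by blast
  next
    fix e assume "e \<in> {e. e \<subseteq> W \<and> card e = 2}"
    then have e: "e \<subseteq> W" "card e = 2" by simp_all
    then show "e \<subseteq> W" "card e = 2" by simp_all
    show "arc (curve G e)" "{pathstart (curve G e), pathfinish (curve G e)} = e"
      using topological_graphD(3,4)[OF top sub[OF e]] .
    show "edge_arc G e \<inter> W = e" using topological_graphD(2)[OF top sub[OF e]] e(1) W by blast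
  next
    fix e e' p assume "e \<in> {e. e \<subseteq> W \<and> card e = 2}" "e' \<in> {e. e \<subseteq> W \<and> card e = 2}" "e \<noteq> e'"
      "p \<in> edge_interior G e \<inter> edge_interior G e'"
    then show "properly_cross_at (edge_arc G e) (edge_arc G e') p"
      using topological_graphD(5)[OF top sub sub] by blast
  qed
  then show "simple_topological_graph ?H"
    using G(1) sub unfolding simple_topological_graph_def by simp
  show "complete_graph ?H" unfolding complete_graph_def by simp
  show "topological_subgraph ?H G" unfolding topological_subgraph_def using topH W sub by auto
qed

lemma weakly_isomorphic_refl:
  assumes "simple_topological_graph G" shows "weakly_isomorphic G G"
  unfolding weakly_isomorphic_def using assms by (intro conjI exI[of _ id]) auto

lemma weakly_isomorphic_parabola:
  assumes H: "simple_topological_graph H" "complete_graph H"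
    and w: "bij_betw w {..<m} (verts H)"
    and cr: "\<And>i j k l. i < j \<Longrightarrow> j < m \<Longrightarrow> k < l \<Longrightarrow> l < m \<Longrightarrow>
      cross H {w i, w j} {w k, w l} \<longleftrightarrow> (i < k \<and> k < j \<and> j < l) \<or> (k < i \<and> i < l \<and> l < j)"
  shows "weakly_isomorphic H (parabola_graph m)"
proof -
  let ?C = "parabola_graph m"
  define f where "f = parab \<circ> the_inv_into {..<m} w"
  have fw: "f (w i) = parab i" if "i < m" for i
    unfolding f_def using that w by (simp add: the_inv_into_f_f bij_betw_def)
  have VC: "verts ?C = parab ` {..<m}" unfolding parabola_graph_def by simp
  have bijf: "bij_betw f (verts H) (verts ?C)"
    unfolding f_def VC
    by (rule bij_betw_trans[OF bij_betw_the_inv_into[OF w]]) (simp add: bij_betw_def inj_on_def)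
  have EH: "edges H = {e. e \<subseteq> verts H \<and> card e = 2}" using H(2) unfolding complete_graph_def .
  have EC: "edges ?C = {e. e \<subseteq> verts ?C \<and> card e = 2}" unfolding parabola_graph_def by simp
  have inj: "inj_on f (verts H)" using bijf by (simp add: bij_betw_def)
  have bijg: "bij_betw ((`) f) (edges H) (edges ?C)"
    unfolding bij_betw_def
  proof
    show "inj_on ((`) f) (edges H)"
      by (rule inj_on_subset[OF inj_on_image_Pow[OF inj]]) (auto simp: EH)
    show "(`) f ` edges H = edges ?C"
    proof (intro set_eqI iffI)
      fix e assume "e \<in> (`) f ` edges H"
      then obtain e' where e': "e' \<subseteq> verts H" "card e' = 2" "e = f ` e'" unfolding EH by auto
      then have "card e = 2" using card_image[OF inj_on_subset[OF inj e'(1)]] by simp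
      then show "e \<in> edges ?C" unfolding EC using e' bijf by (auto simp: bij_betw_def)
    next
      fix e assume "e \<in> edges ?C"
      then have e: "e \<subseteq> f ` verts H" "card e = 2" unfolding EC using bijf by (auto simp: bij_betw_def)
      then obtain e' where e': "e' \<subseteq> verts H" "e = f ` e'" by (meson subset_imageE)
      then have "card e' = 2" using e(2) card_image[OF inj_on_subset[OF inj e'(1)]] by simp
      then show "e \<in> (`) f ` edges H" unfolding EH using e' by blast
    qed
  qed
  have pair: "\<exists>i j. i < j \<and> j < m \<and> e = {w i, w j}" if "e \<in> edges H" for e
  proof -
    have "card e = 2" using that EH by blast
    then obtain x y where xy: "e = {x, y}" "x \<noteq> y" by (meson card_2_iff)
    moreover have "e \<subseteq> w ` {..<m}" using that w unfolding EH by (auto simp: bij_betw_def)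
    ultimately obtain i j where ij: "x = w i" "y = w j" "i < m" "j < m" by auto
    then consider "i < j" | "j < i" using xy(2) by fastforce
    then show ?thesis using xy ij by cases (auto simp: insert_commute)
  qed
  have "cross H e e' \<longleftrightarrow> cross ?C (f ` e) (f ` e')" if e: "e \<in> edges H" "e' \<in> edges H" for e e'
  proof -
    obtain i j where ij: "i < j" "j < m" "e = {w i, w j}" using pair[OF e(1)] by blast
    obtain k l where kl: "k < l" "l < m" "e' = {w k, w l}" using pair[OF e(2)] by blast
    have "f ` e = {parab i, parab j}" "f ` e' = {parab k, parab l}" using ij kl fw by auto
    then show ?thesis using cr[OF ij(1,2) kl(1,2)] parabola_cross[OF ij(1) kl(1), of m] ij(3) kl(3) by simp
  qed
  moreover have "v \<in> e \<longleftrightarrow> f v \<in> f ` e" if "v \<in> verts H" "e \<in> edges H" for v e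
    using that inj_on_image_mem_iff[OF inj, of v e] unfolding EH by auto
  ultimately show ?thesis
    unfolding weakly_isomorphic_def using H(1) parabola_simple bijf bijg by blast
qed

definition has_pattern :: "topgraph \<Rightarrow> nat \<Rightarrow> bool" where
  "has_pattern G m \<longleftrightarrow> (\<exists>H. topological_subgraph H G \<and> card (verts H) = m \<and>
         ((\<exists>C. complete_convex_geometric m C \<and> weakly_isomorphic H C) \<or>
          (\<exists>T. complete_twisted m T \<and> weakly_isomorphic H T)))"

text \<open>The twisted graph is specified by crossings alone, so the induced subgraph is its own
  model. The convex graph has straight edges, and there the parabola graph is needed as a second
  graph.\<close>

lemma twisted_has_pattern:
  assumes G: "simple_topological_graph G" "complete_graph G"
    and w: "inj_on w {..<m}" "w ` {..<m} \<subseteq> verts G"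
    and cr: "\<And>i j k l. i < j \<Longrightarrow> j < m \<Longrightarrow> k < l \<Longrightarrow> l < m \<Longrightarrow>
      cross G {w i, w j} {w k, w l} \<longleftrightarrow> (i < k \<and> k < l \<and> l < j) \<or> (k < i \<and> i < j \<and> j < l)"
  shows "has_pattern G m"
proof -
  let ?H = "induced_subgraph G (w ` {..<m})"
  note H = induced_subgraph[OF G w(2)]
  have card: "card (verts ?H) = m" using w(1) by (simp add: card_image)
  have "complete_twisted m ?H"
    unfolding complete_twisted_def
  \<comment> \<open>Indices are shifted by one: \<open>w\<close> starts at 0, the order in
    \<open>complete_twisted\<close> at 1.\<close>
  proof (intro conjI H card exI[of _ "\<lambda>i. w (i - 1)"] ballI impI)
    have "bij_betw (\<lambda>i. i - 1) {1..m} {..<m}"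
      by (rule bij_betw_byWitness[of _ Suc]) auto
    then have "bij_betw (w \<circ> (\<lambda>i. i - 1)) {1..m} (w ` {..<m})"
      by (rule bij_betw_trans) (use w in \<open>simp add: bij_betw_def\<close>)
    then show "bij_betw (\<lambda>i. w (i - 1)) {1..m} (verts ?H)" by (simp add: comp_def)
    fix i j k l assume "i \<in> {1..m}" "j \<in> {1..m}" "k \<in> {1..m}" "l \<in> {1..m}" "i < j" "k < l"
    then show "cross ?H {w (i - 1), w (j - 1)} {w (k - 1), w (l - 1)} \<longleftrightarrow>
        (i < k \<and> k < l \<and> l < j) \<or> (k < i \<and> i < j \<and> j < l)"
      using cr[of "i - 1" "j - 1" "k - 1" "l - 1"] by auto
  qed
  then show ?thesis unfolding has_pattern_def using H card weakly_isomorphic_refl by blast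
qed

lemma convex_has_pattern:
  assumes G: "simple_topological_graph G" "complete_graph G"
    and w: "inj_on w {..<m}" "w ` {..<m} \<subseteq> verts G"
    and cr: "\<And>i j k l. i < j \<Longrightarrow> j < m \<Longrightarrow> k < l \<Longrightarrow> l < m \<Longrightarrow>
      cross G {w i, w j} {w k, w l} \<longleftrightarrow> (i < k \<and> k < j \<and> j < l) \<or> (k < i \<and> i < l \<and> l < j)"
  shows "has_pattern G m"
proof -
  let ?H = "induced_subgraph G (w ` {..<m})"
  note H = induced_subgraph[OF G w(2)]
  have "weakly_isomorphic ?H (parabola_graph m)"
    by (rule weakly_isomorphic_parabola[OF H(1,2), of w]) (use w cr in \<open>auto simp: bij_betw_def\<close>)
  moreover have "card (verts ?H) = m" using w(1) by (simp add: card_image)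
  ultimately show ?thesis unfolding has_pattern_def using H parabola_convex by blast
qed

section \<open>The quantitative bound and the exponent\<close>

text \<open>Outer factor and summand come from \<open>rotation_order\<close>; the power is the bound
  of \<open>uniform_path_exists\<close> for \<open>q = 3\<close> and
  \<open>T = m ^ 4 + 1\<close>.\<close>

definition ramsey_threshold :: "nat \<Rightarrow> nat" where
  "ramsey_threshold m = 2 * ((m ^ 4 + 2) ^ 3 + 1) ^ (m ^ 4 + 1) + 3"

lemma large_graph_has_pattern:
  assumes G: "simple_topological_graph G" "complete_graph G"
    and m: "m \<ge> 1" and big: "card (verts G) \<ge> ramsey_threshold m"
  shows "has_pattern G m"
proof -
  interpret simple_drawing "verts G" "\<lambda>u v. edge_arc G {u, v}" by (rule simple_drawing_of_graph[OF G])
  have fin: "finite (verts G)" using G(1) topological_graphD(1) unfolding simple_topological_graph_def by blast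
  obtain w where w: "inj_on w {..<m}" "w ` {..<m} \<subseteq> verts G"
    and pat: "(\<forall>i j k l. i < j \<longrightarrow> j < k \<longrightarrow> k < l \<longrightarrow> l < m \<longrightarrow> X (w i) (w l) (w j) (w k)) \<or>
     (\<forall>i j k l. i < j \<longrightarrow> j < k \<longrightarrow> k < l \<longrightarrow> l < m \<longrightarrow> X (w i) (w k) (w j) (w l))"
    by (rule nested_or_alternating_clique[OF fin m big[unfolded ramsey_threshold_def]])
  have cr: "cross G {w i, w j} {w k, w l} \<longleftrightarrow> distinct [w i, w j, w k, w l] \<and> X (w i) (w j) (w k) (w l)"
    if "i < j" "j < m" "k < l" "l < m" for i j k l
    unfolding X_def by (rule cross_iff[OF G]) (use that w inj_on_eq_iff[OF w(1)] in auto)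
  from pat show ?thesis
  proof
    assume nest: "\<forall>i j k l. i < j \<longrightarrow> j < k \<longrightarrow> k < l \<longrightarrow> l < m \<longrightarrow> X (w i) (w l) (w j) (w k)"
    show ?thesis
      by (rule twisted_has_pattern[OF G w]) (use cr nested_crossing[OF w nest[rule_format]] in auto)
  next
    assume alt: "\<forall>i j k l. i < j \<longrightarrow> j < k \<longrightarrow> k < l \<longrightarrow> l < m \<longrightarrow> X (w i) (w k) (w j) (w l)"
    show ?thesis
      by (rule convex_has_pattern[OF G w]) (use cr alternating_crossing[OF w alt[rule_format]] in auto)
  qed
qed

text \<open>This covers those \<open>n\<close> that are below the threshold of every positive size;
  for a single vertex there are no crossings to check.\<close>

lemma nonempty_graph_has_pattern:
  assumes "simple_topological_graph G" "complete_graph G" "verts G \<noteq> {}"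
  shows "has_pattern G 1"
proof -
  obtain v where "v \<in> verts G" using assms(3) by blast
  then show ?thesis using twisted_has_pattern[OF assms(1,2), of "\<lambda>_. v" 1] by (auto simp: lessThan_Suc)
qed

text \<open>The argument is \<open>m + 1\<close> because the bound is applied to the first size that
  \<open>n\<close> does not reach. The 35 is 32 from the exponent \<open>16 * (M ^ 4 + 1)\<close>,
  at most \<open>32 * M ^ 4\<close>, plus 3 from the factor 8.\<close>

definition log_bound :: "nat \<Rightarrow> real" where
  "log_bound m = 35 * real (m + 1) ^ 4 * log 2 (real (m + 1))"

lemma log_ramsey_threshold:
  assumes "m \<ge> 1"
  shows "log 2 (real (ramsey_threshold (m + 1))) \<le> log_bound m"
proof -
  define M where "M = m + 1"
  \<comment> \<open>From \<open>M \<ge> 2\<close> the constants are absorbed into powers of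
    \<open>M\<close>: 16 into \<open>M ^ 4\<close> and 8 into \<open>M ^ 3\<close>.\<close>
  have M: "M \<ge> 2" using assms unfolding M_def by simp
  have M4: "M ^ 4 \<ge> 16" using power_mono[OF M, of 4] by simp
  have "M ^ 4 + 2 \<le> 2 * M ^ 4" using M4 by simp
  then have "(M ^ 4 + 2) ^ 3 \<le> (2 * M ^ 4) ^ 3" by (rule power_mono) simp
  also have "\<dots> = 8 * M ^ 12" by (simp add: power_mult_distrib flip: power_mult)
  finally have "(M ^ 4 + 2) ^ 3 \<le> 8 * M ^ 12" .
  moreover have "M ^ 12 \<ge> 1" using M by (intro one_le_power) simp
  ultimately have "(M ^ 4 + 2) ^ 3 + 1 \<le> 16 * M ^ 12" by linarith
  also have "\<dots> \<le> M ^ 4 * M ^ 12" by (rule mult_right_mono[OF M4]) simp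
  also have "\<dots> = M ^ 16" by (simp flip: power_add)
  finally have "((M ^ 4 + 2) ^ 3 + 1) ^ (M ^ 4 + 1) \<le> (M ^ 16) ^ (M ^ 4 + 1)" by (rule power_mono) simp
  also have "\<dots> = M ^ (16 * (M ^ 4 + 1))" by (simp only: power_mult)
  also have "\<dots> \<le> M ^ (32 * M ^ 4)" using M M4 by (intro power_increasing) auto
  finally have "ramsey_threshold M \<le> 2 * M ^ (32 * M ^ 4) + 3" unfolding ramsey_threshold_def by simp
  also have "\<dots> \<le> 8 * M ^ (32 * M ^ 4)"
  proof -
    have "M ^ (32 * M ^ 4) \<ge> 1" using M by (intro one_le_power) simp
    then show ?thesis by linarith
  qed
  also have "\<dots> \<le> M ^ 3 * M ^ (32 * M ^ 4)"
    by (rule mult_right_mono) (use power_mono[OF M, of 3] in simp_all)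
  also have "\<dots> = M ^ (3 + 32 * M ^ 4)" by (simp add: power_add)
  also have "\<dots> \<le> M ^ (35 * M ^ 4)" using M M4 by (intro power_increasing) auto
  finally have le: "real (ramsey_threshold M) \<le> real M ^ (35 * M ^ 4)" by (metis of_nat_le_iff of_nat_power)
  have "ramsey_threshold M > 0" unfolding ramsey_threshold_def by simp
  then have "log 2 (real (ramsey_threshold M)) \<le> log 2 (real M ^ (35 * M ^ 4))"
    using le M by simp
  also have "\<dots> = real (35 * M ^ 4) * log 2 (real M)" using M by (simp add: log_nat_power)
  also have "\<dots> = log_bound m" unfolding log_bound_def M_def by simp
  finally show ?thesis unfolding M_def .
qed

text \<open>The inserted 1 makes the maximum exist and be positive even if \<open>n\<close> reaches
  no threshold.\<close>

definition best_size :: "nat \<Rightarrow> nat" where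
  "best_size n = Max (insert 1 {m. ramsey_threshold m \<le> n})"

text \<open>Chosen so that \<open>log_bound m powr exponent m = m\<close>. Its limit is 1/4, as
  \<open>log_bound m\<close> is a fourth power up to constant and logarithmic factors.\<close>

definition exponent :: "nat \<Rightarrow> real" where
  "exponent m = ln (real m) / ln (log_bound m)"

lemma ramsey_threshold_ge: "m \<le> ramsey_threshold m"
proof -
  have "m \<le> m ^ 4 + 1"
  proof (cases "m = 0")
    case False
    then have "m \<le> m ^ 4" by (intro self_le_power) auto
    then show ?thesis by simp
  qed simp
  also have "\<dots> < 2 ^ (m ^ 4 + 1)" by (rule less_exp)
  also have "(2::nat) ^ (m ^ 4 + 1) \<le> ((m ^ 4 + 2) ^ 3 + 1) ^ (m ^ 4 + 1)"
  proof (rule power_mono)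
    have "(2::nat) ^ 3 \<le> (m ^ 4 + 2) ^ 3" by (rule power_mono) auto
    then show "(2::nat) \<le> (m ^ 4 + 2) ^ 3 + 1" by simp
  qed simp
  also have "\<dots> \<le> ramsey_threshold m" unfolding ramsey_threshold_def by simp
  finally show ?thesis by simp
qed

lemma finite_thresholds: "finite {m. ramsey_threshold m \<le> n}"
  by (rule finite_subset[of _ "{..n}"]) (use ramsey_threshold_ge order_trans in auto)

lemma best_size_ge: "ramsey_threshold m \<le> n \<Longrightarrow> m \<le> best_size n"
  unfolding best_size_def using finite_thresholds by (intro Max_ge) auto

lemma best_size_pos: "best_size n \<ge> 1"
  unfolding best_size_def using finite_thresholds by (intro Max_ge) auto

lemma has_pattern_best_size:
  assumes "simple_topological_graph G" "complete_graph G" "card (verts G) = n" "n \<ge> 2"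
  shows "has_pattern G (best_size n)"
proof -
  have "best_size n \<in> insert 1 {m. ramsey_threshold m \<le> n}"
    unfolding best_size_def using finite_thresholds by (intro Max_in) auto
  then consider "best_size n = 1" | "ramsey_threshold (best_size n) \<le> n" by auto
  then show ?thesis
  proof cases
    case 1
    then show ?thesis using nonempty_graph_has_pattern[OF assms(1,2)] assms by fastforce
  next
    case 2
    then show ?thesis using large_graph_has_pattern[OF assms(1,2) best_size_pos] assms by simp
  qed
qed

lemma best_size_at_top: "filterlim best_size at_top sequentially"
  unfolding filterlim_at_top
proof
  fix m
  show "eventually (\<lambda>n. m \<le> best_size n) sequentially"
    using eventually_ge_at_top[of "ramsey_threshold m"] by eventually_elim (rule best_size_ge)
qed

lemma exponent_limit: "exponent \<longlonglongrightarrow> 1 / 4"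
  unfolding exponent_def log_bound_def by real_asymp

text \<open>Maximality of \<open>m = best_size n\<close> puts \<open>n\<close> below the threshold
  of \<open>m + 1\<close>, so \<open>log 2 n\<close> is at most \<open>log_bound m\<close>, whose
  power with \<open>exponent m\<close> is \<open>m\<close>.\<close>

lemma best_size_lower_bound:
  assumes n: "n \<ge> 2" and e: "e \<le> exponent (best_size n)"
  shows "log 2 (real n) powr e \<le> real (best_size n)"
proof -
  define m where "m = best_size n"
  have m: "m \<ge> 1" unfolding m_def by (rule best_size_pos)
  have "n < ramsey_threshold (m + 1)"
    using best_size_ge[of "m + 1" n] unfolding m_def by linarith
  then have "log 2 (real n) \<le> log 2 (real (ramsey_threshold (m + 1)))" using n by simp
  also have "\<dots> \<le> log_bound m" by (rule log_ramsey_threshold[OF m])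
  finally have le: "log 2 (real n) \<le> log_bound m" .
  have l1: "log 2 (real n) \<ge> 1" using n by simp
  have "log_bound m > 1"
  proof -
    have "real (m + 1) ^ 4 \<ge> 1" by (rule one_le_power) simp
    moreover have "log 2 (real (m + 1)) \<ge> 1" using m by simp
    ultimately have "real (m + 1) ^ 4 * log 2 (real (m + 1)) \<ge> 1 * 1" by (intro mult_mono) auto
    then show ?thesis unfolding log_bound_def by linarith
  qed
  then have lb: "ln (log_bound m) > 0" "log_bound m > 0" by auto
  \<comment> \<open>Raising the exponent is monotone because the base is at least 1, which is where
    \<open>n \<ge> 2\<close> is used.\<close>
  have "log 2 (real n) powr e \<le> log 2 (real n) powr exponent m"
    using l1 e unfolding m_def by (intro powr_mono) auto
  also have "\<dots> \<le> log_bound m powr exponent m"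
    using l1 le m lb unfolding exponent_def by (intro powr_mono2) auto
  also have "\<dots> = real m" using lb m unfolding powr_def exponent_def by simp
  finally show ?thesis unfolding m_def .
qed

theorem theorem2:
  shows "\<exists>\<epsilon> :: nat \<Rightarrow> real. \<epsilon> \<longlonglongrightarrow> 0 \<and>
    (\<forall>n\<ge>2. \<forall>G. simple_topological_graph G \<and> complete_graph G \<and> card (verts G) = n \<longrightarrow>
      (\<exists>m H. topological_subgraph H G \<and> card (verts H) = m \<and>
         real m \<ge> log 2 (real n) powr (1/4 - \<epsilon> n) \<and>
         ((\<exists>C. complete_convex_geometric m C \<and> weakly_isomorphic H C) \<or>
          (\<exists>T. complete_twisted m T \<and> weakly_isomorphic H T))))"
proof (intro exI[of _ "\<lambda>n. 1 / 4 - exponent (best_size n)"] conjI allI impI)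
  \<comment> \<open>\<epsilon> is the exact deficit of the exponent at \<open>best_size n\<close>,
    so the size bound holds for every \<open>n \<ge> 2\<close> and the limit is that of
    \<open>exponent\<close> along \<open>best_size\<close>.\<close>
  have "(\<lambda>n. exponent (best_size n)) \<longlonglongrightarrow> 1 / 4"
    by (rule filterlim_compose[OF exponent_limit best_size_at_top])
  then show "(\<lambda>n. 1 / 4 - exponent (best_size n)) \<longlonglongrightarrow> 0"
    using tendsto_diff[OF tendsto_const[of "1 / 4 :: real"]] by fastforce
  fix n G assume n: "2 \<le> n" and G: "simple_topological_graph G \<and> complete_graph G \<and> card (verts G) = n"
  then have "has_pattern G (best_size n)" using has_pattern_best_size by blast
  moreover have "log 2 (real n) powr (1 / 4 - (1 / 4 - exponent (best_size n))) \<le> real (best_size n)"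
    by (rule best_size_lower_bound[OF n]) simp
  ultimately show "\<exists>m H. topological_subgraph H G \<and> card (verts H) = m \<and>
         real m \<ge> log 2 (real n) powr (1/4 - (1 / 4 - exponent (best_size n))) \<and>
         ((\<exists>C. complete_convex_geometric m C \<and> weakly_isomorphic H C) \<or>
          (\<exists>T. complete_twisted m T \<and> weakly_isomorphic H T))"
    unfolding has_pattern_def by blast
qed

end
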